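(* For any $R>0$ there exist constants $\delta_0>0$, $C>0$ and $c>0$ such that the following holds. Let $\Omega_0\subset\mathbb{R}^2$ be a bounded open set with $\Omega_0\subset B_R$ and $|D\bigtriangleup\Omega_0|<\delta_0$, and consider the solution of the two-dimensional incompressible Euler equation in vorticity form with initial data $\theta_0=\mathbf{1}_{\Omega_0}$, with associated travel distances $d_x(t)$. Then both of the following properties hold. (I) For any $\delta>0$ satisfying $|D\bigtriangleup\Omega_0|\le\delta\le\delta_0$, there exists a set $H_\delta\subset\Omega_0$ such that $|H_\delta|\ge|\Omega_0|-C\delta^{1/4}$ and $$\limsup_{t\to\infty}\frac{d_x(t)}{t}\ge c\,\delta^{1/2}\qquad\text{for every }x\in H_\delta.$$ (II) For any $\delta>0$ satisfying $|D\bigtriangleup\Omega_0|\le\delta\le\delta_0$ and for each $T>0$, there exists a set $H_{\delta,T}\subset\Omega_0$ such that $|H_{\delta,T}|\ge|\Omega_0|-C\delta^{1/4}$ and $$\frac{d_x(T)}{T}\ge c\,\delta^{1/4}\qquad\text{for every }x\in H_{\delta,T}.$$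
   Context: Notation: for $r>0$, $B_r:=\{x\in\mathbb{R}^2 : |x|<r\}$, and $D:=B_1$ is the open unit disk. For sets $A,B\subset\mathbb{R}^2$, $A\bigtriangleup B:=(A\setminus B)\cup(B\setminus A)$ is the symmetric difference, $|A|$ is the Lebesgue measure of a (measurable) set $A$, and $\mathbf{1}_A$ is the characteristic function of $A$. Euler equation: the incompressible 2D Euler equation in vorticity form on the whole plane is $$\partial_t\theta+u\cdot\nabla\theta=0\quad (x\in\mathbb{R}^2,\ t>0),\qquad \theta|_{t=0}=\theta_0,$$ where $u(t,\cdot)=K*\theta(t,\cdot)$ (convolution in space) and $K(x):=\frac{1}{2\pi}\frac{x^\perp}{|x|^2}=\frac{1}{2\pi}\left(-\frac{x_2}{|x|^2},\frac{x_1}{|x|^2}\right)$. For $\theta_0\in L^1\cap L^\infty(\mathbb{R}^2)$, "the solution" is the unique global-in-time weak solution given by Yudovich's theory. Particle trajectories and vortex patches: for the solution with $\theta_0=\mathbf{1}_{\Omega_0}$, $\Omega_0$ bounded and open, the trajectory $\phi_x(\cdot)$ of the particle initially at $x\in\mathbb{R}^2$ is the unique solution of $$\frac{d}{dt}\phi_x(t)=u(t,\phi_x(t))\ \text{ for } t>0,\qquad \phi_x(0)=x$$ (well defined since $u$ is log-Lipschitz in space). The solution has the form $\theta(t)=\mathbf{1}_{\Omega_t}$ with $\Omega_t=\{\phi_x(t) : x\in\Omega_0\}$. Travel distance: for $t>0$ and $x\in\mathbb{R}^2$, $$d_x(t):=\int_0^t|u(s,\phi_x(s))|\,ds.$$ 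*)

theory Defs
  imports "HOL-Analysis.Analysis"
begin

text \<open>
  The two-dimensional incompressible Euler equation in vorticity form on the whole plane,
  for initial vorticity in $L^1 \cap L^\infty$ (Yudovich class).
\<close>

definition perp :: "real^2 \<Rightarrow> real^2" where
  "perp x = vector [- x$2, x$1]"

definition biot_savart_kernel :: "real^2 \<Rightarrow> real^2" where
  "biot_savart_kernel x = (1 / (2 * pi)) *\<^sub>R ((1 / (norm x)\<^sup>2) *\<^sub>R perp x)"

text \<open>The convolution $u(t,\cdot) = K * \theta(t,\cdot)$.\<close>

definition velocity :: "(real \<Rightarrow> real^2 \<Rightarrow> real) \<Rightarrow> real \<Rightarrow> real^2 \<Rightarrow> real^2" where
  "velocity \<theta> t x = (LINT y|lebesgue. \<theta> t y *\<^sub>R biot_savart_kernel (x - y))"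

text \<open>
  \<open>test_function \<psi> \<psi>\<^sub>t \<psi>\<^sub>x\<close>: \<open>\<psi>\<close> is $C^1$ with compact support in space-time,
  with time derivative \<open>\<psi>\<^sub>t\<close> and spatial gradient \<open>\<psi>\<^sub>x\<close>. The support may meet every
  time \<open>t \<ge> 0\<close>; the weak formulation below therefore has boundary terms at both ends of \<open>[0,T]\<close>.
\<close>

definition test_function ::
  "(real \<Rightarrow> real^2 \<Rightarrow> real) \<Rightarrow> (real \<Rightarrow> real^2 \<Rightarrow> real) \<Rightarrow> (real \<Rightarrow> real^2 \<Rightarrow> real^2) \<Rightarrow> bool" where
  "test_function \<psi> \<psi>\<^sub>t \<psi>\<^sub>x \<longleftrightarrow>
     (\<forall>t x. ((\<lambda>(t, x). \<psi> t x) has_derivative (\<lambda>(s, h). \<psi>\<^sub>t t x * s + \<psi>\<^sub>x t x \<bullet> h)) (at (t, x))) \<and>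
     continuous_on UNIV (\<lambda>(t, x). \<psi>\<^sub>t t x) \<and>
     continuous_on UNIV (\<lambda>(t, x). \<psi>\<^sub>x t x) \<and>
     (\<exists>S. compact S \<and> (\<forall>t x. (t, x) \<notin> S \<longrightarrow> \<psi> t x = 0))"

text \<open>
  Global weak solutions in Yudovich's class: $\theta \in L^\infty([0,T]; L^1 \cap L^\infty)$ for
  every \<open>T\<close>, and for every \<open>T > 0\<close> and every test function \<open>\<psi>\<close>
  \[ \int \theta(T)\psi(T)\,dx - \int \theta(0)\psi(0)\,dx
       = \int_0^T \int \theta\,(\partial_t\psi + u\cdot\nabla\psi)\,dx\,dt . \]
  Imposing this for every \<open>T\<close> determines \<open>\<theta> t\<close> almost everywhere at \<^emph>\<open>every\<close>
  time, so that \<open>velocity \<theta> t\<close> is meaningful for every \<open>t\<close>.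
\<close>

definition euler_weak_solution :: "(real^2 \<Rightarrow> real) \<Rightarrow> (real \<Rightarrow> real^2 \<Rightarrow> real) \<Rightarrow> bool" where
  "euler_weak_solution \<theta>\<^sub>0 \<theta> \<longleftrightarrow>
     (\<lambda>(t, x). \<theta> t x) \<in> borel_measurable (lebesgue_on ({0..} \<times> UNIV)) \<and>
     (\<forall>T>0. \<exists>M. \<forall>t\<in>{0..T}. integrable lebesgue (\<theta> t) \<and>
        (LINT x|lebesgue. \<bar>\<theta> t x\<bar>) \<le> M \<and> (AE x in lebesgue. \<bar>\<theta> t x\<bar> \<le> M)) \<and>
     (AE x in lebesgue. \<theta> 0 x = \<theta>\<^sub>0 x) \<and>
     (\<forall>T>0. \<forall>\<psi> \<psi>\<^sub>t \<psi>\<^sub>x. test_function \<psi> \<psi>\<^sub>t \<psi>\<^sub>x \<longrightarrow>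
        (LINT x|lebesgue. \<theta> T x * \<psi> T x) - (LINT x|lebesgue. \<theta> 0 x * \<psi> 0 x) =
        (LINT t:{0..T}|lebesgue. (LINT x|lebesgue.
           \<theta> t x * (\<psi>\<^sub>t t x + velocity \<theta> t x \<bullet> \<psi>\<^sub>x t x))))"

text \<open>\<open>\<phi> x\<close> is the trajectory of the particle initially at \<open>x\<close>.\<close>

definition particle_trajectories ::
  "(real \<Rightarrow> real^2 \<Rightarrow> real^2) \<Rightarrow> (real^2 \<Rightarrow> real \<Rightarrow> real^2) \<Rightarrow> bool" where
  "particle_trajectories u \<phi> \<longleftrightarrow>
     (\<forall>x. \<phi> x 0 = x \<and> continuous_on {0..} (\<phi> x) \<and>
        (\<forall>t>0. (\<phi> x has_vector_derivative u t (\<phi> x t)) (at t)))"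

definition travel_distance ::
  "(real \<Rightarrow> real^2 \<Rightarrow> real^2) \<Rightarrow> (real^2 \<Rightarrow> real \<Rightarrow> real^2) \<Rightarrow> real^2 \<Rightarrow> real \<Rightarrow> real" where
  "travel_distance u \<phi> x t = (LINT s:{0..t}|lebesgue. norm (u s (\<phi> x s)))"

end

theory Submission imports Defs begin

text \<open>
  The idea is to compare the solution with the disc, first in \<open>L\<^sup>1\<close> and then in velocity, uniformly in time.

  The solution at time \<open>s\<close> has values in \<open>[0, 1]\<close>, the mass of the initial patch and its second moment. Among functions
  \<open>f\<close> with values in \<open>[0, 1]\<close>, the integral of \<open>(|x|\<^sup>2 - 1) (f - 1\<^sub>D)\<close> is an \<open>L\<^sup>1\<close> distance from the disc \<open>D\<close> with a weight
  that degenerates only at the unit circle. It is conserved and initially of order \<open>\<delta>\<close>, so the plain \<open>L\<^sup>1\<close> distance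
  stays of order \<open>\<delta>^(1/2)\<close> for all times (\<open>vort_stability\<close>). A vorticity that is bounded by 1 and has \<open>L\<^sup>1\<close> norm
  \<open>m\<close> induces a velocity of order \<open>m^(1/2)\<close> (\<open>biot_savart_bound_gen\<close>); hence the velocity stays within order
  \<open>\<delta>^(1/4)\<close> of that of the disc, which in \<open>D\<close> is at least a multiple of \<open>|x|\<close> (\<open>disc_velocity_lower\<close>). On the annulus
  \<open>K \<delta>^(1/4) \<le> |x| \<le> 1\<close> particles therefore move with speed at least \<open>\<delta>^(1/4)\<close>. At every time all but an area of order
  \<open>\<delta>^(1/2)\<close> of the patch is in this annulus, so by Fubini and Markov all but such an area of particles
  spends half of any given time interval there (\<open>most_particles_travel\<close>). This is (II). For (I) one takes the particles that have
  this property for infinitely many integer times; the lower bound for the measure passes to the set of these (\<open>limsup_set_measure\<close>). One may take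
  \<open>\<delta>\<^sub>0 = 1\<close>.

  Both the bounds \<open>0 \<le> \<theta> \<le> 1\<close> and the passage from the vorticity to the particles rest on the fact that the weak solution is
  transported by the trajectories, that is, on uniqueness for the transport equation with a log-Lipschitz
  velocity. It is proved by duality. Truncating the Biot-Savart kernel at scale \<open>2^(-n)\<close> changes the velocity by order
  \<open>2^(-n)\<close>, whereas the truncated velocity has Lipschitz constant of order \<open>n\<close> (\<open>biot_savart_approx\<close>, \<open>reg_velocity_grad_bound\<close>). A test
  function is carried backwards in time by explicit Euler steps of the truncated velocity. Its gradient grows by a factor
  \<open>exp (c n \<tau>)\<close> over a time \<open>\<tau>\<close>, which the error \<open>2^(-n)\<close> beats if \<open>\<tau>\<close> is small (\<open>short_time_approximation\<close>); longer
  times follow by iteration, because the smallness of \<open>\<tau>\<close> depends only on the bound for the vorticity (\<open>transported\<close>).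
  The test function for a single step interpolates in time between a function and its composition with the Euler
  map (\<open>vort_step\<close>), so gradients are all that has to be controlled. Truncation keeps the velocity divergence free, and
  the determinant of an Euler map differs from 1 only to second order in the step (\<open>area_step\<close>), whence the flow
  does not increase areas.
\<close>

section \<open>Weakly singular integrals in the plane\<close>

lemma integral_le_of_nn_integral_le:
  fixes g :: "'a \<Rightarrow> real"
  assumes "g \<in> borel_measurable M" "\<And>y. 0 \<le> g y" "(\<integral>\<^sup>+y. ennreal (g y) \<partial>M) \<le> ennreal c" "0 \<le> c"
  shows "integrable M g" "integral\<^sup>L M g \<le> c"
proof -
  show int: "integrable M g"
    using assms by (intro integrableI_bounded) (auto intro: le_less_trans)
  have "ennreal (integral\<^sup>L M g) \<le> ennreal c"
    using nn_integral_eq_integral[OF int] assms by simp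
  then show "integral\<^sup>L M g \<le> c" using assms(4) by (simp add: ennreal_le_iff)
qed

lemma nn_integral_weight_le:
  fixes f :: "'a \<Rightarrow> real" and g :: "'a \<Rightarrow> ennreal"
  assumes "AE y in N. \<bar>f y\<bar> \<le> M" "g \<in> borel_measurable N" "0 \<le> M"
  shows "(\<integral>\<^sup>+y. ennreal \<bar>f y\<bar> * g y \<partial>N) \<le> ennreal M * (\<integral>\<^sup>+y. g y \<partial>N)"
proof -
  have "(\<integral>\<^sup>+y. ennreal \<bar>f y\<bar> * g y \<partial>N) \<le> (\<integral>\<^sup>+y. ennreal M * g y \<partial>N)"
    using assms(1) by (intro nn_integral_mono_AE) (auto intro!: mult_right_mono ennreal_leI)
  then show ?thesis using assms(2) by (simp add: nn_integral_cmult)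
qed

lemma emeasure_ball_plane:
  fixes x :: "real^2" assumes "0 \<le> r" shows "emeasure lebesgue (ball x r) = ennreal (pi * r\<^sup>2)"
  using emeasure_ball[of r x] assms by (simp add: unit_ball_vol_2)

text \<open>
  A point with \<open>\<rho>/2^(j+1) \<le> |x - y| < \<rho>/2^j\<close> lies in the \<open>j\<close>-th disc, and the \<open>j\<close>-th term alone
  dominates \<open>1/|x - y|\<close>. This majorant replaces polar coordinates: integrating it takes only the
  areas of discs.
\<close>

lemma near_weight_dyadic:
  assumes "0 < \<rho>"
  shows "ennreal (indicator (ball x \<rho>) y / norm (x - y)) 
     \<le> (\<Sum>k. ennreal (2 ^ (k+1) / \<rho>) * indicator (ball x (\<rho> / 2 ^ k)) (y::real^2))"
proof (cases "y \<in> ball x \<rho> \<and> y \<noteq> x")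
  case False then show ?thesis by (auto simp: ennreal_neg)
next
  case True
  define d where "d = norm (x - y)"
  have d: "0 < d" "d < \<rho>" using True by (auto simp: d_def dist_norm)
  have "\<exists>k. \<rho> / 2 ^ k \<le> d" 
  proof -
    obtain k where "\<rho> / d < 2 ^ k" using real_arch_pow[of 2 "\<rho>/d"] by auto
    then show ?thesis using d by (intro exI[of _ k]) (auto simp: field_simps)
  qed
  then obtain k where k: "\<rho> / 2 ^ k \<le> d" and km: "\<And>j. j < k \<Longrightarrow> \<not> \<rho> / 2 ^ j \<le> d"
    using exists_least_iff[of "\<lambda>k. \<rho> / 2 ^ k \<le> d"] by auto
  have "k \<noteq> 0" using k d by (cases k) auto
  then obtain j where j: "k = Suc j" using not0_implies_Suc by auto
  have jd: "d < \<rho> / 2 ^ j" using km[of j] j by auto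
  have "ennreal (indicator (ball x \<rho>) y / norm (x - y)) = ennreal (1 / d)"
    using True by (simp add: d_def)
  also have "\<dots> \<le> ennreal (2 ^ (j+1) / \<rho>) * indicator (ball x (\<rho> / 2 ^ j)) y"
    using jd k j d assms by (auto simp: d_def dist_norm indicator_def intro!: ennreal_leI) (auto simp: field_simps)
  also have "\<dots> = (\<Sum>k\<in>{j}. ennreal (2 ^ (k+1) / \<rho>) * indicator (ball x (\<rho> / 2 ^ k)) y)" by (subst sum.insert) auto
  also have "\<dots> \<le> (\<Sum>k. ennreal (2 ^ (k+1) / \<rho>) * indicator (ball x (\<rho> / 2 ^ k)) y)"
    by (rule sum_le_suminf) auto
  finally show ?thesis .
qed

lemma nn_integral_near_weight:
  assumes "0 < \<rho>"
  shows "(\<integral>\<^sup>+y. ennreal (indicator (ball x \<rho>) y / norm (x - (y::real^2))) \<partial>lebesgue) \<le> ennreal (4 * pi * \<rho>)"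
proof -
  have "(\<integral>\<^sup>+y. ennreal (indicator (ball x \<rho>) y / norm (x - (y::real^2))) \<partial>lebesgue)
     \<le> (\<integral>\<^sup>+y. (\<Sum>k. ennreal (2 ^ (k+1) / \<rho>) * indicator (ball x (\<rho> / 2 ^ k)) y) \<partial>lebesgue)"
    by (intro nn_integral_mono near_weight_dyadic assms)
  also have "\<dots> = (\<Sum>k. \<integral>\<^sup>+y. ennreal (2 ^ (k+1) / \<rho>) * indicator (ball x (\<rho> / 2 ^ k)) y \<partial>lebesgue)"
    by (rule nn_integral_suminf) (intro borel_measurable_times_ennreal borel_measurable_const borel_measurable_indicator, auto)
  also have "\<dots> = (\<Sum>k. ennreal (2 ^ (k+1) / \<rho>) * ennreal (pi * (\<rho> / 2 ^ k)\<^sup>2))"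
    using assms by (intro suminf_cong, subst nn_integral_cmult_indicator) (auto simp: emeasure_ball_plane simp del: emeasure_completion)
  also have "\<dots> = (\<Sum>k. ennreal (4 * pi * \<rho> * (1/2)^(Suc k)))"
    using assms by (intro suminf_cong) (simp add: ennreal_mult[symmetric] power2_eq_square field_simps)
  also have "\<dots> = ennreal (4 * pi * \<rho> * 1)"
    using assms by (intro suminf_ennreal_eq sums_mult power_half_series) auto
  finally show ?thesis by simp
qed

text \<open>
  The dyadic majorant gives \<open>4 pi \<rho>\<close> where the exact integral of \<open>1/|z|\<close> over the disc is
  \<open>2 pi \<rho>\<close>; only the order in \<open>\<rho>\<close> matters.
\<close>

lemma near_potential_bound:
  fixes f :: "real^2 \<Rightarrow> real"
  assumes f: "f \<in> borel_measurable lebesgue" and M: "AE y in lebesgue. \<bar>f y\<bar> \<le> M" "0 \<le> M" and \<rho>: "0 < \<rho>"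
  shows "integrable lebesgue (\<lambda>y. \<bar>f y\<bar> * (indicator (ball x \<rho>) y / norm (x - y)))" (is ?I)
    and "(LINT y|lebesgue. \<bar>f y\<bar> * (indicator (ball x \<rho>) y / norm (x - y))) \<le> 4 * pi * M * \<rho>" (is ?L)
proof -
  have [measurable]: "(\<lambda>y. norm (x - y)) \<in> borel_measurable lebesgue" for x :: "real^2"
    by (intro measurable_completion) auto
  have [measurable]: "Measurable.pred lebesgue (\<lambda>y. y \<in> ball x r)" for x :: "real^2" and r
    by (intro measurable_completion) auto
  note f[measurable]
  have "(\<integral>\<^sup>+y. ennreal (\<bar>f y\<bar> * (indicator (ball x \<rho>) y / norm (x - y))) \<partial>lebesgue)
     = (\<integral>\<^sup>+y. ennreal \<bar>f y\<bar> * ennreal (indicator (ball x \<rho>) y / norm (x - y)) \<partial>lebesgue)"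
    by (intro nn_integral_cong) (simp add: ennreal_mult[symmetric])
  also have "\<dots> \<le> ennreal M * (\<integral>\<^sup>+y. ennreal (indicator (ball x \<rho>) y / norm (x - y)) \<partial>lebesgue)"
    by (intro nn_integral_weight_le M) measurable
  also have "\<dots> \<le> ennreal M * ennreal (4 * pi * \<rho>)"
    by (intro mult_left_mono nn_integral_near_weight \<rho>) auto
  also have "\<dots> = ennreal (4 * pi * M * \<rho>)"
    using M \<rho> by (simp add: ennreal_mult[symmetric] mult_ac)
  finally have *: "(\<integral>\<^sup>+y. ennreal (\<bar>f y\<bar> * (indicator (ball x \<rho>) y / norm (x - y))) \<partial>lebesgue) \<le> ennreal (4 * pi * M * \<rho>)" .
  show ?I by (rule integral_le_of_nn_integral_le[OF _ _ *]) (use M \<rho> in auto)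
  show ?L by (rule integral_le_of_nn_integral_le[OF _ _ *]) (use M \<rho> in auto)
qed

text \<open>
  Interpolation between the two norms of \<open>f\<close>: the sup norm pays for the singularity, the
  \<open>L\<^sup>1\<close> norm for the rest. With \<open>\<rho>\<close> of order \<open>sqrt (m/M)\<close> this makes the velocity of \<open>f\<close> of order
  \<open>sqrt (m M)\<close>, which is how an \<open>L\<^sup>1\<close> distance of order \<open>\<delta>^(1/2)\<close> becomes a velocity error of order
  \<open>\<delta>^(1/4)\<close>.
\<close>

lemma potential_bound:
  fixes f :: "real^2 \<Rightarrow> real"
  assumes f: "integrable lebesgue f" and m: "(LINT y|lebesgue. \<bar>f y\<bar>) \<le> m"
    and M: "AE y in lebesgue. \<bar>f y\<bar> \<le> M" "0 \<le> M" and \<rho>: "0 < \<rho>"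
  shows "integrable lebesgue (\<lambda>y. \<bar>f y\<bar> / norm (x - y))" (is ?I)
    and "(LINT y|lebesgue. \<bar>f y\<bar> / norm (x - y)) \<le> 4 * pi * M * \<rho> + m / \<rho>" (is ?L)
proof -
  have [measurable]: "(\<lambda>y. norm (x - y)) \<in> borel_measurable lebesgue" for x :: "real^2"
    by (intro measurable_completion) auto
  have [measurable]: "Measurable.pred lebesgue (\<lambda>y. y \<in> ball x r)" for x :: "real^2" and r
    by (intro measurable_completion) auto
  have fm[measurable]: "f \<in> borel_measurable lebesgue" using f by auto
  let ?n = "\<lambda>y. \<bar>f y\<bar> * (indicator (ball x \<rho>) y / norm (x - y))"
  note n = near_potential_bound[OF fm M \<rho>, of x]
  have i: "integrable lebesgue (\<lambda>y. ?n y + \<bar>f y\<bar> / \<rho>)" using n f by auto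
  have le: "\<bar>f y\<bar> / norm (x - y) \<le> ?n y + \<bar>f y\<bar> / \<rho>" for y
    using \<rho> by (cases "y \<in> ball x \<rho>") (auto simp: dist_norm divide_left_mono intro!: divide_left_mono mult_pos_pos)
  show I: ?I
    by (rule Bochner_Integration.integrable_bound[OF i]) (use le in \<open>auto intro!: AE_I2 simp: abs_of_nonneg order_trans[OF _ abs_ge_self]\<close>)
  have "(LINT y|lebesgue. \<bar>f y\<bar> / norm (x - y)) \<le> (LINT y|lebesgue. ?n y + \<bar>f y\<bar> / \<rho>)"
    using I i le by (intro integral_mono) auto
  also have "\<dots> = (LINT y|lebesgue. ?n y) + (LINT y|lebesgue. \<bar>f y\<bar>) / \<rho>"
    using n f by (subst Bochner_Integration.integral_add) auto
  also have "\<dots> \<le> 4 * pi * M * \<rho> + m / \<rho>"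
    using n m \<rho> by (intro add_mono divide_right_mono) auto
  finally show ?L .
qed

text \<open>
  The discs of radius \<open>2^(-k)\<close>, \<open>k \<le> n\<close>, cover \<open>|x - y| < 1\<close> down to the truncation scale; the
  summand 1 takes care of \<open>|x - y| \<ge> 1\<close>.
\<close>

lemma far_weight_dyadic:
  "1 / max ((norm (x - (y::real^2)))\<^sup>2) ((1/4)^n) \<le> 1 + (\<Sum>k\<le>n. 4 ^ (k+1) * indicator (ball x ((1/2) ^ k)) y)"
proof (cases "norm (x - y) < 1")
  case False
  then have "1 \<le> (norm (x - y))\<^sup>2" by simp
  then have "1 / max ((norm (x - y))\<^sup>2) ((1/4)^n) \<le> 1" by (simp add: le_max_iff_disj)
  also have "\<dots> \<le> 1 + (\<Sum>k\<le>n. 4 ^ (k+1) * indicator (ball x ((1/2) ^ k)) y)"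
    by (simp add: sum_nonneg)
  finally show ?thesis .
next
  case True
  have ex: "\<exists>k\<le>n. norm (x - y) < (1/2)^k \<and> 1 / max ((norm (x - y))\<^sup>2) ((1/4)^n) \<le> 4^(k+1)"
  proof (induction n)
    case 0 show ?case using True by (auto intro!: exI[of _ 0] simp: divide_le_eq)
  next
    case (Suc n)
    then obtain k where k: "k \<le> n" "norm (x - y) < (1/2)^k" "1 / max ((norm (x - y))\<^sup>2) ((1/4)^n) \<le> 4^(k+1)" by auto
    show ?case
    proof (cases "norm (x - y) < (1/2)^(Suc n)")
      case True
      have "1 / max ((norm (x - y))\<^sup>2) ((1/4)^Suc n) \<le> 1 / ((1/4)^Suc n)"
        by (intro divide_left_mono mult_pos_pos) (auto simp: less_max_iff_disj)
      also have "\<dots> \<le> 4 ^ (Suc n + 1)" by (simp add: power_one_over field_simps)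
      finally show ?thesis using True by blast
    next
      case F: False
      show ?thesis
      proof (cases "norm (x - y) < (1/2)^n")
        case True
        have "((1/2)^Suc n)\<^sup>2 \<le> (norm (x - y))\<^sup>2" using F by (intro power_mono) auto
        then have a: "(1/4)^(Suc n) \<le> (norm (x - y))\<^sup>2"
          by (simp add: power2_eq_square power_mult_distrib[symmetric])
        have "1 / max ((norm (x - y))\<^sup>2) ((1/4)^Suc n) \<le> 1 / ((1/4)^Suc n)"
          by (intro divide_left_mono mult_pos_pos) (auto simp: less_max_iff_disj)
        also have "\<dots> \<le> 4 ^ (n + 1)" by (simp add: power_one_over field_simps)
        finally show ?thesis using True by (intro exI[of _ n]) auto
      next
        case False
        then have "((1/2)^n)\<^sup>2 \<le> (norm (x - y))\<^sup>2" by (intro power_mono) auto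
        then have a: "(1/4)^n \<le> (norm (x - y))\<^sup>2"
          by (simp add: power2_eq_square power_mult_distrib[symmetric])
        then have "max ((norm (x - y))\<^sup>2) ((1/4)^Suc n) = max ((norm (x - y))\<^sup>2) ((1/4)^n)"
          using zero_less_power[of "1/4::real" n] unfolding power_Suc by linarith
        then show ?thesis using k by (intro exI[of _ k]) auto
      qed
    qed
  qed
  then obtain k where k: "k \<le> n" "norm (x - y) < (1/2)^k" "1 / max ((norm (x - y))\<^sup>2) ((1/4)^n) \<le> 4^(k+1)" by auto
  have "4^(k+1) * indicator (ball x ((1/2) ^ k)) y \<le> (\<Sum>k\<le>n. 4 ^ (k+1) * indicator (ball x ((1/2) ^ k)) y :: real)"
    using k by (intro member_le_sum) auto
  then show ?thesis using k by (simp add: dist_norm)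
qed

text \<open>
  Each of the \<open>n + 1\<close> dyadic discs contributes the same amount \<open>4 pi M\<close>, so the kernel
  \<open>1/|z|\<^sup>2\<close> cut off at scale \<open>2^(-n)\<close> costs only a factor linear in \<open>n\<close>. This is the logarithm in
  the log-Lipschitz modulus of continuity of the velocity.
\<close>

lemma log_potential_bound:
  fixes f :: "real^2 \<Rightarrow> real"
  assumes f: "integrable lebesgue f" and m: "(LINT y|lebesgue. \<bar>f y\<bar>) \<le> m"
    and M: "AE y in lebesgue. \<bar>f y\<bar> \<le> M" "0 \<le> M"
  shows "(LINT y|lebesgue. \<bar>f y\<bar> / max ((norm (x - y))\<^sup>2) ((1/4)^n)) \<le> m + 4 * pi * M * (real n + 1)"
proof -
  have [measurable]: "(\<lambda>y. norm (x - y)) \<in> borel_measurable lebesgue" for x :: "real^2"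
    by (intro measurable_completion) auto
  have [measurable]: "Measurable.pred lebesgue (\<lambda>y. y \<in> ball x r)" for x :: "real^2" and r
    by (intro measurable_completion) auto
  have fm[measurable]: "f \<in> borel_measurable lebesgue" using f by auto
  have il: "integrable lebesgue (\<lambda>y. \<bar>f y\<bar> / max ((norm (x - y))\<^sup>2) ((1/4)^n))"
  proof (rule Bochner_Integration.integrable_bound[of lebesgue "\<lambda>y. \<bar>f y\<bar> / (1/4)^n"])
    show "AE y in lebesgue. norm (\<bar>f y\<bar> / max ((norm (x - y))\<^sup>2) ((1/4)^n)) \<le> norm (\<bar>f y\<bar> / (1/4)^n)"
      by (intro AE_I2) (auto intro!: divide_left_mono mult_pos_pos simp: less_max_iff_disj abs_of_pos)
  qed (use f in auto)
  have ib: "integrable lebesgue (\<lambda>y. \<bar>f y\<bar> * indicator (ball x r) y)" for r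
    by (rule Bochner_Integration.integrable_bound[of lebesgue f]) (auto simp: f split: split_indicator)
  have bb: "(LINT y|lebesgue. \<bar>f y\<bar> * indicator (ball x r) y) \<le> M * (pi * r\<^sup>2)" if "0 \<le> r" for r
  proof -
    have "(LINT y|lebesgue. \<bar>f y\<bar> * indicator (ball x r) y) \<le> (LINT y|lebesgue. M * indicator (ball x r) y)"
    proof (intro integral_mono_AE ib)
      have "integrable lebesgue (indicat_real (ball x r))"
        by (intro integrable_real_indicator) (auto simp: emeasure_ball_plane that simp del: emeasure_completion)
      then show "integrable lebesgue (\<lambda>y. M * indicator (ball x r) y)" by auto
      show "AE y in lebesgue. \<bar>f y\<bar> * indicator (ball x r) y \<le> M * indicator (ball x r) y"
        using M(1) by eventually_elim (auto split: split_indicator)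
    qed
    also have "\<dots> = M * (pi * r\<^sup>2)"
      using that by (simp add: measure_def emeasure_ball_plane[OF that])
    finally show ?thesis .
  qed
  have "(LINT y|lebesgue. \<bar>f y\<bar> / max ((norm (x - y))\<^sup>2) ((1/4)^n))
    \<le> (LINT y|lebesgue. \<bar>f y\<bar> + (\<Sum>k\<le>n. 4 ^ (k+1) * (\<bar>f y\<bar> * indicator (ball x ((1/2) ^ k)) y)))"
  proof (intro integral_mono il)
    show "integrable lebesgue (\<lambda>y. \<bar>f y\<bar> + (\<Sum>k\<le>n. 4 ^ (k+1) * (\<bar>f y\<bar> * indicator (ball x ((1/2) ^ k)) y)))"
      using f ib by auto
    fix y
    have "\<bar>f y\<bar> * (1 / max ((norm (x - y))\<^sup>2) ((1/4)^n)) \<le> \<bar>f y\<bar> * (1 + (\<Sum>k\<le>n. 4 ^ (k+1) * indicator (ball x ((1/2) ^ k)) y))"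
      by (intro mult_left_mono far_weight_dyadic) auto
    then show "\<bar>f y\<bar> / max ((norm (x - y))\<^sup>2) ((1/4)^n) \<le> \<bar>f y\<bar> + (\<Sum>k\<le>n. 4 ^ (k+1) * (\<bar>f y\<bar> * indicator (ball x ((1/2) ^ k)) y))"
      by (simp add: ring_distribs sum_distrib_left mult_ac)
  qed
  also have "\<dots> = (LINT y|lebesgue. \<bar>f y\<bar>) + (\<Sum>k\<le>n. 4 ^ (k+1) * (LINT y|lebesgue. \<bar>f y\<bar> * indicator (ball x ((1/2) ^ k)) y))"
    using f ib by (simp add: Bochner_Integration.integral_sum)
  also have "\<dots> \<le> m + (\<Sum>k\<le>n. 4 ^ (k+1) * (M * (pi * ((1/2)^k)\<^sup>2)))"
    using m bb by (intro add_mono sum_mono mult_left_mono) auto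
  also have "(\<Sum>k\<le>n. 4 ^ (k+1) * (M * (pi * ((1/2)^k)\<^sup>2))) = (\<Sum>k\<le>n. 4 * pi * M)"
    by (intro sum.cong) (auto simp: power2_eq_square power_mult_distrib[symmetric] power_one_over)
  also have "m + \<dots> \<le> m + 4 * pi * M * (real n + 1)" using M by (simp add: field_simps)
  finally show ?thesis .
qed

section \<open>Compactly supported differentiable functions\<close>

text \<open>
  The class \<open>C\<^sup>1\<^sub>c\<close> of the plane. The gradient is carried along as a second argument because the
  weak formulation refers to it explicitly.
\<close>

definition C1c :: "(real^2 \<Rightarrow> real) \<Rightarrow> (real^2 \<Rightarrow> real^2) \<Rightarrow> bool" where
  "C1c g g' \<longleftrightarrow> (\<forall>x. (g has_derivative (\<lambda>k. g' x \<bullet> k)) (at x)) \<and> continuous_on UNIV g' \<and>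
     (\<exists>r. \<forall>x. r \<le> norm x \<longrightarrow> g x = 0)"

lemma C1c_deriv: "C1c g g' \<Longrightarrow> (g has_derivative (\<lambda>k. g' x \<bullet> k)) (at x)"
  by (auto simp: C1c_def)

lemma C1c_continuous: "C1c g g' \<Longrightarrow> continuous_on UNIV g"
  by (auto simp: C1c_def intro!: has_derivative_continuous_on[of UNIV g "\<lambda>x k. g' x \<bullet> k"] intro: has_derivative_at_withinI)

lemma C1c_continuous_grad: "C1c g g' \<Longrightarrow> continuous_on UNIV g'"
  by (auto simp: C1c_def)

text \<open>
  The common radius also kills the gradient; this is why it is enlarged by 1, so that the point
  is interior to the set where the function vanishes.
\<close>

lemma C1c_support:
  assumes "C1c g g'"
  obtains r where "0 < r" "\<And>x. r \<le> norm x \<Longrightarrow> g x = 0" "\<And>x. r \<le> norm x \<Longrightarrow> g' x = 0"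
proof -
  obtain r where r: "\<And>x. r \<le> norm x \<Longrightarrow> g x = 0" using assms by (auto simp: C1c_def)
  show ?thesis
  proof
    show "0 < \<bar>r\<bar> + 1" by simp
    show "g x = 0" if "\<bar>r\<bar> + 1 \<le> norm x" for x using that r by auto
    show "g' x = 0" if x: "\<bar>r\<bar> + 1 \<le> norm x" for x
    proof -
      have "((\<lambda>_. 0) has_derivative (\<lambda>k. g' x \<bullet> k)) (at x)"
      proof (rule has_derivative_transform_within_open[OF C1c_deriv[OF assms]])
        show "open (- cball 0 r)" "x \<in> - cball 0 r" using x by auto
        show "g y = 0" if "y \<in> - cball 0 r" for y using that r by auto
      qed
      moreover have "((\<lambda>_. 0::real) has_derivative (\<lambda>_. 0)) (at x)" by simp
      ultimately have "(\<lambda>k. g' x \<bullet> k) = (\<lambda>_. 0)" by (rule has_derivative_unique)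
      then show ?thesis using inner_eq_zero_iff by metis
    qed
  qed
qed

lemma uniformly_continuous_compact_support:
  fixes w :: "'a::euclidean_space \<Rightarrow> 'b::real_normed_vector"
  assumes c: "continuous_on UNIV w" and z: "\<And>x. r \<le> norm x \<Longrightarrow> w x = 0"
  shows "uniformly_continuous_on UNIV w"
proof -
  have "uniformly_continuous_on (cball 0 (r+1)) w"
    by (intro compact_uniformly_continuous continuous_on_subset[OF c]) auto
  show ?thesis
    unfolding uniformly_continuous_on_def
  proof (intro allI impI)
    fix e :: real assume "0 < e"
    then obtain d where d: "d > 0" "\<And>x y. x \<in> cball 0 (r+1) \<Longrightarrow> y \<in> cball 0 (r+1) \<Longrightarrow> dist y x < d \<Longrightarrow> dist (w y) (w x) < e"
      using \<open>uniformly_continuous_on (cball 0 (r+1)) w\<close> unfolding uniformly_continuous_on_def by metis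
    show "\<exists>d>0. \<forall>x\<in>UNIV. \<forall>x'\<in>UNIV. dist x' x < d \<longrightarrow> dist (w x') (w x) < e"
    proof (intro exI[of _ "min d 1"] conjI ballI impI)
      fix x y :: 'a assume xy: "dist y x < min d 1"
      have t: "norm x \<le> norm y + dist y x" "norm y \<le> norm x + dist y x"
        by (metis dist_commute dist_norm norm_triangle_sub add.commute, metis dist_norm norm_triangle_sub add.commute)
      show "dist (w y) (w x) < e"
      proof (cases "x \<in> cball 0 (r+1) \<and> y \<in> cball 0 (r+1)")
        case True then show ?thesis using d xy by auto
      next
        case False
        then have "r \<le> norm x" "r \<le> norm y" using xy t by (auto simp del: dist_commute)
        then show ?thesis using z \<open>0 < e\<close> by auto
      qed
    qed (use d in auto)
  qed
qed

lemma compact_support_bounded: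
  fixes w :: "'a::euclidean_space \<Rightarrow> 'b::real_normed_vector"
  assumes c: "continuous_on UNIV w" and z: "\<And>x. r \<le> norm x \<Longrightarrow> w x = 0"
  obtains b where "0 < b" "\<And>x. norm (w x) \<le> b"
proof -
  have "compact (w ` cball 0 r)" by (intro compact_continuous_image continuous_on_subset[OF c]) auto
  then obtain b where b: "0 < b" "\<forall>y\<in>w ` cball 0 r. norm y \<le> b" using bounded_pos compact_imp_bounded by blast
  show ?thesis
  proof
    show "norm (w x) \<le> b" for x using b z[of x] by (cases "norm x \<le> r") auto
  qed (use b in auto)
qed

lemma C1c_grad_bounded:
  assumes "C1c g g'" obtains b where "0 < b" "\<And>x. norm (g' x) \<le> b"
  using C1c_support[OF assms] compact_support_bounded[OF C1c_continuous_grad[OF assms]] by metis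

lemma C1c_bounded:
  assumes "C1c g g'" obtains b where "0 < b" "\<And>x. \<bar>g x\<bar> \<le> b"
  using C1c_support[OF assms] compact_support_bounded[OF C1c_continuous[OF assms]] by (metis real_norm_def)

lemma onorm_inner_le: "onorm (\<lambda>k. a \<bullet> k) \<le> norm (a :: real^2)"
  by (rule onorm_le) (simp add: Cauchy_Schwarz_ineq2)

lemma C1c_lipschitz:
  assumes "C1c g g'" "\<And>x. norm (g' x) \<le> L"
  shows "\<bar>g x - g y\<bar> \<le> L * norm (x - y)"
proof -
  have "onorm (\<lambda>k. g' x \<bullet> k) \<le> L" for x
    using onorm_inner_le[of "g' x"] assms(2)[of x] by linarith
  then show ?thesis
    using differentiable_bound[of UNIV g "\<lambda>x k. g' x \<bullet> k" L x y] C1c_deriv[OF assms(1)]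
    by (simp add: has_derivative_at_withinI)
qed

lemma borel_lebesgue: "f \<in> borel_measurable borel \<Longrightarrow> f \<in> borel_measurable lebesgue"
  by (simp add: measurable_completion)

lemma integrable_mult_C1c:
  assumes f: "integrable lebesgue f" and k: "C1c k w"
  shows "integrable lebesgue (\<lambda>y. f y * k (x - y))" "integrable lebesgue (\<lambda>y. f y *\<^sub>R w (x - y))"
proof -
  obtain b where b: "\<And>x. \<bar>k x\<bar> \<le> b" "0 < b" using C1c_bounded[OF k] by metis
  obtain c where c: "\<And>x. norm (w x) \<le> c" "0 < c" using C1c_grad_bounded[OF k] by metis
  have [measurable]: "(\<lambda>y. k (x - y)) \<in> borel_measurable lebesgue" "(\<lambda>y. w (x - y)) \<in> borel_measurable lebesgue"
    by (intro borel_lebesgue borel_measurable_continuous_onI continuous_on_compose2[OF C1c_continuous[OF k]]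
         continuous_on_compose2[OF C1c_continuous_grad[OF k]] continuous_intros; simp)+
  have [measurable]: "f \<in> borel_measurable lebesgue" using f by auto
  show "integrable lebesgue (\<lambda>y. f y * k (x - y))"
    by (rule Bochner_Integration.integrable_bound[of lebesgue "\<lambda>y. f y * b"])
       (use f b in \<open>auto simp: abs_mult intro!: mult_left_mono AE_I2\<close>)
  show "integrable lebesgue (\<lambda>y. f y *\<^sub>R w (x - y))"
    by (rule Bochner_Integration.integrable_bound[of lebesgue "\<lambda>y. f y * c"])
       (use f c in \<open>auto simp: abs_mult intro!: mult_left_mono AE_I2\<close>)
qed

lemma convolution_grad_continuous:
  assumes f: "integrable lebesgue f" and k: "C1c k w"
  shows "continuous_on UNIV (\<lambda>x. LINT y|lebesgue. f y *\<^sub>R w (x - y))"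
  unfolding continuous_on_iff
proof (intro ballI allI impI)
  fix x :: "real^2" and e :: real assume "0 < e"
  define F where "F = (LINT y|lebesgue. \<bar>f y\<bar>) + 1"
  have F: "0 < F" by (simp add: F_def add_nonneg_pos)
  obtain r where r: "\<And>x. r \<le> norm x \<Longrightarrow> w x = 0" using C1c_support[OF k] by metis
  have "uniformly_continuous_on UNIV w"
    by (rule uniformly_continuous_compact_support[OF C1c_continuous_grad[OF k] r])
  then obtain d where d: "0 < d" "\<And>x y. dist y x < d \<Longrightarrow> dist (w y) (w x) < e / F"
    unfolding uniformly_continuous_on_def using \<open>0 < e\<close> F by (metis UNIV_I divide_pos_pos)
  show "\<exists>d>0. \<forall>x'\<in>UNIV. dist x' x < d \<longrightarrow> dist (LINT y|lebesgue. f y *\<^sub>R w (x' - y)) (LINT y|lebesgue. f y *\<^sub>R w (x - y)) < e"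
  proof (intro exI[of _ d] conjI ballI impI d)
    fix x' assume x': "dist x' x < d"
    note i = integrable_mult_C1c(2)[OF f k]
    have "dist (LINT y|lebesgue. f y *\<^sub>R w (x' - y)) (LINT y|lebesgue. f y *\<^sub>R w (x - y))
       = norm (LINT y|lebesgue. f y *\<^sub>R w (x' - y) - f y *\<^sub>R w (x - y))"
      by (simp add: dist_norm Bochner_Integration.integral_diff i)
    also have "\<dots> \<le> (LINT y|lebesgue. \<bar>f y\<bar> * (e / F))"
    proof (rule Bochner_Integration.integral_norm_bound_integral)
      show "norm (f y *\<^sub>R w (x' - y) - f y *\<^sub>R w (x - y)) \<le> \<bar>f y\<bar> * (e / F)" for y
        using mult_left_mono[OF less_imp_le[OF d(2)[of "x' - y" "x - y"]], of "\<bar>f y\<bar>"] x' by (simp add: scaleR_diff_right[symmetric] dist_norm)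
    qed (use i f in auto)
    also have "\<dots> = (F - 1) * (e / F)" by (simp add: F_def)
    also have "\<dots> < e" using F \<open>0 < e\<close> by (simp add: field_simps)
    finally show "dist (LINT y|lebesgue. f y *\<^sub>R w (x' - y)) (LINT y|lebesgue. f y *\<^sub>R w (x - y)) < e" .
  qed
qed

text \<open>
  Uniform continuity of the gradient makes the first-order remainder of \<open>k\<close> at most \<open>e |h|\<close>
  with \<open>e\<close> independent of the point, and such a bound survives integration against any integrable \<open>f\<close>.
\<close>

lemma convolution_has_derivative:
  assumes f: "integrable lebesgue f" and k: "C1c k w"
  shows "((\<lambda>x. LINT y|lebesgue. f y * k (x - y)) has_derivative (\<lambda>h. (LINT y|lebesgue. f y *\<^sub>R w (x - y)) \<bullet> h)) (at x)"
  unfolding has_derivative_at_alt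
proof (intro conjI allI impI)
  show "bounded_linear (\<lambda>h. (LINT y|lebesgue. f y *\<^sub>R w (x - y)) \<bullet> h)" by (rule bounded_linear_inner_right)
  fix e :: real assume "0 < e"
  \<comment> \<open>Adding 1 keeps the denominator positive when \<open>f\<close> vanishes.\<close>
  define F where "F = (LINT y|lebesgue. \<bar>f y\<bar>) + 1"
  have F: "0 < F" by (simp add: F_def add_nonneg_pos)
  obtain r where r: "\<And>x. r \<le> norm x \<Longrightarrow> w x = 0" using C1c_support[OF k] by metis
  have "uniformly_continuous_on UNIV w"
    by (rule uniformly_continuous_compact_support[OF C1c_continuous_grad[OF k] r])
  then obtain d where d: "0 < d" "\<And>x y. dist y x < d \<Longrightarrow> dist (w y) (w x) < e / F"
    unfolding uniformly_continuous_on_def using \<open>0 < e\<close> F by (metis UNIV_I divide_pos_pos)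
  note i = integrable_mult_C1c[OF f k]
  show "\<exists>d>0. \<forall>y. norm (y - x) < d \<longrightarrow>
      norm ((LINT ya|lebesgue. f ya * k (y - ya)) - (LINT y|lebesgue. f y * k (x - y)) - (LINT y|lebesgue. f y *\<^sub>R w (x - y)) \<bullet> (y - x)) \<le> e * norm (y - x)"
  proof (intro exI[of _ d] conjI allI impI d)
    fix x' assume x': "norm (x' - x) < d"
    have lin: "\<bar>k (x' - y) - k (x - y) - w (x - y) \<bullet> (x' - x)\<bar> \<le> norm (x' - x) * (e / F)" for y
    proof -
      have "norm (k (x' - y) - k (x - y) - w (x - y) \<bullet> ((x' - y) - (x - y))) \<le> norm ((x' - y) - (x - y)) * (e / F)"
      proof (rule differentiable_bound_linearization[where S = "ball (x - y) d" and f' = "\<lambda>z k. w z \<bullet> k"])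
        fix t :: real assume t: "t \<in> {0..1}"
        have "norm (t *\<^sub>R (x' - x)) \<le> norm (x' - x)" using t by (simp add: mult_left_le_one_le)
        then show "x - y + t *\<^sub>R (x' - y - (x - y)) \<in> ball (x - y) d"
          using x' by (simp add: dist_norm)
      next
        fix z assume "z \<in> ball (x - y) d"
        then have "norm (w z - w (x - y)) \<le> e / F" using d(2)[of z "x - y"] by (simp add: dist_norm norm_minus_commute)
        moreover have "onorm ((\<bullet>) (w z) - (\<bullet>) (w (x - y))) \<le> norm (w z - w (x - y))"
          using onorm_inner_le[of "w z - w (x - y)"] by (simp add: inner_diff_left fun_diff_def)
        ultimately show "onorm ((\<bullet>) (w z) - (\<bullet>) (w (x - y))) \<le> e / F" by linarith
      next
        show "(k has_derivative (\<bullet>) (w z)) (at z within ball (x - y) d)" for z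
          using C1c_deriv[OF k, of z] by (rule has_derivative_at_withinI)
      qed (use d in auto)
      then show ?thesis by simp
    qed
    have "(LINT ya|lebesgue. f ya * k (x' - ya)) - (LINT y|lebesgue. f y * k (x - y)) - (LINT y|lebesgue. f y *\<^sub>R w (x - y)) \<bullet> (x' - x)
      = (LINT y|lebesgue. f y * k (x' - y) - f y * k (x - y) - (f y *\<^sub>R w (x - y)) \<bullet> (x' - x))"
    proof -
      have "(LINT y|lebesgue. (f y *\<^sub>R w (x - y)) \<bullet> (x' - x)) = (LINT y|lebesgue. f y *\<^sub>R w (x - y)) \<bullet> (x' - x)"
        using i(2) by (intro integral_inner_left) auto
      moreover have "integrable lebesgue (\<lambda>y. (f y *\<^sub>R w (x - y)) \<bullet> (x' - x))"
        using i(2) by (intro integrable_inner_left) auto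
      ultimately show ?thesis using i(1) by (simp add: Bochner_Integration.integral_diff)
    qed
    also have "norm \<dots> \<le> (LINT y|lebesgue. \<bar>f y\<bar> * (norm (x' - x) * (e / F)))"
    proof (rule Bochner_Integration.integral_norm_bound_integral)
      show "norm (f y * k (x' - y) - f y * k (x - y) - (f y *\<^sub>R w (x - y)) \<bullet> (x' - x)) \<le> \<bar>f y\<bar> * (norm (x' - x) * (e / F))" for y
        using mult_left_mono[OF lin[of y], of "\<bar>f y\<bar>"] by (simp add: abs_mult[symmetric] right_diff_distrib)
      have "integrable lebesgue (\<lambda>y. (f y *\<^sub>R w (x - y)) \<bullet> (x' - x))"
        using i(2) by (intro integrable_inner_left) auto
      then show "integrable lebesgue (\<lambda>y. f y * k (x' - y) - f y * k (x - y) - (f y *\<^sub>R w (x - y)) \<bullet> (x' - x))"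
        using i(1) by (intro Bochner_Integration.integrable_diff)
    qed (use f in auto)
    also have "\<dots> = (F - 1) * (norm (x' - x) * (e / F))" by (simp add: F_def)
    also have "\<dots> \<le> F * (norm (x' - x) * (e / F))" using \<open>0 < e\<close> F by (intro mult_right_mono) auto
    also have "\<dots> = e * norm (x' - x)" using F by simp
    finally show "norm ((LINT ya|lebesgue. f ya * k (x' - ya)) - (LINT y|lebesgue. f y * k (x - y)) - (LINT y|lebesgue. f y *\<^sub>R w (x - y)) \<bullet> (x' - x)) \<le> e * norm (x' - x)" .
  qed
qed


section \<open>A smooth compactly supported approximation of the Biot-Savart kernel\<close>

text \<open>
  The function \<open>1/s\<close>, continued below \<open>a\<close> by its tangent line at \<open>a\<close>. The tangent keeps the function
  \<open>C\<^sup>1\<close>, and by convexity it stays below \<open>1/s\<close>.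
\<close>

definition trunc_inv :: "real \<Rightarrow> real \<Rightarrow> real" where
  "trunc_inv a s = (if s < a then 2 / a - s / a\<^sup>2 else 1 / s)"

lemma trunc_inv_has_derivative:
  assumes a: "0 < a"
  shows "(trunc_inv a has_real_derivative - 1 / (max s a)\<^sup>2) (at s)"
proof -
  let ?l = "\<lambda>s. 2 / a - s / a\<^sup>2" and ?h = "\<lambda>s::real. 1 / s"
  have l: "(?l has_real_derivative - 1 / a\<^sup>2) (at x within S)" for x S
  proof -
    have "(?l has_real_derivative 0 - 1 / a\<^sup>2) (at x within S)"
      by (intro DERIV_diff DERIV_const DERIV_cdivide DERIV_ident)
    then show ?thesis by simp
  qed
  have h: "(?h has_real_derivative - 1 / x\<^sup>2) (at x within S)" if "0 < x" for x S
    using that by (auto intro!: derivative_eq_intros simp: power2_eq_square)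
  consider "s < a" | "a < s" | "s = a" by linarith
  then show ?thesis
  proof cases
    case 1
    show ?thesis
      by (rule has_field_derivative_transform_within_open[of ?l _ _ "{..<a}"])
         (use 1 l[of s UNIV] in \<open>auto simp: trunc_inv_def max_def\<close>)
  next
    case 2
    show ?thesis
      by (rule has_field_derivative_transform_within_open[of ?h _ _ "{a<..}"])
         (use 2 a h[of s UNIV] in \<open>auto simp: trunc_inv_def max_def\<close>)
  next
    case 3
    have v: "trunc_inv a a = 1 / a" "2 / a - a / a\<^sup>2 = 1 / a" using a by (auto simp: trunc_inv_def power2_eq_square field_simps)
    have 1: "((\<lambda>y. (trunc_inv a y - trunc_inv a a) / (y - a)) \<longlongrightarrow> - 1 / a\<^sup>2) (at_left a)"
    proof (rule Lim_transform_eventually[OF l[of a "{..<a}", unfolded has_field_derivative_iff]])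
      show "\<forall>\<^sub>F y in at_left a. (2 / a - y / a\<^sup>2 - (2 / a - a / a\<^sup>2)) / (y - a) = (trunc_inv a y - trunc_inv a a) / (y - a)"
        unfolding eventually_at_filter by (rule always_eventually) (simp add: v, simp add: trunc_inv_def)
    qed
    have 2: "((\<lambda>y. (trunc_inv a y - trunc_inv a a) / (y - a)) \<longlongrightarrow> - 1 / a\<^sup>2) (at_right a)"
    proof (rule Lim_transform_eventually[OF h[OF a, of "{a<..}", unfolded has_field_derivative_iff]])
      show "\<forall>\<^sub>F y in at_right a. (1 / y - 1 / a) / (y - a) = (trunc_inv a y - trunc_inv a a) / (y - a)"
        unfolding eventually_at_filter by (rule always_eventually) (simp add: v, simp add: trunc_inv_def)
    qed
    show ?thesis
      using 1 2 unfolding 3 has_field_derivative_iff max.idem by (rule filterlim_split_at)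
  qed
qed

lemma trunc_inv_bounds:
  assumes a: "0 < a" and s: "0 \<le> s"
  shows "0 \<le> trunc_inv a s" "trunc_inv a s \<le> 2 / max s a" "0 < s \<Longrightarrow> trunc_inv a s \<le> 1 / s"
proof -
  have *: "s / a\<^sup>2 \<le> 2 / a" if "s < a" using that a s by (simp add: power2_eq_square field_simps)
  show "0 \<le> trunc_inv a s" using * s by (auto simp: trunc_inv_def)
  show "trunc_inv a s \<le> 2 / max s a" using a s by (auto simp: trunc_inv_def max_def field_simps)
  show "trunc_inv a s \<le> 1 / s" if "0 < s"
  proof (cases "s < a")
    case True
    have "0 \<le> (1 - s / a)\<^sup>2 / s" using that by simp
    also have "\<dots> = 1 / s - (2 / a - s / a\<^sup>2)" using that a by (simp add: power2_eq_square field_simps)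
    finally show ?thesis using True by (simp add: trunc_inv_def)
  qed (simp add: trunc_inv_def)
qed

lemma trunc_inv_antimono:
  assumes a: "0 < a" "a \<le> b" and s: "0 \<le> s"
  shows "trunc_inv b s \<le> trunc_inv a s"
proof -
  consider "s < a" | "a \<le> s" by linarith
  then show ?thesis
  proof cases
    case 1
    have "s * (1 / a) \<le> 1" "s * (1 / b) \<le> 1" "1 / b \<le> 1 / a"
      using 1 a s by (auto simp: field_simps)
    then have "0 \<le> (1 / a - 1 / b) * (2 - (s * (1 / a) + s * (1 / b)))" by (intro mult_nonneg_nonneg) auto
    also have "\<dots> = (2 / a - s / a\<^sup>2) - (2 / b - s / b\<^sup>2)"
      by (simp add: algebra_simps power2_eq_square)
    finally show ?thesis using 1 a by (simp add: trunc_inv_def)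
  next
    case 2
    then have "trunc_inv a s = 1 / s" by (simp add: trunc_inv_def)
    then show ?thesis using trunc_inv_bounds(3)[of b s] 2 a by auto
  qed
qed

text \<open>
  The radial profile of the regularised Biot-Savart kernel. Beyond \<open>4^n\<close> both truncations equal
  \<open>1/s\<close> and cancel, so subtracting the second one gives compact support; below \<open>4^n\<close> it is
  at most \<open>2/4^n\<close> and spoils the kernel only a little. The argument \<open>s\<close> is the squared distance, whence scales
  \<open>2^(-n)\<close> and \<open>2^n\<close> for the distance itself.
\<close>

definition reg_profile :: "nat \<Rightarrow> real \<Rightarrow> real" where
  "reg_profile n s = (trunc_inv ((1/4)^n) s - trunc_inv (4^n) s) / (2 * pi)"

definition reg_profile' :: "nat \<Rightarrow> real \<Rightarrow> real" where
  "reg_profile' n s = (1 / (max s (4^n))\<^sup>2 - 1 / (max s ((1/4)^n))\<^sup>2) / (2 * pi)"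

lemma quarter_le: "(1/4::real)^n \<le> 4^n"
proof -
  have "(1/4::real)^n \<le> 1" by (simp add: power_le_one)
  also have "1 \<le> (4::real)^n" by simp
  finally show ?thesis .
qed

lemma reg_profile_has_derivative: "(reg_profile n has_real_derivative reg_profile' n s) (at s)"
proof -
  have "((\<lambda>s. (trunc_inv ((1/4)^n) s - trunc_inv (4^n) s) / (2 * pi)) has_real_derivative
      (- 1 / (max s ((1/4)^n))\<^sup>2 - - 1 / (max s (4^n))\<^sup>2) / (2 * pi)) (at s)"
    by (intro DERIV_cdivide DERIV_diff trunc_inv_has_derivative) auto
  then show ?thesis by (simp add: reg_profile_def[abs_def] reg_profile'_def)
qed

lemma reg_profile_has_derivative_compose:
  "((\<lambda>z. reg_profile n (z \<bullet> z)) has_derivative (\<lambda>k. 2 * reg_profile' n (z \<bullet> z) * (z \<bullet> k))) (at (z::real^2))"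
proof -
  have "((\<lambda>z. z \<bullet> z) has_derivative (\<lambda>k. 2 * (z \<bullet> k))) (at z)"
    by (rule has_derivative_eq_rhs[OF has_derivative_inner[OF has_derivative_ident has_derivative_ident]]) (simp add: inner_commute)
  from has_derivative_compose[OF this reg_profile_has_derivative[of n, THEN has_field_derivative_imp_has_derivative]]
  show ?thesis by (simp add: mult_ac)
qed

lemma reg_profile_bounds:
  assumes "0 \<le> s"
  shows "0 \<le> reg_profile n s" "reg_profile n s \<le> 2 / max s ((1/4)^n) / (2 * pi)"
    "\<bar>reg_profile' n s\<bar> \<le> 1 / (max s ((1/4)^n))\<^sup>2 / (2 * pi)"
proof -
  show "0 \<le> reg_profile n s" using trunc_inv_antimono[OF _ quarter_le assms] by (simp add: reg_profile_def)
  have "trunc_inv ((1/4)^n) s - trunc_inv (4^n) s \<le> 2 / max s ((1/4)^n)"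
    using trunc_inv_bounds[OF _ assms, of "(1/4)^n"] trunc_inv_bounds(1)[OF _ assms, of "4^n"] by simp
  then show "reg_profile n s \<le> 2 / max s ((1/4)^n) / (2 * pi)" unfolding reg_profile_def by (intro divide_right_mono) auto
  have "max s ((1/4)^n) \<le> max s (4^n)" using quarter_le[of n] by (auto simp: max_def)
  moreover have p: "0 < max s ((1/4)^n)" by (simp add: less_max_iff_disj)
  ultimately have "1 / (max s (4^n))\<^sup>2 \<le> 1 / (max s ((1/4)^n))\<^sup>2"
    by (intro divide_left_mono power_mono mult_pos_pos zero_less_power) auto
  then have "\<bar>1 / (max s (4^n))\<^sup>2 - 1 / (max s ((1/4)^n))\<^sup>2\<bar> \<le> 1 / (max s ((1/4)^n))\<^sup>2" by (simp add: abs_le_iff)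
  then show "\<bar>reg_profile' n s\<bar> \<le> 1 / (max s ((1/4)^n))\<^sup>2 / (2 * pi)"
    unfolding reg_profile'_def abs_divide by (intro divide_mono) auto
qed

lemma reg_profile_continuous: "continuous_on UNIV (reg_profile n)" "continuous_on UNIV (reg_profile' n)"
proof -
  show "continuous_on UNIV (reg_profile n)"
    by (rule DERIV_continuous_on[OF reg_profile_has_derivative[THEN DERIV_subset]]) auto
  have "0 < max s (4^n)" "0 < max s ((1/4)^n)" for s :: real
    by (simp_all only: less_max_iff_disj) auto
  then have "max s (4^n) \<noteq> 0" "max s ((1/4)^n) \<noteq> 0" for s :: real
    by (metis less_irrefl)+
  then show "continuous_on UNIV (reg_profile' n)" unfolding reg_profile'_def by (intro continuous_intros) auto
qed

text \<open>
  The two components of the regularised kernel \<open>reg_profile n (|z|\<^sup>2) *\<^sub>R perp z\<close> and their gradients, that is,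
  the rows of its Jacobian.
\<close>

definition reg_kernel1 :: "nat \<Rightarrow> real^2 \<Rightarrow> real" where "reg_kernel1 n z = - z$2 * reg_profile n (z \<bullet> z)"
definition reg_kernel2 :: "nat \<Rightarrow> real^2 \<Rightarrow> real" where "reg_kernel2 n z = z$1 * reg_profile n (z \<bullet> z)"
definition reg_kernel_grad1 :: "nat \<Rightarrow> real^2 \<Rightarrow> real^2" where
  "reg_kernel_grad1 n z = (- reg_profile n (z \<bullet> z)) *\<^sub>R axis 2 1 - (2 * z$2 * reg_profile' n (z \<bullet> z)) *\<^sub>R z"
definition reg_kernel_grad2 :: "nat \<Rightarrow> real^2 \<Rightarrow> real^2" where
  "reg_kernel_grad2 n z = reg_profile n (z \<bullet> z) *\<^sub>R axis 1 1 + (2 * z$1 * reg_profile' n (z \<bullet> z)) *\<^sub>R z"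

lemma reg_profile_far: "2 ^ n \<le> norm (z::real^2) \<Longrightarrow> reg_profile n (z \<bullet> z) = 0"
proof -
  assume "2 ^ n \<le> norm z"
  then have "(2 ^ n)\<^sup>2 \<le> (norm z)\<^sup>2" by (intro power_mono) auto
  then have "4 ^ n \<le> z \<bullet> z" by (simp add: power2_norm_eq_inner[symmetric] power2_eq_square power_mult_distrib[symmetric])
  then show ?thesis using quarter_le[of n] by (simp add: reg_profile_def trunc_inv_def)
qed

lemma inner_axis_2: "axis i (1::real) \<bullet> (k::real^2) = k $ i"
  by (simp add: inner_axis inner_commute)

lemma C1c_reg_kernel1: "C1c (reg_kernel1 n) (reg_kernel_grad1 n)"
  unfolding C1c_def
proof (intro conjI allI)
  fix z :: "real^2"
  show "(reg_kernel1 n has_derivative (\<bullet>) (reg_kernel_grad1 n z)) (at z)"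
  proof -
    have c: "((\<lambda>z. z $ 2) has_derivative (\<lambda>k. k $ 2)) (at z)"
      by (intro bounded_linear_imp_has_derivative bounded_linear_vec_nth)
    have "((\<lambda>z. - (z $ 2 * reg_profile n (z \<bullet> z))) has_derivative
        (\<lambda>k. - (z $ 2 * (2 * reg_profile' n (z \<bullet> z) * (z \<bullet> k)) + k $ 2 * reg_profile n (z \<bullet> z)))) (at z)"
      by (intro has_derivative_minus has_derivative_mult c reg_profile_has_derivative_compose)
    moreover have "(\<lambda>k. - (z $ 2 * (2 * reg_profile' n (z \<bullet> z) * (z \<bullet> k)) + k $ 2 * reg_profile n (z \<bullet> z))) = (\<bullet>) (reg_kernel_grad1 n z)"
      unfolding reg_kernel_grad1_def by (rule ext) (simp add: inner_diff_left inner_add_left inner_axis_2)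
    ultimately show ?thesis by (simp add: reg_kernel1_def[abs_def])
  qed
  show "continuous_on UNIV (reg_kernel_grad1 n)" unfolding reg_kernel_grad1_def
    by (intro continuous_intros continuous_on_compose2[OF reg_profile_continuous(1)] continuous_on_compose2[OF reg_profile_continuous(2)]) auto
  show "\<exists>r. \<forall>x. r \<le> norm x \<longrightarrow> reg_kernel1 n x = 0" using reg_profile_far by (auto simp: reg_kernel1_def)
qed

lemma C1c_reg_kernel2: "C1c (reg_kernel2 n) (reg_kernel_grad2 n)"
  unfolding C1c_def
proof (intro conjI allI)
  fix z :: "real^2"
  show "(reg_kernel2 n has_derivative (\<bullet>) (reg_kernel_grad2 n z)) (at z)"
  proof -
    have c: "((\<lambda>z. z $ 1) has_derivative (\<lambda>k. k $ 1)) (at z)"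
      by (intro bounded_linear_imp_has_derivative bounded_linear_vec_nth)
    have "((\<lambda>z. (z $ 1 * reg_profile n (z \<bullet> z))) has_derivative
        (\<lambda>k. (z $ 1 * (2 * reg_profile' n (z \<bullet> z) * (z \<bullet> k)) + k $ 1 * reg_profile n (z \<bullet> z)))) (at z)"
      by (intro has_derivative_mult c reg_profile_has_derivative_compose)
    moreover have "(\<lambda>k. (z $ 1 * (2 * reg_profile' n (z \<bullet> z) * (z \<bullet> k)) + k $ 1 * reg_profile n (z \<bullet> z))) = (\<bullet>) (reg_kernel_grad2 n z)"
      unfolding reg_kernel_grad2_def by (rule ext) (simp add: inner_diff_left inner_add_left inner_axis_2)
    ultimately show ?thesis by (simp add: reg_kernel2_def[abs_def])
  qed
  show "continuous_on UNIV (reg_kernel_grad2 n)" unfolding reg_kernel_grad2_def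
    by (intro continuous_intros continuous_on_compose2[OF reg_profile_continuous(1)] continuous_on_compose2[OF reg_profile_continuous(2)]) auto
  show "\<exists>r. \<forall>x. r \<le> norm x \<longrightarrow> reg_kernel2 n x = 0" using reg_profile_far by (auto simp: reg_kernel2_def)
qed

text \<open>
  A radial profile times the rotated position vector is divergence free whatever the profile is, so
  the regularised flow preserves area to first order.
\<close>

lemma reg_kernel_grad_trace: "reg_kernel_grad1 n z $ 1 + reg_kernel_grad2 n z $ 2 = 0"
  by (simp add: reg_kernel_grad1_def reg_kernel_grad2_def axis_def)

text \<open>
  At distances beyond the truncation scale this is the size of the gradient of the Biot-Savart kernel;
  the logarithmic potential estimate applies to it.
\<close>

lemma reg_kernel_grad_bound:
  "norm (reg_kernel_grad1 n z) \<le> 1 / max ((norm z)\<^sup>2) ((1/4)^n)" "norm (reg_kernel_grad2 n z) \<le> 1 / max ((norm z)\<^sup>2) ((1/4)^n)"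
proof -
  define s where "s = z \<bullet> z"
  define m where "m = max s ((1/4)^n)"
  have s: "0 \<le> s" "s = (norm z)\<^sup>2" by (auto simp: s_def power2_norm_eq_inner)
  have m: "0 < m" "s \<le> m" by (auto simp: m_def less_max_iff_disj)
  have p: "norm (reg_profile n s *\<^sub>R (axis i 1::real^2)) \<le> 2 / m / (2 * pi)" for i
    using reg_profile_bounds[OF s(1), of n] by (simp add: m_def)
  have q: "norm ((2 * z$i * reg_profile' n s) *\<^sub>R z) \<le> 2 / m / (2 * pi)" for i
  proof -
    have "norm ((2 * z$i * reg_profile' n s) *\<^sub>R z) = 2 * \<bar>z $ i\<bar> * norm z * \<bar>reg_profile' n s\<bar>" by (simp add: abs_mult)
    also have "\<dots> \<le> 2 * norm z * norm z * (1 / m\<^sup>2 / (2 * pi))"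
      using reg_profile_bounds[OF s(1), of n] component_le_norm_cart[of z i] by (intro mult_mono) (auto simp: m_def)
    also have "\<dots> = 2 * s * (1 / m\<^sup>2 / (2 * pi))" by (simp add: s power2_eq_square)
    also have "\<dots> \<le> 2 * m * (1 / m\<^sup>2 / (2 * pi))" using m by (intro mult_right_mono) auto
    also have "\<dots> = 2 / m / (2 * pi)" using m by (simp add: power2_eq_square)
    finally show ?thesis .
  qed
  have r: "2 / m / (2 * pi) + 2 / m / (2 * pi) \<le> 1 / m"
    using m pi_gt3 by (simp add: field_simps)
  show "norm (reg_kernel_grad1 n z) \<le> 1 / max ((norm z)\<^sup>2) ((1/4)^n)"
    using norm_minus_cancel[of "reg_profile n s *\<^sub>R (axis 2 1::real^2)"] norm_triangle_ineq4[of "(- reg_profile n s) *\<^sub>R axis 2 1" "(2 * z$2 * reg_profile' n s) *\<^sub>R z"] p[of 2] q[of 2] r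
    unfolding reg_kernel_grad1_def s_def[symmetric] m_def[symmetric] s(2)[symmetric] scaleR_minus_left by linarith
  show "norm (reg_kernel_grad2 n z) \<le> 1 / max ((norm z)\<^sup>2) ((1/4)^n)"
    using norm_triangle_ineq[of "reg_profile n s *\<^sub>R axis 1 1" "(2 * z$1 * reg_profile' n s) *\<^sub>R z"] p[of 1] q[of 1] r
    unfolding reg_kernel_grad2_def s_def[symmetric] m_def[symmetric] s(2)[symmetric] by linarith
qed

lemma perp_component: "perp x $ 1 = - x $ 2" "perp x $ 2 = x $ 1"
  by (auto simp: perp_def)

lemma norm_perp: "norm (perp x) = norm x"
  by (simp add: norm_eq_sqrt_inner inner_vec_def sum_2 perp_component)

lemma biot_savart_kernel_norm: "norm (biot_savart_kernel z) = 1 / (2 * pi * norm z)"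
  by (simp add: biot_savart_kernel_def norm_perp power2_eq_square)

lemma reg_kernel_eq: "vector [reg_kernel1 n z, reg_kernel2 n z] = reg_profile n (z \<bullet> z) *\<^sub>R perp z"
  by (simp add: vec_eq_iff forall_2 perp_component reg_kernel1_def reg_kernel2_def)

text \<open>
  Inside the disc of radius \<open>2^(-n)\<close> the error is at most the kernel itself. Elsewhere only the
  subtracted outer truncation remains, which is at most \<open>2/2^n\<close> after multiplication by \<open>|z|\<close>: through
  its bound \<open>2/4^n\<close> when \<open>|z| \<le> 2^n\<close>, and through \<open>1/|z|\<^sup>2\<close> beyond.
\<close>

lemma biot_savart_kernel_approx:
  "norm (biot_savart_kernel z - vector [reg_kernel1 n z, reg_kernel2 n z])
     \<le> (indicator (ball 0 ((1/2)^n)) z / norm z + 2 * (1/2)^n) / (2 * pi)"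
proof (cases "z = 0")
  case True
  have "perp (0::real^2) = 0" by (simp add: vec_eq_iff forall_2 perp_component)
  with True show ?thesis by (simp add: reg_kernel_eq biot_savart_kernel_def)
next
  case False
  define s where "s = z \<bullet> z"
  have s: "0 < s" "s = (norm z)\<^sup>2" using False by (auto simp: s_def power2_norm_eq_inner)
  have q: "(1/4)^n = ((1/2::real)^n)\<^sup>2" "4^n = ((2::real)^n)\<^sup>2" by (auto simp: power2_eq_square power_mult_distrib[symmetric])
  let ?a = "trunc_inv ((1/4)^n) s" and ?b = "trunc_inv (4^n) s"
  have "biot_savart_kernel z - vector [reg_kernel1 n z, reg_kernel2 n z] = ((1 / s - ?a + ?b) / (2 * pi)) *\<^sub>R perp z"
    by (simp add: reg_kernel_eq biot_savart_kernel_def s_def power2_norm_eq_inner reg_profile_def scaleR_diff_left[symmetric] diff_divide_distrib add_divide_distrib)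
  moreover have "0 \<le> 1 / s - ?a" "0 \<le> ?b" using trunc_inv_bounds[of _ s] s by auto
  ultimately have e: "norm (biot_savart_kernel z - vector [reg_kernel1 n z, reg_kernel2 n z]) = ((1 / s - ?a) * norm z + ?b * norm z) / (2 * pi)"
    by (simp add: norm_perp abs_of_nonneg ring_distribs)
  have "(1 / s - ?a) * norm z \<le> indicator (ball 0 ((1/2)^n)) z / norm z"
  proof (cases "norm z < (1/2)^n")
    case True
    have "(1 / s - ?a) * norm z \<le> 1 / s * norm z" using trunc_inv_bounds(1)[of "(1/4)^n" s] s by (intro mult_right_mono) auto
    then show ?thesis using True False by (simp add: s power2_eq_square)
  next
    case F: False
    then have "(1/4)^n \<le> s" unfolding q s by (intro power_mono) auto
    then show ?thesis by (simp add: trunc_inv_def)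
  qed
  moreover have "?b * norm z \<le> 2 * (1/2)^n"
  proof (cases "norm z \<le> 2^n")
    case True
    have "?b \<le> 2 / max s (4^n)" using trunc_inv_bounds(2)[of "4^n" s] s by auto
    also have "\<dots> \<le> 2 / 4^n" by (intro divide_left_mono mult_pos_pos) (auto simp: less_max_iff_disj)
    finally have "?b * norm z \<le> 2 / 4^n * 2^n" using True by (intro mult_mono) auto
    also have "\<dots> = 2 * (1/2)^n" unfolding q by (simp add: power2_eq_square power_one_over)
    finally show ?thesis .
  next
    case F: False
    have "?b * norm z \<le> 1 / s * norm z" using trunc_inv_bounds(3)[of "4^n" s] s by (intro mult_right_mono) auto
    also have "\<dots> = 1 / norm z" by (simp add: s power2_eq_square)
    also have "\<dots> \<le> 1 / 2^n" using F False by (intro divide_left_mono mult_pos_pos) auto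
    also have "\<dots> \<le> 2 * (1/2)^n" by (simp add: power_one_over divide_right_mono)
    finally show ?thesis .
  qed
  ultimately show ?thesis unfolding e by (intro divide_right_mono add_mono) auto
qed


section \<open>A differentiable step function\<close>

lemma DERIV_max_power2: "((\<lambda>s::real. (max 0 s)\<^sup>2) has_real_derivative 2 * max 0 s) (at s)"
proof -
  consider "s < 0" | "0 < s" | "s = 0" by linarith
  then show ?thesis
  proof cases
    case 1
    show ?thesis
      by (rule has_field_derivative_transform_within_open[of "\<lambda>_. 0" _ _ "{..<0}"]) (use 1 in auto)
  next
    case 2
    have "((\<lambda>s. s\<^sup>2) has_real_derivative 2 * max 0 s) (at s)"
      using DERIV_pow[of 2 s] 2 by simp
    then show ?thesis
      by (rule has_field_derivative_transform_within_open[of _ _ _ "{0<..}"]) (use 2 in auto)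
  next
    case 3
    have t: "((\<lambda>y::real. max 0 y) \<longlongrightarrow> max 0 0) (at 0)" by (intro tendsto_max tendsto_const tendsto_ident_at)
    have e: "(\<lambda>y::real. ((max 0 y)\<^sup>2 - (max 0 0)\<^sup>2) / (y - 0)) = (\<lambda>y. max 0 y)"
    proof
      fix y :: real show "((max 0 y)\<^sup>2 - (max 0 0)\<^sup>2) / (y - 0) = max 0 y"
        by (cases "y \<le> 0") (auto simp: power2_eq_square)
    qed
    have "((\<lambda>y::real. ((max 0 y)\<^sup>2 - (max 0 0)\<^sup>2) / (y - 0)) \<longlongrightarrow> 0) (at 0)"
      unfolding e using t by (simp only: max.idem)
    then show ?thesis using 3 by (simp add: has_field_derivative_iff)
  qed
qed

text \<open>
  Applying the \<open>C\<^sup>1\<close> function \<open>s \<mapsto> (max 0 s)\<^sup>2\<close> twice flattens both ends of the step.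
\<close>

definition smoothstep :: "real \<Rightarrow> real" where
  "smoothstep s = 1 - (max 0 (1 - (max 0 s)\<^sup>2))\<^sup>2"

definition smoothstep' :: "real \<Rightarrow> real" where
  "smoothstep' s = 2 * max 0 (1 - (max 0 s)\<^sup>2) * (2 * max 0 s)"

lemma DERIV_smoothstep: "(smoothstep has_real_derivative smoothstep' s) (at s)"
proof -
  have "((\<lambda>s::real. 1 - (max 0 s)\<^sup>2) has_real_derivative 0 - 2 * max 0 s) (at s)"
    by (intro DERIV_diff DERIV_const DERIV_max_power2)
  from DERIV_chain2[OF DERIV_max_power2 this]
  have "((\<lambda>s::real. 1 - (max 0 (1 - (max 0 s)\<^sup>2))\<^sup>2) has_real_derivative
    0 - 2 * max 0 (1 - (max 0 s)\<^sup>2) * (0 - 2 * max 0 s)) (at s)"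
    by (intro DERIV_diff DERIV_const)
  then show ?thesis by (simp add: smoothstep_def[abs_def] smoothstep'_def)
qed

lemma smoothstep_props:
  "s \<le> 0 \<Longrightarrow> smoothstep s = 0" "1 \<le> s \<Longrightarrow> smoothstep s = 1" "0 \<le> smoothstep s" "smoothstep s \<le> 1"
proof -
  show "s \<le> 0 \<Longrightarrow> smoothstep s = 0" by (simp add: smoothstep_def max_def)
  show "smoothstep s = 1" if "1 \<le> s"
  proof -
    have "1 \<le> s\<^sup>2" using that by simp
    then show ?thesis using that by (simp add: smoothstep_def)
  qed
  have "(max 0 (1 - (max 0 s)\<^sup>2))\<^sup>2 \<le> 1" by (intro power_le_one) auto
  then show "0 \<le> smoothstep s" by (simp add: smoothstep_def)
  show "smoothstep s \<le> 1" by (simp add: smoothstep_def)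
qed

lemma continuous_smoothstep': "continuous_on UNIV smoothstep'"
  unfolding smoothstep'_def by (intro continuous_intros)

section \<open>The velocity of a bounded vorticity\<close>

text \<open>
  A single constant for both norms, so that all velocity bounds are linear in \<open>M\<close>.
\<close>

definition bounded_vorticity :: "real \<Rightarrow> (real^2 \<Rightarrow> real) \<Rightarrow> bool" where
  "bounded_vorticity M f \<longleftrightarrow> integrable lebesgue f \<and> (LINT x|lebesgue. \<bar>f x\<bar>) \<le> M \<and> (AE x in lebesgue. \<bar>f x\<bar> \<le> M)"

definition biot_savart :: "(real^2 \<Rightarrow> real) \<Rightarrow> real^2 \<Rightarrow> real^2" where
  "biot_savart f x = (LINT y|lebesgue. f y *\<^sub>R biot_savart_kernel (x - y))"

lemma velocity_eq_biot_savart: "velocity \<theta> t = biot_savart (\<theta> t)"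
  by (simp add: fun_eq_iff velocity_def biot_savart_def)

lemma vec2_axis: "(vector [a, b] :: real^2) = a *\<^sub>R axis 1 1 + b *\<^sub>R axis 2 1"
  by (simp add: vec_eq_iff forall_2 axis_def)

lemma borel_measurable_biot_savart_kernel[measurable]: "biot_savart_kernel \<in> borel_measurable borel"
proof -
  have "continuous_on UNIV perp" unfolding perp_def vec2_axis by (intro continuous_intros)
  then have [measurable]: "perp \<in> borel_measurable borel" by (rule borel_measurable_continuous_onI)
  show ?thesis unfolding biot_savart_kernel_def by measurable
qed

lemma biot_savart_integrable:
  assumes f: "integrable lebesgue f" and M: "AE y in lebesgue. \<bar>f y\<bar> \<le> M"
  shows "integrable lebesgue (\<lambda>y. f y *\<^sub>R biot_savart_kernel (x - y))"
proof (rule Bochner_Integration.integrable_bound)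
  have "AE y in lebesgue. \<bar>f y\<bar> \<le> \<bar>M\<bar>" using M by eventually_elim auto
  then show "integrable lebesgue (\<lambda>y. \<bar>f y\<bar> / norm (x - y))"
    using potential_bound(1)[OF f order_refl _ _ zero_less_one] by auto
  have [measurable]: "(\<lambda>y. biot_savart_kernel (x - y)) \<in> borel_measurable lebesgue"
    by (intro borel_lebesgue) measurable
  have [measurable]: "f \<in> borel_measurable lebesgue" using f by auto
  show "(\<lambda>y. f y *\<^sub>R biot_savart_kernel (x - y)) \<in> borel_measurable lebesgue" by measurable
  show "AE y in lebesgue. norm (f y *\<^sub>R biot_savart_kernel (x - y)) \<le> norm (\<bar>f y\<bar> / norm (x - y))"
  proof (rule AE_I2)
    fix y
    have "1 / (2 * pi * norm (x - y)) = (1 / (2 * pi)) * (1 / norm (x - y))" by simp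
    also have "\<dots> \<le> 1 * (1 / norm (x - y))" using pi_gt3 by (intro mult_right_mono) auto
    finally have "\<bar>f y\<bar> * (1 / (2 * pi * norm (x - y))) \<le> \<bar>f y\<bar> * (1 / norm (x - y))" by (intro mult_left_mono) auto
    then show "norm (f y *\<^sub>R biot_savart_kernel (x - y)) \<le> norm (\<bar>f y\<bar> / norm (x - y))"
      by (simp add: biot_savart_kernel_norm)
  qed
qed

lemma biot_savart_bound_gen:
  assumes f: "integrable lebesgue f" and m: "(LINT y|lebesgue. \<bar>f y\<bar>) \<le> m" 
    and M: "AE y in lebesgue. \<bar>f y\<bar> \<le> M" "0 \<le> M" and \<rho>: "0 < \<rho>"
  shows "norm (biot_savart f x) \<le> (4 * pi * M * \<rho> + m / \<rho>) / (2 * pi)"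
proof -
  note p = potential_bound[OF f m M \<rho>, of x]
  have "norm (biot_savart f x) \<le> (LINT y|lebesgue. (\<bar>f y\<bar> / norm (x - y)) / (2 * pi))"
    unfolding biot_savart_def
  proof (rule Bochner_Integration.integral_norm_bound_integral)
    show "integrable lebesgue (\<lambda>y. (\<bar>f y\<bar> / norm (x - y)) / (2 * pi))"
      using p(1) by (intro integrable_divide) auto
  qed (use biot_savart_integrable[OF f M(1)] in \<open>auto simp: biot_savart_kernel_norm mult_ac\<close>)
  also have "\<dots> \<le> (4 * pi * M * \<rho> + m / \<rho>) / (2 * pi)"
    using divide_right_mono[OF p(2), of "2 * pi"] by (subst integral_divide_zero) simp
  finally show ?thesis .
qed

lemma bounded_vorticity_nonneg: "bounded_vorticity M f \<Longrightarrow> 0 \<le> M"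
  unfolding bounded_vorticity_def using Bochner_Integration.integral_nonneg[of lebesgue "\<lambda>x. \<bar>f x\<bar>"] by linarith

lemma biot_savart_bound: assumes "bounded_vorticity M f" shows "norm (biot_savart f x) \<le> 3 * M"
proof -
  have "norm (biot_savart f x) \<le> (4 * pi * M * 1 + M / 1) / (2 * pi)"
    using assms bounded_vorticity_nonneg[OF assms] by (intro biot_savart_bound_gen) (auto simp: bounded_vorticity_def)
  also have "\<dots> \<le> 3 * M"
    using bounded_vorticity_nonneg[OF assms] pi_gt3 mult_right_mono[of 3 pi M] by (simp add: field_simps)
  finally show ?thesis .
qed

definition reg_velocity :: "nat \<Rightarrow> (real^2 \<Rightarrow> real) \<Rightarrow> real^2 \<Rightarrow> real^2" where
  "reg_velocity n f x = vector [LINT y|lebesgue. f y * reg_kernel1 n (x - y), LINT y|lebesgue. f y * reg_kernel2 n (x - y)]"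

definition reg_velocity_grad1 :: "nat \<Rightarrow> (real^2 \<Rightarrow> real) \<Rightarrow> real^2 \<Rightarrow> real^2" where
  "reg_velocity_grad1 n f x = (LINT y|lebesgue. f y *\<^sub>R reg_kernel_grad1 n (x - y))"
definition reg_velocity_grad2 :: "nat \<Rightarrow> (real^2 \<Rightarrow> real) \<Rightarrow> real^2 \<Rightarrow> real^2" where
  "reg_velocity_grad2 n f x = (LINT y|lebesgue. f y *\<^sub>R reg_kernel_grad2 n (x - y))"

lemma reg_velocity_eq: 
  assumes f: "integrable lebesgue f"
  shows "reg_velocity n f x = (LINT y|lebesgue. f y *\<^sub>R vector [reg_kernel1 n (x - y), reg_kernel2 n (x - y)])"
    "integrable lebesgue (\<lambda>y. f y *\<^sub>R (vector [reg_kernel1 n (x - y), reg_kernel2 n (x - y)] :: real^2))"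
proof -
  note i = integrable_mult_C1c(1)[OF f C1c_reg_kernel1[of n]] integrable_mult_C1c(1)[OF f C1c_reg_kernel2[of n]]
  have e: "f y *\<^sub>R (vector [reg_kernel1 n (x - y), reg_kernel2 n (x - y)] :: real^2)
     = (f y * reg_kernel1 n (x - y)) *\<^sub>R axis 1 1 + (f y * reg_kernel2 n (x - y)) *\<^sub>R axis 2 1" for y
    by (simp add: vec2_axis scaleR_add_right)
  show "integrable lebesgue (\<lambda>y. f y *\<^sub>R (vector [reg_kernel1 n (x - y), reg_kernel2 n (x - y)] :: real^2))"
    unfolding e using i by auto
  show "reg_velocity n f x = (LINT y|lebesgue. f y *\<^sub>R vector [reg_kernel1 n (x - y), reg_kernel2 n (x - y)])"
    unfolding e reg_velocity_def using i by (subst Bochner_Integration.integral_add) (auto simp: vec2_axis)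
qed

text \<open>
  Halving the scale halves the error, while by \<open>reg_velocity_grad_bound\<close> it adds only a constant to the Lipschitz
  constant of the regularised velocity. This imbalance is what makes the solution follow the
  particle trajectories.
\<close>

lemma biot_savart_approx:
  assumes f: "bounded_vorticity M f"
  shows "norm (biot_savart f x - reg_velocity n f x) \<le> 3 * M * (1/2)^n"
proof -
  have fi: "integrable lebesgue f" and M: "AE y in lebesgue. \<bar>f y\<bar> \<le> M" and m: "(LINT x|lebesgue. \<bar>f x\<bar>) \<le> M"
    using f by (auto simp: bounded_vorticity_def)
  have M0: "0 \<le> M" using bounded_vorticity_nonneg[OF f] .
  have fm: "f \<in> borel_measurable lebesgue" using fi by auto
  let ?r = "(1/2::real)^n"
  note np = near_potential_bound[OF fm M M0, of ?r x]
  let ?w = "\<lambda>y. (\<bar>f y\<bar> * (indicator (ball x ?r) y / norm (x - y)) + \<bar>f y\<bar> * (2 * ?r)) / (2 * pi)"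
  have wi: "integrable lebesgue ?w" using np fi by auto
  have "biot_savart f x - reg_velocity n f x = (LINT y|lebesgue. f y *\<^sub>R biot_savart_kernel (x - y) - f y *\<^sub>R vector [reg_kernel1 n (x - y), reg_kernel2 n (x - y)])"
    using reg_velocity_eq[OF fi] biot_savart_integrable[OF fi M] by (simp add: biot_savart_def Bochner_Integration.integral_diff)
  also have "norm \<dots> \<le> (LINT y|lebesgue. ?w y)"
  proof (rule Bochner_Integration.integral_norm_bound_integral)
    fix y
    have "norm (f y *\<^sub>R biot_savart_kernel (x - y) - f y *\<^sub>R vector [reg_kernel1 n (x - y), reg_kernel2 n (x - y)])
       = \<bar>f y\<bar> * norm (biot_savart_kernel (x - y) - vector [reg_kernel1 n (x - y), reg_kernel2 n (x - y)])"
      by (simp add: scaleR_diff_right[symmetric])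
    also have "\<dots> \<le> \<bar>f y\<bar> * ((indicator (ball 0 ?r) (x - y) / norm (x - y) + 2 * ?r) / (2 * pi))"
      by (intro mult_left_mono biot_savart_kernel_approx) auto
    also have "\<dots> = ?w y" by (simp add: ring_distribs dist_norm norm_minus_commute add_divide_distrib indicator_def)
    finally show "norm (f y *\<^sub>R biot_savart_kernel (x - y) - f y *\<^sub>R vector [reg_kernel1 n (x - y), reg_kernel2 n (x - y)]) \<le> ?w y" .
  qed (use reg_velocity_eq[OF fi] biot_savart_integrable[OF fi M] wi in auto)
  also have "\<dots> = ((LINT y|lebesgue. \<bar>f y\<bar> * (indicator (ball x ?r) y / norm (x - y))) + (LINT y|lebesgue. \<bar>f y\<bar>) * (2 * ?r)) / (2 * pi)"
  proof -
    have "(LINT y|lebesgue. \<bar>f y\<bar> * (indicator (ball x ?r) y / norm (x - y)) + \<bar>f y\<bar> * (2 * ?r))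
     = (LINT y|lebesgue. \<bar>f y\<bar> * (indicator (ball x ?r) y / norm (x - y))) + (LINT y|lebesgue. \<bar>f y\<bar> * (2 * ?r))"
      by (rule Bochner_Integration.integral_add) (use np fi in auto)
    then show ?thesis by simp
  qed
  also have "\<dots> \<le> (4 * pi * M * ?r + M * (2 * ?r)) / (2 * pi)"
    using np m by (intro divide_right_mono add_mono mult_right_mono) auto
  also have "\<dots> \<le> 3 * M * ?r"
  proof -
    have "3 * (M * ?r) \<le> pi * (M * ?r)" using M0 pi_gt3 by (intro mult_right_mono) auto
    moreover have "0 \<le> M * ?r" using M0 by simp
    ultimately have "4 * pi * M * ?r + M * (2 * ?r) \<le> 3 * M * ?r * (2 * pi)" by (simp add: mult_ac)
    then show ?thesis by (simp add: pos_divide_le_eq)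
  qed
  finally show ?thesis .
qed

lemma reg_velocity_has_derivative:
  assumes f: "integrable lebesgue f"
  shows "(reg_velocity n f has_derivative (\<lambda>k. vector [reg_velocity_grad1 n f x \<bullet> k, reg_velocity_grad2 n f x \<bullet> k])) (at x)"
  unfolding reg_velocity_def[abs_def] vec2_axis reg_velocity_grad1_def reg_velocity_grad2_def
  by (rule has_derivative_add[OF has_derivative_scaleR_left[OF convolution_has_derivative[OF f C1c_reg_kernel1]]
        has_derivative_scaleR_left[OF convolution_has_derivative[OF f C1c_reg_kernel2]]])

lemma reg_velocity_grad_continuous:
  assumes f: "integrable lebesgue f"
  shows "continuous_on UNIV (reg_velocity_grad1 n f)" "continuous_on UNIV (reg_velocity_grad2 n f)"
  using convolution_grad_continuous[OF f C1c_reg_kernel1] convolution_grad_continuous[OF f C1c_reg_kernel2]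
  by (simp_all add: reg_velocity_grad1_def[abs_def] reg_velocity_grad2_def[abs_def])

lemma reg_velocity_grad_trace:
  assumes f: "integrable lebesgue f"
  shows "reg_velocity_grad1 n f x $ 1 + reg_velocity_grad2 n f x $ 2 = 0"
proof -
  note i = integrable_mult_C1c(2)[OF f C1c_reg_kernel1[of n], of x] integrable_mult_C1c(2)[OF f C1c_reg_kernel2[of n], of x]
  have c: "(LINT y|lebesgue. g y) $ j = (LINT y|lebesgue. g y $ j)" if "integrable lebesgue g" for g :: "real^2 \<Rightarrow> real^2" and j
    using integral_bounded_linear[OF bounded_linear_vec_nth that, of j] by simp
  have ci: "integrable lebesgue (\<lambda>y. g y $ j)" if "integrable lebesgue g" for g :: "real^2 \<Rightarrow> real^2" and j
    using integrable_bounded_linear[OF bounded_linear_vec_nth that, of j] by simp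
  have "reg_velocity_grad1 n f x $ 1 + reg_velocity_grad2 n f x $ 2 = (LINT y|lebesgue. (f y *\<^sub>R reg_kernel_grad1 n (x - y)) $ 1 + (f y *\<^sub>R reg_kernel_grad2 n (x - y)) $ 2)"
    unfolding reg_velocity_grad1_def reg_velocity_grad2_def c[OF i(1)] c[OF i(2)]
    by (rule Bochner_Integration.integral_add[symmetric]) (intro ci i)+
  also have "\<dots> = (LINT y|(lebesgue :: (real^2) measure). 0)"
    by (rule Bochner_Integration.integral_cong[OF refl]) (simp add: distrib_left[symmetric] reg_kernel_grad_trace)
  finally show ?thesis by simp
qed

lemma reg_velocity_grad_bound:
  assumes f: "bounded_vorticity M f"
  shows "norm (reg_velocity_grad1 n f x) \<le> 17 * M * (real n + 1)" "norm (reg_velocity_grad2 n f x) \<le> 17 * M * (real n + 1)"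
proof -
  have fi: "integrable lebesgue f" and M: "AE y in lebesgue. \<bar>f y\<bar> \<le> M" and m: "(LINT x|lebesgue. \<bar>f x\<bar>) \<le> M"
    using f by (auto simp: bounded_vorticity_def)
  have M0: "0 \<le> M" using bounded_vorticity_nonneg[OF f] .
  have *: "norm (LINT y|lebesgue. f y *\<^sub>R w (x - y)) \<le> 17 * M * (real n + 1)"
    if w: "\<And>z. norm (w z) \<le> 1 / max ((norm z)\<^sup>2) ((1/4)^n)" and k: "C1c k w" for w :: "real^2 \<Rightarrow> real^2" and k
  proof -
    have fm[measurable]: "f \<in> borel_measurable lebesgue" using fi by auto
    have [measurable]: "(\<lambda>y. norm (x - y)) \<in> borel_measurable lebesgue"
      by (intro borel_lebesgue) measurable
    have il: "integrable lebesgue (\<lambda>y. \<bar>f y\<bar> / max ((norm (x - y))\<^sup>2) ((1/4)^n))"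
    proof (rule Bochner_Integration.integrable_bound[of lebesgue "\<lambda>y. \<bar>f y\<bar> / (1/4)^n"])
      show "AE y in lebesgue. norm (\<bar>f y\<bar> / max ((norm (x - y))\<^sup>2) ((1/4)^n)) \<le> norm (\<bar>f y\<bar> / (1/4)^n)"
        by (intro AE_I2) (auto intro!: divide_left_mono mult_pos_pos simp: less_max_iff_disj abs_of_pos)
    qed (use fi in auto)
    have "norm (LINT y|lebesgue. f y *\<^sub>R w (x - y)) \<le> (LINT y|lebesgue. \<bar>f y\<bar> / max ((norm (x - y))\<^sup>2) ((1/4)^n))"
    proof (rule Bochner_Integration.integral_norm_bound_integral)
      show "norm (f y *\<^sub>R w (x - y)) \<le> \<bar>f y\<bar> / max ((norm (x - y))\<^sup>2) ((1/4)^n)" for y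
        using mult_left_mono[OF w[of "x - y"], of "\<bar>f y\<bar>"] by simp
    qed (use il integrable_mult_C1c(2)[OF fi k] in auto)
    also have "\<dots> \<le> M + 4 * pi * M * (real n + 1)" by (rule log_potential_bound[OF fi m M M0])
    also have "\<dots> \<le> M * (real n + 1) + 16 * (M * (real n + 1))"
    proof (intro add_mono)
      show "M \<le> M * (real n + 1)" using M0 mult_left_mono[of 1 "real n + 1" M] by simp
      have "(4 * pi) * (M * (real n + 1)) \<le> 16 * (M * (real n + 1))" using M0 pi_less_4 by (intro mult_right_mono) auto
      then show "4 * pi * M * (real n + 1) \<le> 16 * (M * (real n + 1))" by (simp only: mult.assoc)
    qed
    finally show ?thesis by (simp add: algebra_simps)
  qed
  show "norm (reg_velocity_grad1 n f x) \<le> 17 * M * (real n + 1)" unfolding reg_velocity_grad1_def by (rule *[OF reg_kernel_grad_bound(1) C1c_reg_kernel1])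
  show "norm (reg_velocity_grad2 n f x) \<le> 17 * M * (real n + 1)" unfolding reg_velocity_grad2_def by (rule *[OF reg_kernel_grad_bound(2) C1c_reg_kernel2])
qed


section \<open>Consequences of the weak formulation\<close>

text \<open>
  A solution with its particle trajectories on a time window in which one constant \<open>M\<close> controls the vorticity.
  Taking \<open>M \<ge> 1\<close> is a normalisation.
\<close>

locale yudovich_flow =
  fixes \<Omega> :: "(real^2) set" and \<theta> :: "real \<Rightarrow> real^2 \<Rightarrow> real" and \<phi> :: "real^2 \<Rightarrow> real \<Rightarrow> real^2"
    and T M :: real
  assumes weak: "euler_weak_solution (indicator \<Omega>) \<theta>"
    and traj: "particle_trajectories (velocity \<theta>) \<phi>"
    and open_\<Omega>: "open \<Omega>" and bounded_\<Omega>: "bounded \<Omega>"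
    and T_pos: "0 < T" and M_ge_1: "1 \<le> M"
    and vort: "\<And>t. 0 \<le> t \<Longrightarrow> t \<le> T \<Longrightarrow> bounded_vorticity M (\<theta> t)"
begin

lemma M_nonneg: "0 \<le> M" using bounded_vorticity_nonneg[OF vort[of 0]] T_pos by simp

lemma vort_integrable: "0 \<le> t \<Longrightarrow> t \<le> T \<Longrightarrow> integrable lebesgue (\<theta> t)"
  and vort_L1: "0 \<le> t \<Longrightarrow> t \<le> T \<Longrightarrow> (LINT x|lebesgue. \<bar>\<theta> t x\<bar>) \<le> M"
  using vort by (auto simp: bounded_vorticity_def)

lemma velocity_bound: "0 \<le> t \<Longrightarrow> t \<le> T \<Longrightarrow> norm (velocity \<theta> t x) \<le> 3 * M"
  unfolding velocity_eq_biot_savart by (rule biot_savart_bound[OF vort])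

end

text \<open>
  The vorticity is Lebesgue measurable in space-time, which does not suit iterated integrals. Changing
  it on a null set affects neither the velocity nor the spatial integrals at almost every time.
\<close>

lemma borel_representative:
  assumes weak: "euler_weak_solution \<theta>0 \<theta>"
  obtains g :: "real \<Rightarrow> real^2 \<Rightarrow> real" where "(\<lambda>(t, x). g t x) \<in> borel_measurable (borel \<Otimes>\<^sub>M borel)"
    "AE t in lebesgue. 0 \<le> t \<longrightarrow> (AE x in lebesgue. \<theta> t x = g t x)"
proof -
  let ?S = "{0..} \<times> UNIV :: (real \<times> (real^2)) set"
  have S: "?S \<in> sets lebesgue" by (rule sets_completionI_sets) (simp add: borel_closed closed_Times)
  have "(\<lambda>(t, x). \<theta> t x) \<in> borel_measurable (lebesgue_on ?S)"
    using weak by (auto simp: euler_weak_solution_def)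
  from borel_measurable_if_I[OF this S]
  obtain h where h: "h \<in> borel_measurable lborel" "AE p in lborel. (if p \<in> ?S then case p of (t, x) \<Rightarrow> \<theta> t x else 0) = h p"
    using completion_ex_borel_measurable_real by blast
  show ?thesis
  proof
    show "(\<lambda>(t, x). curry h t x) \<in> borel_measurable (borel \<Otimes>\<^sub>M borel)"
      using h(1) by (simp add: borel_prod)
    have "AE p in (lborel \<Otimes>\<^sub>M lborel). (if p \<in> ?S then case p of (t, x) \<Rightarrow> \<theta> t x else 0) = h p"
      using h(2) by (simp only: lborel_prod)
    then have "AE t in lborel. AE x in lborel. (if (t, x) \<in> ?S then case (t, x) of (t, x) \<Rightarrow> \<theta> t x else 0) = h (t, x)"
      by (rule lborel_pair.AE_pair)
    then have "AE t in lborel. 0 \<le> t \<longrightarrow> (AE x in lebesgue. \<theta> t x = curry h t x)"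
    proof eventually_elim
      case (elim t)
      show ?case
      proof
        assume "0 \<le> t"
        then have "AE x in lborel. \<theta> t x = curry h t x" using elim by simp
        then show "AE x in lebesgue. \<theta> t x = curry h t x" by (rule AE_completion)
      qed
    qed
    then show "AE t in lebesgue. 0 \<le> t \<longrightarrow> (AE x in lebesgue. \<theta> t x = curry h t x)" by (rule AE_completion)
  qed
qed

lemma biot_savart_cong_AE:
  assumes "AE x in lebesgue. f x = g x" "f \<in> borel_measurable lebesgue" "g \<in> borel_measurable lebesgue"
  shows "biot_savart f = biot_savart g"
proof
  fix x
  have [measurable]: "(\<lambda>y. biot_savart_kernel (x - y)) \<in> borel_measurable lebesgue"
    by (intro borel_lebesgue) measurable
  note assms(2,3)[measurable]
  show "biot_savart f x = biot_savart g x" unfolding biot_savart_def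
  proof (rule integral_cong_AE)
    show "AE y in lebesgue. f y *\<^sub>R biot_savart_kernel (x - y) = g y *\<^sub>R biot_savart_kernel (x - y)"
      using assms(1) by eventually_elim simp
  qed measurable
qed

text \<open>
  Measurability in time lets the weak formulations for two final times be subtracted: the
  integral over \<open>{0..T}\<close> splits only if the integrand is integrable, and a non-integrable one would have
  integral 0 by convention.
\<close>

lemma weak_integrand_measurable:
  fixes p :: "real \<Rightarrow> real^2 \<Rightarrow> real" and q :: "real \<Rightarrow> real^2 \<Rightarrow> real^2"
  assumes weak: "euler_weak_solution \<theta>0 \<theta>"
    and meas: "\<And>t. 0 \<le> t \<Longrightarrow> \<theta> t \<in> borel_measurable lebesgue"
    and p: "continuous_on UNIV (\<lambda>(t, x). p t x)" and q: "continuous_on UNIV (\<lambda>(t, x). q t x)"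
  shows "(\<lambda>t. indicator {0..} t * (LINT x|lebesgue. \<theta> t x * (p t x + velocity \<theta> t x \<bullet> q t x))) \<in> borel_measurable lebesgue"
proof -
  obtain g where g[measurable]: "(\<lambda>(t, x). g t x) \<in> borel_measurable (borel \<Otimes>\<^sub>M borel)"
    and ae: "AE t in lebesgue. 0 \<le> t \<longrightarrow> (AE x in lebesgue. \<theta> t x = g t x)"
    using borel_representative[OF weak] by blast
  have [measurable]: "(\<lambda>(t, x). p t x) \<in> borel_measurable (borel \<Otimes>\<^sub>M borel)" "(\<lambda>(t, x). q t x) \<in> borel_measurable (borel \<Otimes>\<^sub>M borel)"
    using borel_measurable_continuous_onI[OF p] borel_measurable_continuous_onI[OF q] by (simp_all add: borel_prod)
  have gl: "g t \<in> borel_measurable borel" for t by measurable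
  define U where "U t x = (LINT y|lborel. g t y *\<^sub>R biot_savart_kernel (x - y))" for t x
  have U: "biot_savart (g t) x = U t x" for t x
    unfolding biot_savart_def U_def by (rule integral_completion) measurable
  have [measurable]: "(\<lambda>(t, x). U t x) \<in> borel_measurable (borel \<Otimes>\<^sub>M borel)"
  proof -
    have "(\<lambda>z. LINT y|lborel. g (fst z) y *\<^sub>R biot_savart_kernel (snd z - y)) \<in> borel_measurable (borel \<Otimes>\<^sub>M borel)"
      by (rule lborel.borel_measurable_lebesgue_integral) measurable
    then show ?thesis by (simp add: U_def case_prod_beta)
  qed
  define G where "G t = (LINT x|lborel. g t x * (p t x + U t x \<bullet> q t x))" for t
  have G: "G \<in> borel_measurable borel"
    unfolding G_def by (rule lborel.borel_measurable_lebesgue_integral) measurable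
  have "AE t in lebesgue. indicator {0..} t * G t = indicator {0..} t * (LINT x|lebesgue. \<theta> t x * (p t x + velocity \<theta> t x \<bullet> q t x))"
    using ae
  proof eventually_elim
    case (elim t)
    show ?case
    proof (cases "0 \<le> t")
      case True
      with elim have ae: "AE x in lebesgue. \<theta> t x = g t x" by simp
      have tm: "\<theta> t \<in> borel_measurable lebesgue" and gm: "g t \<in> borel_measurable lebesgue" using meas[OF True] gl by (auto intro: borel_lebesgue)
      have v: "velocity \<theta> t x = U t x" for x
        using biot_savart_cong_AE[OF ae tm gm] by (simp add: velocity_eq_biot_savart U)
      have [measurable]: "(\<lambda>x. p t x + U t x \<bullet> q t x) \<in> borel_measurable lebesgue"
        by (intro borel_lebesgue) measurable
      have "G t = (LINT x|lebesgue. g t x * (p t x + U t x \<bullet> q t x))"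
        unfolding G_def by (rule integral_completion[symmetric]) measurable
      also have "\<dots> = (LINT x|lebesgue. \<theta> t x * (p t x + velocity \<theta> t x \<bullet> q t x))"
      proof (rule integral_cong_AE)
        note tm[measurable] gm[measurable]
        show "(\<lambda>x. g t x * (p t x + U t x \<bullet> q t x)) \<in> borel_measurable lebesgue" by measurable
        show "(\<lambda>x. \<theta> t x * (p t x + velocity \<theta> t x \<bullet> q t x)) \<in> borel_measurable lebesgue" unfolding v by measurable
        show "AE x in lebesgue. g t x * (p t x + U t x \<bullet> q t x) = \<theta> t x * (p t x + velocity \<theta> t x \<bullet> q t x)"
          using ae unfolding v by eventually_elim simp
      qed
      finally show ?thesis by simp
    qed auto
  qed
  then show ?thesis
  proof (rule borel_measurable_AE[rotated])
    show "(\<lambda>t. indicator {0..} t * G t) \<in> borel_measurable lebesgue"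
      using G by (intro borel_lebesgue) measurable
  qed
qed

context yudovich_flow begin

lemma abs_integral_vort_le:
  assumes t: "0 \<le> t" "t \<le> T" and b: "\<And>x. \<bar>p x\<bar> \<le> b"
  shows "\<bar>LINT x|lebesgue. \<theta> t x * p x\<bar> \<le> M * b"
proof (cases "integrable lebesgue (\<lambda>x. \<theta> t x * p x)")
  case True
  have b0: "0 \<le> b" using b[of 0] by (meson abs_ge_zero order_trans)
  have "norm (LINT x|lebesgue. \<theta> t x * p x) \<le> (LINT x|lebesgue. \<bar>\<theta> t x\<bar> * b)"
    by (rule Bochner_Integration.integral_norm_bound_integral)
       (use True vort_integrable[OF t] b in \<open>auto simp: abs_mult intro!: mult_left_mono\<close>)
  also have "\<dots> \<le> M * b" using vort_L1[OF t] b0 by (simp add: mult_right_mono)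
  finally show ?thesis by simp
next
  case False
  have "0 \<le> b" using b[of 0] by (meson abs_ge_zero order_trans)
  with False show ?thesis using M_nonneg by (simp add: not_integrable_integral_eq)
qed

text \<open>
  Both derivatives vanish off the support, because its complement is open, and are continuous on it.
\<close>

lemma test_function_bounded:
  assumes "test_function \<psi> p q"
  obtains b where "0 \<le> b" "\<And>t x. \<bar>p t x\<bar> \<le> b" "\<And>t x. norm (q t x) \<le> b"
proof -
  have d: "((\<lambda>(t, x). \<psi> t x) has_derivative (\<lambda>(s, h). p t x * s + q t x \<bullet> h)) (at (t, x))" for t x
    using assms by (auto simp: test_function_def)
  have c: "continuous_on UNIV (\<lambda>(t, x). p t x)" "continuous_on UNIV (\<lambda>(t, x). q t x)"
    using assms by (auto simp: test_function_def)
  obtain S where S: "compact S" "\<And>t x. (t, x) \<notin> S \<Longrightarrow> \<psi> t x = 0"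
    using assms by (auto simp: test_function_def)
  have z: "p t x = 0 \<and> q t x = 0" if n: "(t, x) \<notin> S" for t x
  proof -
    have "((\<lambda>_. 0) has_derivative (\<lambda>(s, h). p t x * s + q t x \<bullet> h)) (at (t, x))"
    proof (rule has_derivative_transform_within_open[OF d])
      show "open (- S)" using S by (simp add: compact_imp_closed open_Compl)
      show "(case y of (t, x) \<Rightarrow> \<psi> t x) = 0" if "y \<in> - S" for y using that S(2) by (cases y) auto
    qed (use n in auto)
    moreover have "((\<lambda>_. 0::real) has_derivative (\<lambda>_. 0)) (at (t, x))" by simp
    ultimately have "(\<lambda>(s, h). p t x * s + q t x \<bullet> h) = (\<lambda>_. 0)" by (rule has_derivative_unique)
    from fun_cong[OF this, of "(1, 0)"] fun_cong[OF this, of "(0, q t x)"] show ?thesis by simp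
  qed
  have "compact ((\<lambda>(t, x). p t x) ` S)" "compact ((\<lambda>(t, x). q t x) ` S)"
    using S by (auto intro!: compact_continuous_image continuous_on_subset[OF c(1)] continuous_on_subset[OF c(2)])
  then obtain b1 b2 where b: "0 < b1" "\<forall>y\<in>(\<lambda>(t, x). p t x) ` S. norm y \<le> b1" "0 < b2" "\<forall>y\<in>(\<lambda>(t, x). q t x) ` S. norm y \<le> b2"
    using compact_imp_bounded bounded_pos by metis
  show ?thesis
  proof
    show "0 \<le> max b1 b2" using b by simp
    show "\<bar>p t x\<bar> \<le> max b1 b2" for t x using b z[of t x] by (cases "(t, x) \<in> S") (fastforce simp: le_max_iff_disj)+
    show "norm (q t x) \<le> max b1 b2" for t x using b z[of t x] by (cases "(t, x) \<in> S") (fastforce simp: le_max_iff_disj)+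
  qed
qed

lemma weak_increment_compact:
  assumes \<psi>: "test_function \<psi> p q" and s: "0 \<le> s" "s \<le> s'" "s' \<le> T"
    and B: "\<And>t. s \<le> t \<Longrightarrow> t \<le> s' \<Longrightarrow> \<bar>LINT x|lebesgue. \<theta> t x * (p t x + velocity \<theta> t x \<bullet> q t x)\<bar> \<le> B"
  shows "\<bar>(LINT x|lebesgue. \<theta> s' x * \<psi> s' x) - (LINT x|lebesgue. \<theta> s x * \<psi> s x)\<bar> \<le> B * (s' - s)"
proof -
  define F where "F t = (LINT x|lebesgue. \<theta> t x * (p t x + velocity \<theta> t x \<bullet> q t x))" for t
  obtain b where b: "0 \<le> b" "\<And>t x. \<bar>p t x\<bar> \<le> b" "\<And>t x. norm (q t x) \<le> b" using test_function_bounded[OF \<psi>] by metis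
  have cp: "continuous_on UNIV (\<lambda>(t, x). p t x)" "continuous_on UNIV (\<lambda>(t, x). q t x)"
    using \<psi> by (auto simp: test_function_def)
  have Fb: "\<bar>F t\<bar> \<le> M * (b + 3 * M * b)" if t: "0 \<le> t" "t \<le> T" for t
    unfolding F_def
  proof (rule abs_integral_vort_le[OF t])
    fix x
    have "\<bar>velocity \<theta> t x \<bullet> q t x\<bar> \<le> norm (velocity \<theta> t x) * norm (q t x)" by (rule Cauchy_Schwarz_ineq2)
    also have "\<dots> \<le> 3 * M * b" using velocity_bound[OF t] b M_nonneg by (intro mult_mono) auto
    finally show "\<bar>p t x + velocity \<theta> t x \<bullet> q t x\<bar> \<le> b + 3 * M * b" using b(2)[of t x] by linarith
  qed
  have Bi: "\<exists>M. \<forall>t\<in>{0..U}. integrable lebesgue (\<theta> t)" if "0 < U" for U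
    using weak that unfolding euler_weak_solution_def by blast
  have "\<theta> t \<in> borel_measurable lebesgue" if "0 \<le> t" for t
    using Bi[of "t + 1"] that by auto
  from weak_integrand_measurable[OF weak this cp]
  have Fm[measurable]: "(\<lambda>t. indicator {0..} t * F t) \<in> borel_measurable lebesgue" unfolding F_def by blast
  have Fi: "set_integrable lebesgue {0..T} F"
  proof -
    have [measurable]: "{0..T} \<in> sets lebesgue" by simp
    have "integrable lebesgue (\<lambda>t. indicator {0..T} t * (indicator {0..} t * F t))"
    proof (rule Bochner_Integration.integrable_bound)
      show "integrable lebesgue (\<lambda>t. indicator {0..T} t * (M * (b + 3 * M * b)))"
        by (intro integrable_mult_left integrable_real_indicator) (auto simp: emeasure_lborel_Icc_eq)
      show "AE t in lebesgue. norm (indicator {0..T} t * (indicator {0..} t * F t)) \<le> norm (indicator {0..T} t * (M * (b + 3 * M * b)))"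
        using Fb by (intro AE_I2) (fastforce split: split_indicator)
    qed measurable
    moreover have "(\<lambda>t. indicator {0..T} t * (indicator {0..} t * F t)) = (\<lambda>t. indicator {0..T} t *\<^sub>R F t)"
      by (auto simp: fun_eq_iff split: split_indicator)
    ultimately show ?thesis by (simp add: set_integrable_def)
  qed
  have sub: "set_integrable lebesgue A F" if "A \<in> sets lebesgue" "A \<subseteq> {0..T}" for A
    by (rule set_integrable_subset[OF Fi that])
  define D where "D t = (LINT x|lebesgue. \<theta> t x * \<psi> t x)" for t
  have D: "D t - D 0 = (LINT t:{0..t}|lebesgue. F t)" if "0 \<le> t" "t \<le> T" for t
  proof (cases "t = 0")
    case True
    have "(LINT t:{0..0::real}|lebesgue. F t) = 0"
      unfolding set_lebesgue_integral_def
    proof (rule integral_eq_zero_AE)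
      have "AE t in lebesgue. t \<noteq> (0::real)" by (intro AE_completion AE_lborel_singleton)
      then show "AE t in lebesgue. indicat_real {0..0} t *\<^sub>R F t = 0" by eventually_elim (auto split: split_indicator)
    qed
    with True show ?thesis by simp
  next
    case False
    with that have "0 < t" by simp
    with weak \<psi> show ?thesis unfolding euler_weak_solution_def D_def F_def by blast
  qed
  have "(LINT t:{0..s'}|lebesgue. F t) = (LINT t:{0..s} \<union> {s<..s'}|lebesgue. F t)"
    using s by (intro arg_cong[where f="\<lambda>A. set_lebesgue_integral lebesgue A F"]) auto
  also have "\<dots> = (LINT t:{0..s}|lebesgue. F t) + (LINT t:{s<..s'}|lebesgue. F t)"
    using s by (intro set_integral_Un sub) auto
  finally have "D s' - D s = (LINT t:{s<..s'}|lebesgue. F t)"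
    using D[of s] D[of s'] s by linarith
  also have "\<bar>\<dots>\<bar> \<le> (LINT t:{s<..s'}|lebesgue. B)"
    unfolding set_lebesgue_integral_def real_norm_def[symmetric]
  proof (rule Bochner_Integration.integral_norm_bound_integral)
    show "integrable lebesgue (\<lambda>t. indicator {s<..s'} t *\<^sub>R F t)"
    proof -
      have "{s<..s'} \<subseteq> {0..T}" using s by auto
      then show ?thesis using sub[of "{s<..s'}"] by (simp add: set_integrable_def)
    qed
    show "integrable lebesgue (\<lambda>t. indicator {s<..s'} t *\<^sub>R B)" 
      by (intro integrable_scaleR_left integrable_real_indicator) (use s in auto)
    show "norm (indicator {s<..s'} t *\<^sub>R F t) \<le> indicator {s<..s'} t *\<^sub>R B" for t
      using B[of t] by (auto simp: F_def split: split_indicator)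
  qed
  also have "\<dots> = B * (s' - s)" using s by (simp add: set_lebesgue_integral_def)
  finally show ?thesis by (simp add: D_def)
qed

text \<open>
  Multiplying by a function of time that equals 1 on \<open>{0..T}\<close> does not change the weak formulation
  there, so bounded support in space over a slightly longer time interval suffices.
\<close>

lemma weak_increment:
  assumes d: "\<And>t x. ((\<lambda>(t, x). \<psi> t x) has_derivative (\<lambda>(s, h). p t x * s + q t x \<bullet> h)) (at (t, x))"
    and c: "continuous_on UNIV (\<lambda>(t, x). p t x)" "continuous_on UNIV (\<lambda>(t, x). q t x)"
    and supp: "\<And>t x. - 1 \<le> t \<Longrightarrow> t \<le> T + 1 \<Longrightarrow> r \<le> norm x \<Longrightarrow> \<psi> t x = 0"
    and s: "0 \<le> s" "s \<le> s'" "s' \<le> T"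
    and B: "\<And>t. s \<le> t \<Longrightarrow> t \<le> s' \<Longrightarrow> \<bar>LINT x|lebesgue. \<theta> t x * (p t x + velocity \<theta> t x \<bullet> q t x)\<bar> \<le> B"
  shows "\<bar>(LINT x|lebesgue. \<theta> s' x * \<psi> s' x) - (LINT x|lebesgue. \<theta> s x * \<psi> s x)\<bar> \<le> B * (s' - s)"
proof -
  define \<eta> where "\<eta> t = smoothstep (t + 1) * smoothstep (T + 1 - t)" for t
  define \<eta>' where "\<eta>' t = smoothstep' (t + 1) * smoothstep (T + 1 - t) + smoothstep (t + 1) * (- smoothstep' (T + 1 - t))" for t
  have d1: "((\<lambda>t. smoothstep (t + 1)) has_real_derivative smoothstep' (t + 1) * 1) (at t)" for t
    by (rule DERIV_chain2[OF DERIV_smoothstep]) (auto intro!: derivative_eq_intros)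
  have d2: "((\<lambda>t. smoothstep (T + 1 - t)) has_real_derivative smoothstep' (T + 1 - t) * (- 1)) (at t)" for t
    by (rule DERIV_chain2[OF DERIV_smoothstep]) (auto intro!: derivative_eq_intros)
  have dc: "(\<eta> has_real_derivative \<eta>' t) (at t)" for t
    using DERIV_mult[OF d1 d2, of t] by (simp add: \<eta>_def[abs_def] \<eta>'_def algebra_simps)
  have cs: "continuous_on UNIV smoothstep"
    by (rule DERIV_continuous_on[OF DERIV_smoothstep[THEN DERIV_subset]]) auto
  have cc: "continuous_on UNIV \<eta>" "continuous_on UNIV \<eta>'"
    unfolding \<eta>_def[abs_def] \<eta>'_def[abs_def]
    by (intro continuous_intros continuous_on_compose2[OF cs] continuous_on_compose2[OF continuous_smoothstep']; simp)+
  have c1: "\<eta> t = 1 \<and> \<eta>' t = 0" if "0 \<le> t" "t \<le> T" for t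
  proof -
    have *: "smoothstep' y = 0" if "1 \<le> y" for y :: real
    proof -
      have "1 \<le> y\<^sup>2" using that by simp
      then show ?thesis using that by (simp add: smoothstep'_def)
    qed
    show ?thesis using that smoothstep_props(2)[of "t+1"] smoothstep_props(2)[of "T+1-t"] *[of "t+1"] *[of "T+1-t"]
      by (simp add: \<eta>_def \<eta>'_def)
  qed
  have c0: "\<eta> t = 0" if "t \<le> -1 \<or> T + 1 \<le> t" for t
    using that smoothstep_props(1)[of "t+1"] smoothstep_props(1)[of "T+1-t"] by (auto simp: \<eta>_def)
  have co: "continuous_on UNIV (\<lambda>(t, x). \<psi> t x)"
  proof (rule has_derivative_continuous_on)
    fix z :: "real \<times> (real^2)"
    show "((\<lambda>(t, x). \<psi> t x) has_derivative (\<lambda>(s, h). p (fst z) (snd z) * s + q (fst z) (snd z) \<bullet> h)) (at z within UNIV)"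
      using d[of "fst z" "snd z"] by simp
  qed
  have tf: "test_function (\<lambda>t x. \<eta> t * \<psi> t x) (\<lambda>t x. \<eta>' t * \<psi> t x + \<eta> t * p t x) (\<lambda>t x. \<eta> t *\<^sub>R q t x)"
    unfolding test_function_def
  proof (intro conjI allI)
    fix t :: real and x :: "real^2"
    have f: "((\<lambda>z. \<eta> (fst z)) has_derivative (\<lambda>z. \<eta>' t * fst z)) (at (t, x))"
      using has_derivative_compose[OF has_derivative_fst[OF has_derivative_ident], of \<eta> "\<lambda>h. \<eta>' t * h" "(t, x)" UNIV]
        dc[of t] by (simp add: has_field_derivative_def)
    have "((\<lambda>z. \<eta> (fst z) * (case z of (t, x) \<Rightarrow> \<psi> t x)) has_derivative
       (\<lambda>z. \<eta> (fst (t, x)) * (case z of (s, h) \<Rightarrow> p t x * s + q t x \<bullet> h) + \<eta>' t * fst z * (case (t, x) of (t, x) \<Rightarrow> \<psi> t x))) (at (t, x))"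
      by (rule has_derivative_mult[OF f d])
    then show "((\<lambda>(t, x). \<eta> t * \<psi> t x) has_derivative (\<lambda>(s, h). (\<eta>' t * \<psi> t x + \<eta> t * p t x) * s + \<eta> t *\<^sub>R q t x \<bullet> h)) (at (t, x))"
      by (simp add: case_prod_beta' algebra_simps)
  next
    have cf: "continuous_on UNIV (\<lambda>z::real \<times> (real^2). \<eta> (fst z))" "continuous_on UNIV (\<lambda>z::real \<times> (real^2). \<eta>' (fst z))"
      by (intro continuous_on_compose2[OF cc(1)] continuous_on_compose2[OF cc(2)] continuous_intros; simp)+
    show "continuous_on UNIV (\<lambda>(t, x). \<eta>' t * \<psi> t x + \<eta> t * p t x)"
      using continuous_on_add[OF continuous_on_mult[OF cf(2) co] continuous_on_mult[OF cf(1) c(1)]] by (simp add: case_prod_beta)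
    show "continuous_on UNIV (\<lambda>(t, x). \<eta> t *\<^sub>R q t x)"
      using continuous_on_scaleR[OF cf(1) c(2)] by (simp add: case_prod_beta)
  next
    show "\<exists>S. compact S \<and> (\<forall>t x. (t, x) \<notin> S \<longrightarrow> \<eta> t * \<psi> t x = 0)"
    proof (intro exI[of _ "{- 1..T + 1} \<times> cball 0 r"] conjI allI impI)
      show "compact ({- 1..T + 1} \<times> cball (0::real^2) r)" by (intro compact_Times) auto
      show "\<eta> t * \<psi> t x = 0" if "(t, x) \<notin> {- 1..T + 1} \<times> cball 0 r" for t x
        using that c0[of t] supp[of t x] by (cases "- 1 \<le> t \<and> t \<le> T + 1") auto
    qed
  qed
  have "\<bar>(LINT x|lebesgue. \<theta> s' x * (\<eta> s' * \<psi> s' x)) - (LINT x|lebesgue. \<theta> s x * (\<eta> s * \<psi> s x))\<bar> \<le> B * (s' - s)"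
  proof (rule weak_increment_compact[OF tf s])
    show "\<bar>LINT x|lebesgue. \<theta> t x * (\<eta>' t * \<psi> t x + \<eta> t * p t x + velocity \<theta> t x \<bullet> \<eta> t *\<^sub>R q t x)\<bar> \<le> B"
      if "s \<le> t" "t \<le> s'" for t
      using B[OF that] c1[of t] that s by simp
  qed
  then show ?thesis using c1[of s] c1[of s'] s by simp
qed

lemma weak_increment_static:
  assumes G: "C1c G G'" and s: "0 \<le> s" "s \<le> s'" "s' \<le> T"
    and B: "\<And>t. s \<le> t \<Longrightarrow> t \<le> s' \<Longrightarrow> \<bar>LINT x|lebesgue. \<theta> t x * (velocity \<theta> t x \<bullet> G' x)\<bar> \<le> B"
  shows "\<bar>(LINT x|lebesgue. \<theta> s' x * G x) - (LINT x|lebesgue. \<theta> s x * G x)\<bar> \<le> B * (s' - s)"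
proof -
  obtain r where r: "\<And>x. r \<le> norm x \<Longrightarrow> G x = 0" using C1c_support[OF G] by metis
  show ?thesis
  proof (rule weak_increment[where p = "\<lambda>t x. 0" and q = "\<lambda>t. G'" and r = r and \<psi> = "\<lambda>t. G"])
    show "((\<lambda>(t, x). G x) has_derivative (\<lambda>(s, h). 0 * s + G' x \<bullet> h)) (at (t, x))" for t :: real and x
      using has_derivative_compose[OF has_derivative_snd[OF has_derivative_ident], of G "\<lambda>k. G' x \<bullet> k" "(t, x)" UNIV] C1c_deriv[OF G, of x]
      by (simp add: case_prod_beta')
    show "continuous_on UNIV (\<lambda>(t::real, x). G' x)"
      unfolding case_prod_beta' by (intro continuous_on_compose2[OF C1c_continuous_grad[OF G]] continuous_intros) auto
  qed (use r s B in auto)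
qed

end

section \<open>One explicit Euler step\<close>

text \<open>
  \<open>w1\<close> and \<open>w2\<close> are the gradients of the components of \<open>v\<close>; the last two clauses are
  incompressibility and a bound for the Lipschitz constant.
\<close>

definition smooth_field :: "(real^2 \<Rightarrow> real^2) \<Rightarrow> (real^2 \<Rightarrow> real^2) \<Rightarrow> (real^2 \<Rightarrow> real^2) \<Rightarrow> real \<Rightarrow> bool" where
  "smooth_field v w1 w2 l \<longleftrightarrow>
     (\<forall>x. (v has_derivative (\<lambda>k. vector [w1 x \<bullet> k, w2 x \<bullet> k])) (at x)) \<and>
     continuous_on UNIV w1 \<and> continuous_on UNIV w2 \<and>
     (\<forall>x. w1 x $ 1 + w2 x $ 2 = 0) \<and> (\<forall>x. norm (w1 x) + norm (w2 x) \<le> l)"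

lemma smooth_field_lipschitz:
  assumes v: "smooth_field v w1 w2 l"
  shows "norm (v x - v y) \<le> l * norm (x - y)"
proof (rule differentiable_bound[of UNIV v "\<lambda>x k. vector [w1 x \<bullet> k, w2 x \<bullet> k]"])
  fix z :: "real^2"
  show "(v has_derivative (\<lambda>k. vector [w1 z \<bullet> k, w2 z \<bullet> k])) (at z within UNIV)" using v by (auto simp: smooth_field_def)
  show "onorm (\<lambda>k. vector [w1 z \<bullet> k, w2 z \<bullet> k] :: real^2) \<le> l"
  proof (rule onorm_le)
    fix k
    have "norm (vector [w1 z \<bullet> k, w2 z \<bullet> k] :: real^2) \<le> \<bar>w1 z \<bullet> k\<bar> + \<bar>w2 z \<bullet> k\<bar>"
      using norm_le_l1_cart[of "vector [w1 z \<bullet> k, w2 z \<bullet> k] :: real^2"] by (simp add: sum_2)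
    also have "\<dots> \<le> norm (w1 z) * norm k + norm (w2 z) * norm k"
      by (intro add_mono Cauchy_Schwarz_ineq2)
    also have "\<dots> \<le> l * norm k" using v by (simp add: smooth_field_def distrib_right[symmetric] mult_right_mono)
    finally show "norm (vector [w1 z \<bullet> k, w2 z \<bullet> k] :: real^2) \<le> l * norm k" .
  qed
qed auto

lemma smooth_field_nonneg: "smooth_field v w1 w2 l \<Longrightarrow> 0 \<le> l"
proof -
  assume "smooth_field v w1 w2 l"
  then have "norm (w1 0) + norm (w2 0) \<le> l" by (auto simp: smooth_field_def)
  then show ?thesis using norm_ge_zero[of "w1 0"] norm_ge_zero[of "w2 0"] by linarith
qed

lemma smooth_field_continuous: "smooth_field v w1 w2 l \<Longrightarrow> continuous_on UNIV v"
  by (rule has_derivative_continuous_on[of UNIV v "\<lambda>x k. vector [w1 x \<bullet> k, w2 x \<bullet> k]"]) (auto simp: smooth_field_def)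

lemma inner_vec2: "z \<bullet> (vector [a, b] :: real^2) = z $ 1 * a + z $ 2 * b"
  by (simp add: inner_vec_def sum_2)

text \<open>
  Moving the argument of \<open>G\<close> along straight lines leads from the composition of \<open>G\<close> with the Euler step
  \<open>x \<mapsto> x + h *\<^sub>R v x\<close>, at time \<open>a - h\<close>, to \<open>G\<close> itself, at time \<open>a\<close>. The derivatives involve
  only first derivatives of \<open>G\<close> and \<open>v\<close>, so the class \<open>C\<^sup>1\<^sub>c\<close> is closed under repeated steps with
  control of the gradient alone.
\<close>

lemma step_function_derivative:
  assumes G: "C1c G G'" and v: "smooth_field v w1 w2 l"
  shows "((\<lambda>(t, x). G (x + (a - t) *\<^sub>R v x)) has_derivative
     (\<lambda>(s, k). - (G' (x + (a - t) *\<^sub>R v x) \<bullet> v x) * s +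
        (G' (x + (a - t) *\<^sub>R v x) + (a - t) *\<^sub>R (G' (x + (a - t) *\<^sub>R v x) $ 1 *\<^sub>R w1 x + G' (x + (a - t) *\<^sub>R v x) $ 2 *\<^sub>R w2 x)) \<bullet> k)) (at (t, x))"
proof -
  let ?y = "x + (a - t) *\<^sub>R v x"
  have dv: "((\<lambda>z. v (snd z)) has_derivative (\<lambda>z. vector [w1 x \<bullet> snd z, w2 x \<bullet> snd z])) (at (t, x))"
    using has_derivative_compose[OF has_derivative_snd[OF has_derivative_ident], of v "\<lambda>k. vector [w1 x \<bullet> k, w2 x \<bullet> k]" "(t, x)" UNIV] v
    by (simp add: smooth_field_def)
  have dt: "((\<lambda>z. a - fst z) has_derivative (\<lambda>z. 0 - fst z)) (at (t, x))"
    by (intro has_derivative_diff has_derivative_const has_derivative_fst has_derivative_ident)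
  have "((\<lambda>z. snd z + (a - fst z) *\<^sub>R v (snd z)) has_derivative
     (\<lambda>z. snd z + ((a - fst (t, x)) *\<^sub>R vector [w1 x \<bullet> snd z, w2 x \<bullet> snd z] + (0 - fst z) *\<^sub>R v (snd (t, x))))) (at (t, x))"
    by (intro has_derivative_add has_derivative_snd has_derivative_ident has_derivative_scaleR dt dv)
  from has_derivative_compose[OF this, of G "\<lambda>k. G' ?y \<bullet> k"] C1c_deriv[OF G, of ?y]
  have "((\<lambda>z. G (snd z + (a - fst z) *\<^sub>R v (snd z))) has_derivative
     (\<lambda>z. G' ?y \<bullet> (snd z + ((a - t) *\<^sub>R vector [w1 x \<bullet> snd z, w2 x \<bullet> snd z] + (0 - fst z) *\<^sub>R v x)))) (at (t, x))"
    by simp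
  then show ?thesis
    by (simp add: case_prod_beta' inner_vec2 inner_add_left inner_add_right algebra_simps)
qed

lemma C1c_step:
  assumes G: "C1c G G'" "\<And>x. norm (G' x) \<le> L" and v: "smooth_field v w1 w2 l" and b: "\<And>x. norm (v x) \<le> b" and h: "0 \<le> h"
  obtains H where "C1c (\<lambda>x. G (x + h *\<^sub>R v x)) H" "\<And>x. norm (H x) \<le> L * (1 + h * l)"
proof -
  define H where "H x = G' (x + h *\<^sub>R v x) + h *\<^sub>R (G' (x + h *\<^sub>R v x) $ 1 *\<^sub>R w1 x + G' (x + h *\<^sub>R v x) $ 2 *\<^sub>R w2 x)" for x
  have cv: "continuous_on UNIV v" using smooth_field_continuous[OF v] .
  obtain r where r: "\<And>x. r \<le> norm x \<Longrightarrow> G x = 0" using C1c_support[OF G(1)] by metis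
  have L: "0 \<le> L" using G(2)[of 0] norm_ge_zero order_trans by blast
  show ?thesis
  proof
    show "C1c (\<lambda>x. G (x + h *\<^sub>R v x)) H"
      unfolding C1c_def
    proof (intro conjI allI)
      fix x :: "real^2"
      have "((\<lambda>x. (0::real, x)) has_derivative (\<lambda>k. (0, k))) (at x)"
        by (intro has_derivative_Pair has_derivative_const has_derivative_ident)
      from has_derivative_compose[OF this step_function_derivative[OF G(1) v, of h x 0]]
      show "((\<lambda>x. G (x + h *\<^sub>R v x)) has_derivative (\<bullet>) (H x)) (at x)" by (simp add: H_def)
    next
      have c: "continuous_on UNIV (\<lambda>x. G' (x + h *\<^sub>R v x))"
        by (intro continuous_on_compose2[OF C1c_continuous_grad[OF G(1)]] continuous_intros cv) auto
      have cw: "continuous_on UNIV w1" "continuous_on UNIV w2" using v by (auto simp: smooth_field_def)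
      show "continuous_on UNIV H" unfolding H_def by (intro continuous_intros c cw)
    next
      show "\<exists>r. \<forall>x. r \<le> norm x \<longrightarrow> G (x + h *\<^sub>R v x) = 0"
      proof (intro exI[of _ "r + h * b"] allI impI r)
        fix x :: "real^2" assume x: "r + h * b \<le> norm x"
        have "norm (h *\<^sub>R v x) \<le> h * b" using b h by (simp add: mult_left_mono)
        then show "r \<le> norm (x + h *\<^sub>R v x)" using norm_diff_ineq[of x "h *\<^sub>R v x"] x by linarith
      qed
    qed
    show "norm (H x) \<le> L * (1 + h * l)" for x
    proof -
      let ?g = "G' (x + h *\<^sub>R v x)"
      have "norm (?g $ 1 *\<^sub>R w1 x + ?g $ 2 *\<^sub>R w2 x) \<le> \<bar>?g $ 1\<bar> * norm (w1 x) + \<bar>?g $ 2\<bar> * norm (w2 x)"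
        by (rule norm_triangle_le) simp
      also have "\<dots> \<le> L * norm (w1 x) + L * norm (w2 x)"
        using component_le_norm_cart[of ?g] G(2)[of "x + h *\<^sub>R v x"] by (intro add_mono mult_right_mono) (auto intro: order_trans)
      also have "\<dots> \<le> L * l" using v L by (simp add: smooth_field_def distrib_left[symmetric] mult_left_mono)
      finally have *: "norm (h *\<^sub>R (?g $ 1 *\<^sub>R w1 x + ?g $ 2 *\<^sub>R w2 x)) \<le> h * (L * l)" using h by (simp add: mult_left_mono)
      have "norm (H x) \<le> norm ?g + norm (h *\<^sub>R (?g $ 1 *\<^sub>R w1 x + ?g $ 2 *\<^sub>R w2 x))"
        unfolding H_def by (rule norm_triangle_ineq)
      then show ?thesis using * G(2)[of "x + h *\<^sub>R v x"] by (simp add: algebra_simps)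
    qed
  qed
qed

context yudovich_flow begin

text \<open>
  Along the interpolation, the transport operator leaves
  \<open>\<nabla>G \<bullet> (u - v) + (a - t) \<nabla>G \<bullet> (Dv u)\<close>: the velocity error and a term of first order
  in \<open>h\<close>, both multiplied by the gradient bound \<open>L\<close> only.
\<close>

lemma vort_step:
  assumes G: "C1c G G'" "\<And>x. norm (G' x) \<le> L" and v: "smooth_field v w1 w2 l" and b: "\<And>x. norm (v x) \<le> b"
    and s: "0 \<le> s" "0 \<le> h" "s + h \<le> T"
    and e: "\<And>t x. s \<le> t \<Longrightarrow> t \<le> s + h \<Longrightarrow> norm (velocity \<theta> t x - v x) \<le> e"
  shows "\<bar>(LINT x|lebesgue. \<theta> (s + h) x * G x) - (LINT x|lebesgue. \<theta> s x * G (x + h *\<^sub>R v x))\<bar> \<le> M * (L * (e + 3 * M * h * l)) * h"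
proof -
  let ?a = "s + h"
  let ?y = "\<lambda>t x. x + (?a - t) *\<^sub>R v x"
  let ?p = "\<lambda>t x. - (G' (?y t x) \<bullet> v x)"
  let ?W = "\<lambda>t x. G' (?y t x) $ 1 *\<^sub>R w1 x + G' (?y t x) $ 2 *\<^sub>R w2 x"
  let ?q = "\<lambda>t x. G' (?y t x) + (?a - t) *\<^sub>R ?W t x"
  obtain r where r: "\<And>x. r \<le> norm x \<Longrightarrow> G x = 0" using C1c_support[OF G(1)] by metis
  have cv: "continuous_on UNIV v" using smooth_field_continuous[OF v] .
  have cw: "continuous_on UNIV w1" "continuous_on UNIV w2" using v by (auto simp: smooth_field_def)
  have L: "0 \<le> L" using G(2)[of 0] norm_ge_zero order_trans by blast
  have b0: "0 \<le> b" using b[of 0] norm_ge_zero order_trans by blast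
  have l: "0 \<le> l" using smooth_field_nonneg[OF v] .
  have cg: "continuous_on UNIV (\<lambda>(t, x). G' (?y t x))"
    unfolding case_prod_beta'
    by (intro continuous_on_compose2[OF C1c_continuous_grad[OF G(1)]] continuous_intros continuous_on_compose2[OF cv]) auto
  have "\<bar>(LINT x|lebesgue. \<theta> (s + h) x * G (?y (s + h) x)) - (LINT x|lebesgue. \<theta> s x * G (?y s x))\<bar>
     \<le> M * (L * (e + 3 * M * h * l)) * (s + h - s)"
  proof (rule weak_increment[where p = ?p and q = ?q and r = "r + (T + 1) * b"])
    show "((\<lambda>(t, x). G (?y t x)) has_derivative (\<lambda>(s, k). ?p t x * s + ?q t x \<bullet> k)) (at (t, x))" for t x
      by (rule step_function_derivative[OF G(1) v])
    show "continuous_on UNIV (\<lambda>(t, x). ?p t x)"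
      using cg unfolding case_prod_beta' by (intro continuous_intros continuous_on_compose2[OF cv]) auto
    show "continuous_on UNIV (\<lambda>(t, x). ?q t x)"
      using cg unfolding case_prod_beta' by (intro continuous_intros continuous_on_compose2[OF cw(1)] continuous_on_compose2[OF cw(2)]) auto
    show "G (?y t x) = 0" if t: "-1 \<le> t" "t \<le> T + 1" and x: "r + (T + 1) * b \<le> norm x" for t x
    proof (rule r)
      have "norm ((?a - t) *\<^sub>R v x) \<le> (T + 1) * b"
        using s t b b0 T_pos by (auto intro!: mult_mono)
      then show "r \<le> norm (?y t x)" using norm_diff_ineq[of x "(?a - t) *\<^sub>R v x"] x by linarith
    qed
    show "\<bar>LINT x|lebesgue. \<theta> t x * (?p t x + velocity \<theta> t x \<bullet> ?q t x)\<bar> \<le> M * (L * (e + 3 * M * h * l))"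
      if t: "s \<le> t" "t \<le> s + h" for t
    proof (rule abs_integral_vort_le)
      show t0: "0 \<le> t" "t \<le> T" using s t by auto
      fix x
      let ?g = "G' (?y t x)" and ?u = "velocity \<theta> t x"
      have eq: "?p t x + ?u \<bullet> ?q t x = ?g \<bullet> (?u - v x) + (?a - t) * (?u \<bullet> ?W t x)"
        by (simp add: inner_diff_right inner_diff_left inner_add_right inner_commute)
      have 1: "\<bar>?g \<bullet> (?u - v x)\<bar> \<le> L * e"
        using Cauchy_Schwarz_ineq2[of ?g "?u - v x"] mult_mono[OF G(2)[of "?y t x"] e[OF t, of x] L norm_ge_zero] by linarith
      have "norm (?W t x) \<le> \<bar>?g $ 1\<bar> * norm (w1 x) + \<bar>?g $ 2\<bar> * norm (w2 x)"
        by (rule norm_triangle_le) simp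
      also have "\<dots> \<le> L * norm (w1 x) + L * norm (w2 x)"
        using component_le_norm_cart[of ?g] G(2)[of "?y t x"] by (intro add_mono mult_right_mono) (auto intro: order_trans)
      also have "\<dots> \<le> L * l" using v L by (simp add: smooth_field_def distrib_left[symmetric] mult_left_mono)
      finally have W: "norm (?W t x) \<le> L * l" .
      have "\<bar>?u \<bullet> ?W t x\<bar> \<le> 3 * M * (L * l)"
        using Cauchy_Schwarz_ineq2[of ?u "?W t x"] mult_mono[OF velocity_bound[OF t0, of x] W] M_nonneg by force
      then have "\<bar>(?a - t) * (?u \<bullet> ?W t x)\<bar> \<le> h * (3 * M * (L * l))"
        unfolding abs_mult using t s by (intro mult_mono) auto
      then have "\<bar>?p t x + ?u \<bullet> ?q t x\<bar> \<le> L * e + h * (3 * M * (L * l))" unfolding eq using 1 by linarith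
      then show "\<bar>?p t x + ?u \<bullet> ?q t x\<bar> \<le> L * (e + 3 * M * h * l)" by (simp add: algebra_simps)
    qed
  qed (use s in auto)
  then show ?thesis by simp
qed

lemma traj_0: "\<phi> x 0 = x" and traj_continuous: "continuous_on {0..} (\<phi> x)"
  and traj_deriv: "0 < t \<Longrightarrow> (\<phi> x has_vector_derivative velocity \<theta> t (\<phi> x t)) (at t)"
  using traj by (auto simp: particle_trajectories_def)

lemma traj_lipschitz:
  assumes "0 \<le> s" "s \<le> t" "t \<le> T" shows "norm (\<phi> x t - \<phi> x s) \<le> 3 * M * (t - s)"
proof (cases "s = t")
  case False
  have "norm (\<phi> x t - \<phi> x s) \<le> 3 * M * t - 3 * M * s"
  proof (rule differentiable_bound_general[of s t "\<phi> x" "\<lambda>t. 3 * M * t" "\<lambda>t. velocity \<theta> t (\<phi> x t)" "\<lambda>_. 3 * M"])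
    show "continuous_on {s..t} (\<phi> x)" by (rule continuous_on_subset[OF traj_continuous]) (use assms in auto)
    show "((\<lambda>t. 3 * M * t) has_vector_derivative 3 * M) (at r)" for r
      by (auto intro!: derivative_eq_intros simp: has_real_derivative_iff_has_vector_derivative[symmetric])
  qed (use assms False velocity_bound traj_deriv in \<open>auto intro!: continuous_intros\<close>)
  then show ?thesis by (simp add: algebra_simps)
qed simp

text \<open>
  A particle makes the same error in one step as the weak solution does, for the same reason.
\<close>

lemma traj_step:
  assumes v: "smooth_field v w1 w2 l" and s: "0 \<le> s" "0 \<le> h" "s + h \<le> T"
    and e: "\<And>t x. s \<le> t \<Longrightarrow> t \<le> s + h \<Longrightarrow> norm (velocity \<theta> t x - v x) \<le> e"
  shows "norm (\<phi> x (s + h) - (\<phi> x s + h *\<^sub>R v (\<phi> x s))) \<le> (e + 3 * M * h * l) * h"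
proof (cases "h = 0")
  case False
  let ?f = "\<lambda>t. \<phi> x t - t *\<^sub>R v (\<phi> x s)"
  let ?B = "e + 3 * M * h * l"
  have "norm (?f (s + h) - ?f s) \<le> ?B * (s + h) - ?B * s"
  proof (rule differentiable_bound_general[of s "s + h" ?f "\<lambda>t. ?B * t" "\<lambda>t. velocity \<theta> t (\<phi> x t) - v (\<phi> x s)" "\<lambda>_. ?B"])
    show "continuous_on {s..s + h} ?f" by (intro continuous_intros continuous_on_subset[OF traj_continuous]) (use s in auto)
    show "((\<lambda>t. ?B * t) has_vector_derivative ?B) (at r)" for r
      by (auto intro!: derivative_eq_intros simp: has_real_derivative_iff_has_vector_derivative[symmetric])
    fix t assume t: "s < t" "t < s + h"
    show "(?f has_vector_derivative velocity \<theta> t (\<phi> x t) - v (\<phi> x s)) (at t)"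
    proof -
      have "((\<lambda>t. t *\<^sub>R v (\<phi> x s)) has_vector_derivative 1 *\<^sub>R v (\<phi> x s)) (at t)"
        by (auto intro!: derivative_eq_intros simp: has_vector_derivative_def)
      with traj_deriv[of t x] t s show ?thesis by (auto intro!: has_vector_derivative_diff)
    qed
    have "norm (v (\<phi> x t) - v (\<phi> x s)) \<le> l * norm (\<phi> x t - \<phi> x s)" by (rule smooth_field_lipschitz[OF v])
    also have "\<dots> \<le> l * (3 * M * (t - s))" using t s smooth_field_nonneg[OF v] by (intro mult_left_mono traj_lipschitz) auto
    also have "\<dots> \<le> l * (3 * M * h)" using t M_nonneg smooth_field_nonneg[OF v] by (intro mult_left_mono) auto
    finally have "norm (v (\<phi> x t) - v (\<phi> x s)) \<le> 3 * M * h * l" by (simp add: mult_ac)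
    moreover have "norm (velocity \<theta> t (\<phi> x t) - v (\<phi> x t)) \<le> e" using e t by auto
    ultimately show "norm (velocity \<theta> t (\<phi> x t) - v (\<phi> x s)) \<le> ?B"
      using norm_triangle_ineq[of "velocity \<theta> t (\<phi> x t) - v (\<phi> x t)" "v (\<phi> x t) - v (\<phi> x s)"] by simp
  qed (use s False in \<open>auto intro!: continuous_intros\<close>)
  then show ?thesis by (simp add: algebra_simps)
qed simp

end

lemma C1c_integrable: "C1c G G' \<Longrightarrow> integrable lebesgue G"
proof -
  assume G: "C1c G G'"
  obtain r where r: "0 < r" "\<And>x. r \<le> norm x \<Longrightarrow> G x = 0" using C1c_support[OF G] by metis
  obtain b where b: "\<And>x. \<bar>G x\<bar> \<le> b" using C1c_bounded[OF G] by metis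
  show ?thesis
  proof (rule Bochner_Integration.integrable_bound[of lebesgue "\<lambda>x. indicator (ball (0::real^2) r) x * b"])
    show "integrable lebesgue (\<lambda>x. indicator (ball (0::real^2) r) x * b)"
      using emeasure_lborel_ball_finite[of "0::real^2" r] by (intro integrable_mult_left integrable_real_indicator) auto
    show "G \<in> borel_measurable lebesgue" by (intro borel_lebesgue borel_measurable_continuous_onI C1c_continuous[OF G])
    show "AE x in lebesgue. norm (G x) \<le> norm (indicator (ball (0::real^2) r) x * b)"
      using b r by (intro AE_I2) (auto split: split_indicator simp: not_less intro: order_trans[OF b abs_ge_self])
  qed
qed

text \<open>
  For a trace-free Jacobian, \<open>det (I + h Dv)\<close> differs from 1 by \<open>h\<^sup>2 det Dv\<close>. A step thus changes
  areas to second order only, and the product over \<open>\<tau>/h\<close> steps tends to 1 with \<open>h\<close>.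
\<close>

lemma area_step:
  assumes G: "C1c G G'" "\<And>x. 0 \<le> G x" and v: "smooth_field v w1 w2 l" and b: "\<And>x. norm (v x) \<le> b"
    and h: "0 \<le> h" "h * l < 1"
  shows "(LINT x|lebesgue. G (x + h *\<^sub>R v x)) * (1 - (h * l)\<^sup>2) \<le> (LINT x|lebesgue. G x)"
proof -
  define E where "E x = x + h *\<^sub>R v x" for x
  define E' where "E' x = (\<lambda>k. k + h *\<^sub>R (vector [w1 x \<bullet> k, w2 x \<bullet> k] :: real^2))" for x
  have dE: "(E has_derivative E' x) (at x)" for x
    unfolding E_def[abs_def] E'_def using v
    by (intro has_derivative_add has_derivative_ident has_derivative_scaleR_right) (auto simp: smooth_field_def)
  have vl: "norm (v x - v y) \<le> l * norm (x - y)" for x y by (rule smooth_field_lipschitz[OF v])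
  have contr: "norm (h *\<^sub>R v x - h *\<^sub>R v y) \<le> h * l * norm (x - y)" for x y
    using mult_left_mono[OF vl[of x y] h(1)] h by (simp add: scaleR_diff_right[symmetric] mult_ac)
  have hl: "0 \<le> h * l" using h smooth_field_nonneg[OF v] by simp
  have inj: "inj E"
  proof (rule injI)
    fix x y assume "E x = E y"
    then have "x - y = - (h *\<^sub>R v x - h *\<^sub>R v y)" by (simp add: E_def algebra_simps)
    then have "norm (x - y) \<le> h * l * norm (x - y)" using contr[of x y] by (metis norm_minus_cancel)
    then have "(1 - h * l) * norm (x - y) \<le> 0" by (simp add: algebra_simps)
    then have "norm (x - y) \<le> 0" using h by (simp add: mult_le_0_iff)
    then show "x = y" by simp
  qed
  have surj: "range E = UNIV"
  proof -
    have "\<exists>x. E x = y" for y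
    proof -
      have "\<exists>!x. y - h *\<^sub>R v x = x"
      proof (rule banach_fix_type[OF hl h(2)])
        show "\<forall>x z. dist (y - h *\<^sub>R v x) (y - h *\<^sub>R v z) \<le> h * l * dist x z"
          using contr by (simp add: dist_norm norm_minus_commute)
      qed
      then show ?thesis unfolding E_def by (metis (no_types) diff_add_cancel)
    qed
    then show ?thesis by (metis surj_def)
  qed
  have det: "1 - (h * l)\<^sup>2 \<le> det (matrix (E' x))" for x
  proof -
    let ?a = "w1 x $ 1" and ?b = "w1 x $ 2" and ?c = "w2 x $ 1" and ?d = "w2 x $ 2"
    have tr: "?d = - ?a" and n: "norm (w1 x) + norm (w2 x) \<le> l" using v by (auto simp: smooth_field_def eq_neg_iff_add_eq_0 add.commute)
    have "det (matrix (E' x)) = (1 + h * ?a) * (1 + h * ?d) - h * ?b * (h * ?c)"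
      by (simp add: det_2 matrix_def E'_def axis_def inner_vec_def sum_2)
    also have "\<dots> = 1 - h\<^sup>2 * (?a * ?a + ?b * ?c)" by (simp add: tr algebra_simps power2_eq_square)
    finally have d: "det (matrix (E' x)) = 1 - h\<^sup>2 * (?a * ?a + ?b * ?c)" .
    have "?a * ?a \<le> \<bar>?a\<bar> * \<bar>?d\<bar>" by (simp add: tr)
    also have "\<dots> \<le> norm (w1 x) * norm (w2 x)" by (intro mult_mono component_le_norm_cart) auto
    finally have 1: "?a * ?a \<le> norm (w1 x) * norm (w2 x)" .
    have "?b * ?c \<le> \<bar>?b\<bar> * \<bar>?c\<bar>" by (simp add: abs_mult[symmetric])
    also have "\<dots> \<le> norm (w1 x) * norm (w2 x)" by (intro mult_mono component_le_norm_cart) auto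
    finally have 2: "?b * ?c \<le> norm (w1 x) * norm (w2 x)" .
    have "?a * ?a + ?b * ?c \<le> 2 * (norm (w1 x) * norm (w2 x))" using 1 2 by linarith
    also have "\<dots> \<le> (norm (w1 x) + norm (w2 x))\<^sup>2" by (simp add: power2_sum)
    also have "\<dots> \<le> l\<^sup>2" using n by (intro power_mono) auto
    finally have "h\<^sup>2 * (?a * ?a + ?b * ?c) \<le> h\<^sup>2 * l\<^sup>2" by (intro mult_left_mono) auto
    then show ?thesis unfolding d by (simp add: power_mult_distrib)
  qed
  have hl2: "(h * l)\<^sup>2 \<le> 1" using hl h by (simp add: power_le_one)
  have Gi: "integrable lebesgue G" by (rule C1c_integrable[OF G(1)])
  define F where "F x = G x *\<^sub>R (axis 1 1 :: real^1)" for x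
  have Fi: "F absolutely_integrable_on E ` UNIV"
    using Gi unfolding surj F_def set_integrable_def by (auto intro: integrable_scaleR_left)
  have *: "(\<lambda>x. \<bar>det (matrix (E' x))\<bar> *\<^sub>R F (E x)) absolutely_integrable_on UNIV \<and>
       integral UNIV (\<lambda>x. \<bar>det (matrix (E' x))\<bar> *\<^sub>R F (E x)) = integral (E ` UNIV) F"
    by (subst has_absolute_integral_change_of_variables[where g = E and g' = E']) (use Fi dE inj in \<open>auto intro: has_derivative_at_withinI\<close>)
  have FD: "integrable lebesgue (\<lambda>x. \<bar>det (matrix (E' x))\<bar> *\<^sub>R F (E x))" "integrable lebesgue F"
    using * Fi surj by (auto simp: set_integrable_def)
  have eq: "(LINT x|lebesgue. \<bar>det (matrix (E' x))\<bar> *\<^sub>R F (E x)) = (LINT x|lebesgue. F x)"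
    using * surj integral_unique[OF has_integral_integral_lebesgue[OF FD(1)]] integral_unique[OF has_integral_integral_lebesgue[OF FD(2)]] by simp
  have D: "integrable lebesgue (\<lambda>x. \<bar>det (matrix (E' x))\<bar> * G (E x))"
    using integrable_bounded_linear[OF bounded_linear_vec_nth FD(1), of 1] by (simp add: F_def)
  have eq': "(LINT x|lebesgue. \<bar>det (matrix (E' x))\<bar> * G (E x)) = (LINT x|lebesgue. G x)"
    using arg_cong[OF eq, of "\<lambda>z. z $ 1"] integral_bounded_linear[OF bounded_linear_vec_nth FD(1), of 1] integral_bounded_linear[OF bounded_linear_vec_nth FD(2), of 1]
    by (simp add: F_def[abs_def])
  obtain L where L: "\<And>x. norm (G' x) \<le> L" using C1c_grad_bounded[OF G(1)] by metis
  obtain H where H: "C1c (\<lambda>x. G (x + h *\<^sub>R v x)) H" using C1c_step[OF G(1) L v b h(1)] by metis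
  have Ei: "integrable lebesgue (\<lambda>x. G (E x))" using C1c_integrable[OF H] by (simp add: E_def)
  have "(LINT x|lebesgue. G (E x)) * (1 - (h * l)\<^sup>2) = (LINT x|lebesgue. G (E x) * (1 - (h * l)\<^sup>2))" by simp
  also have "\<dots> \<le> (LINT x|lebesgue. \<bar>det (matrix (E' x))\<bar> * G (E x))"
  proof (rule integral_mono)
    show "G (E x) * (1 - (h * l)\<^sup>2) \<le> \<bar>det (matrix (E' x))\<bar> * G (E x)" for x
      using mult_right_mono[OF order_trans[OF det[of x] abs_ge_self] G(2)[of "E x"]] by (simp add: mult.commute)
  qed (use Ei D in auto)
  finally show ?thesis using eq' by (simp add: E_def)
qed

context yudovich_flow begin

section \<open>Short-time approximation of the transport\<close>

lemma weak_lipschitz: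
  assumes G: "C1c G G'" "\<And>x. norm (G' x) \<le> L" and s: "0 \<le> s" "s \<le> s'" "s' \<le> T"
  shows "\<bar>(LINT x|lebesgue. \<theta> s' x * G x) - (LINT x|lebesgue. \<theta> s x * G x)\<bar> \<le> M * (3 * M * L) * (s' - s)"
proof (rule weak_increment_static[OF G(1) s], rule abs_integral_vort_le)
  fix t x assume t: "s \<le> t" "t \<le> s'"
  show t0: "0 \<le> t" "t \<le> T" using s t by auto
  have "0 \<le> L" using G(2)[of 0] norm_ge_zero order_trans by blast
  then show "\<bar>velocity \<theta> t x \<bullet> G' x\<bar> \<le> 3 * M * L"
    using Cauchy_Schwarz_ineq2[of "velocity \<theta> t x" "G' x"] mult_mono[OF velocity_bound[OF t0, of x] G(2)[of x]] M_nonneg by force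
qed

lemma C1c_reflect:
  assumes k: "C1c k w" shows "C1c (\<lambda>y. k (x - y)) (\<lambda>y. - w (x - y))"
  unfolding C1c_def
proof (intro conjI allI)
  fix y
  have "((\<lambda>y. x - y) has_derivative (\<lambda>h. 0 - h)) (at y)" by (intro has_derivative_diff has_derivative_const has_derivative_ident)
  from has_derivative_compose[OF this C1c_deriv[OF k, of "x - y"]]
  show "((\<lambda>y. k (x - y)) has_derivative (\<bullet>) (- w (x - y))) (at y)"
    by (rule has_derivative_eq_rhs) (auto simp: fun_eq_iff)
  show "continuous_on UNIV (\<lambda>y. - w (x - y))"
    by (intro continuous_intros continuous_on_compose2[OF C1c_continuous_grad[OF k]]) auto
next
  obtain r where r: "\<And>x. r \<le> norm x \<Longrightarrow> k x = 0" using C1c_support[OF k] by metis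
  show "\<exists>r. \<forall>y. r \<le> norm y \<longrightarrow> k (x - y) = 0"
  proof (intro exI[of _ "r + norm x"] allI impI r)
    show "r \<le> norm (x - y)" if "r + norm x \<le> norm y" for y using that norm_triangle_ineq2[of y x] by (simp add: norm_minus_commute)
  qed
qed

lemma reg_kernel_grad_bound_unif: "norm (reg_kernel_grad1 n z) \<le> 4 ^ n" "norm (reg_kernel_grad2 n z) \<le> 4 ^ n"
proof -
  have "1 / max ((norm z)\<^sup>2) ((1/4)^n) \<le> 1 / (1/4)^n"
    by (intro divide_left_mono mult_pos_pos) (auto simp: less_max_iff_disj)
  also have "\<dots> = 4 ^ n" by (simp add: power_one_over)
  finally show "norm (reg_kernel_grad1 n z) \<le> 4 ^ n" "norm (reg_kernel_grad2 n z) \<le> 4 ^ n" using reg_kernel_grad_bound[of n z] by auto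
qed

lemma reg_velocity_time_lipschitz:
  assumes s: "0 \<le> s" "s \<le> s'" "s' \<le> T"
  shows "norm (reg_velocity n (\<theta> s') x - reg_velocity n (\<theta> s) x) \<le> 6 * M\<^sup>2 * 4 ^ n * (s' - s)"
proof -
  have "norm (reg_velocity n (\<theta> s') x - reg_velocity n (\<theta> s) x) \<le>
     \<bar>(LINT y|lebesgue. \<theta> s' y * reg_kernel1 n (x - y)) - (LINT y|lebesgue. \<theta> s y * reg_kernel1 n (x - y))\<bar> +
     \<bar>(LINT y|lebesgue. \<theta> s' y * reg_kernel2 n (x - y)) - (LINT y|lebesgue. \<theta> s y * reg_kernel2 n (x - y))\<bar>"
    using norm_le_l1_cart[of "reg_velocity n (\<theta> s') x - reg_velocity n (\<theta> s) x"] by (simp add: sum_2 reg_velocity_def)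
  also have "\<dots> \<le> M * (3 * M * 4 ^ n) * (s' - s) + M * (3 * M * 4 ^ n) * (s' - s)"
    by (intro add_mono weak_lipschitz[OF C1c_reflect[OF C1c_reg_kernel1] _ s] weak_lipschitz[OF C1c_reflect[OF C1c_reg_kernel2] _ s])
       (simp_all add: reg_kernel_grad_bound_unif)
  also have "\<dots> = 6 * M\<^sup>2 * 4 ^ n * (s' - s)" by (simp add: power2_eq_square)
  finally show ?thesis .
qed

lemma reg_velocity_velocity_error:
  assumes t: "0 \<le> s" "s \<le> t" "t \<le> s + h" "s + h \<le> T"
  shows "norm (velocity \<theta> t x - reg_velocity n (\<theta> s) x) \<le> 3 * M * (1/2)^n + 6 * M\<^sup>2 * 4 ^ n * h"
proof -
  have "norm (velocity \<theta> t x - reg_velocity n (\<theta> t) x) \<le> 3 * M * (1/2)^n"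
    unfolding velocity_eq_biot_savart using t by (intro biot_savart_approx vort) auto
  moreover have "norm (reg_velocity n (\<theta> t) x - reg_velocity n (\<theta> s) x) \<le> 6 * M\<^sup>2 * 4 ^ n * h"
    by (rule order_trans[OF reg_velocity_time_lipschitz]) (use t in \<open>auto intro!: mult_left_mono\<close>)
  ultimately show ?thesis
    using norm_triangle_ineq[of "velocity \<theta> t x - reg_velocity n (\<theta> t) x" "reg_velocity n (\<theta> t) x - reg_velocity n (\<theta> s) x"] by simp
qed

lemma reg_velocity_smooth_field:
  assumes t: "0 \<le> t" "t \<le> T"
  shows "smooth_field (reg_velocity n (\<theta> t)) (reg_velocity_grad1 n (\<theta> t)) (reg_velocity_grad2 n (\<theta> t)) (34 * M * (real n + 1))"
  unfolding smooth_field_def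
proof (intro conjI allI)
  note i = vort_integrable[OF t]
  show "(reg_velocity n (\<theta> t) has_derivative (\<lambda>k. vector [reg_velocity_grad1 n (\<theta> t) x \<bullet> k, reg_velocity_grad2 n (\<theta> t) x \<bullet> k])) (at x)" for x by (rule reg_velocity_has_derivative[OF i])
  show "continuous_on UNIV (reg_velocity_grad1 n (\<theta> t))" "continuous_on UNIV (reg_velocity_grad2 n (\<theta> t))" by (rule reg_velocity_grad_continuous[OF i])+
  show "reg_velocity_grad1 n (\<theta> t) x $ 1 + reg_velocity_grad2 n (\<theta> t) x $ 2 = 0" for x by (rule reg_velocity_grad_trace[OF i])
  show "norm (reg_velocity_grad1 n (\<theta> t) x) + norm (reg_velocity_grad2 n (\<theta> t) x) \<le> 34 * M * (real n + 1)" for x using reg_velocity_grad_bound[OF vort[OF t], of n x] by linarith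
qed

lemma reg_velocity_bounded:
  assumes t: "0 \<le> t" "t \<le> T" shows "norm (reg_velocity n (\<theta> t) x) \<le> 3 * M + 3 * M * (1/2)^n"
  using biot_savart_approx[OF vort[OF t], of x n] biot_savart_bound[OF vort[OF t], of x] norm_triangle_ineq4[of "biot_savart (\<theta> t) x" "biot_savart (\<theta> t) x - reg_velocity n (\<theta> t) x"] by simp

text \<open>
  \<open>H\<close> is \<open>G\<close> composed with \<open>N\<close> Euler steps of the regularised velocity. Each step multiplies the gradient
  bound by \<open>1 + h * l\<close>, and the one-step errors for the solution, for the particles and for the area add up.
  The last step is peeled off in the induction because the composition acts on test functions backwards in time.
\<close>

lemma euler_scheme:
  fixes n :: nat and h l \<eta> :: real
  assumes h: "0 \<le> h" "h * l < 1" and l: "l = 34 * M * (real n + 1)"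
    and \<eta>: "\<eta> = 3 * M * (1/2)^n + 6 * M\<^sup>2 * 4 ^ n * h + 3 * M * h * l"
    and s: "0 \<le> s" "s + real N * h \<le> T"
    and G: "C1c G G'" "\<And>x. norm (G' x) \<le> L" "\<And>x. 0 \<le> G x"
  shows "\<exists>H H'. C1c H H' \<and> (\<forall>x. 0 \<le> H x) \<and>
     \<bar>(LINT x|lebesgue. \<theta> (s + real N * h) x * G x) - (LINT x|lebesgue. \<theta> s x * H x)\<bar> \<le> M * (L * (1 + h * l)^N * \<eta> * (real N * h)) \<and>
     (\<forall>x. \<bar>G (\<phi> x (s + real N * h)) - H (\<phi> x s)\<bar> \<le> L * (1 + h * l)^N * \<eta> * (real N * h)) \<and>
     (LINT x|lebesgue. H x) * (1 - (h * l)\<^sup>2)^N \<le> (LINT x|lebesgue. G x)"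
  using s(2) G
proof (induction N arbitrary: G G' L)
  case 0 then show ?case by (intro exI[of _ G] exI[of _ G']) auto
next
  case (Suc N)
  let ?t = "s + real N * h"
  have t: "0 \<le> ?t" "?t \<le> T" "?t + h \<le> T" using Suc.prems(1) s h by (auto simp: algebra_simps)
  have st: "s + real (Suc N) * h = ?t + h" by (simp add: algebra_simps)
  let ?v = "reg_velocity n (\<theta> ?t)"
  note v = reg_velocity_smooth_field[OF t(1,2), of n, folded l]
  note b = reg_velocity_bounded[OF t(1,2), of n]
  have L: "0 \<le> L" using Suc.prems(3)[of 0] norm_ge_zero order_trans by blast
  have l0: "0 \<le> l" using smooth_field_nonneg[OF v] .
  have lam: "1 \<le> 1 + h * l" using h l0 by simp
  have \<eta>0: "0 \<le> \<eta>" unfolding \<eta> using h l0 M_nonneg by auto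
  have e: "norm (velocity \<theta> r x - ?v x) \<le> 3 * M * (1/2)^n + 6 * M\<^sup>2 * 4 ^ n * h" if "?t \<le> r" "r \<le> ?t + h" for r x
    by (rule reg_velocity_velocity_error) (use t that in auto)
  obtain H where H: "C1c (\<lambda>x. G (x + h *\<^sub>R ?v x)) H" "\<And>x. norm (H x) \<le> L * (1 + h * l)"
    using C1c_step[OF Suc.prems(2,3) v b h(1)] by metis
  obtain H0 H0' where IH: "C1c H0 H0'" "\<And>x. 0 \<le> H0 x"
    "\<bar>(LINT x|lebesgue. \<theta> ?t x * G (x + h *\<^sub>R ?v x)) - (LINT x|lebesgue. \<theta> s x * H0 x)\<bar> \<le> M * ((L * (1 + h * l)) * (1 + h * l)^N * \<eta> * (real N * h))"
    "\<And>x. \<bar>G (\<phi> x ?t + h *\<^sub>R ?v (\<phi> x ?t)) - H0 (\<phi> x s)\<bar> \<le> (L * (1 + h * l)) * (1 + h * l)^N * \<eta> * (real N * h)"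
    "(LINT x|lebesgue. H0 x) * (1 - (h * l)\<^sup>2)^N \<le> (LINT x|lebesgue. G (x + h *\<^sub>R ?v x))"
    using Suc.IH[OF t(2) H Suc.prems(4)] by blast
  have one: "\<bar>(LINT x|lebesgue. \<theta> (?t + h) x * G x) - (LINT x|lebesgue. \<theta> ?t x * G (x + h *\<^sub>R ?v x))\<bar> \<le> M * (L * \<eta>) * h"
    using vort_step[OF Suc.prems(2,3) v b t(1) h(1) t(3) e] by (simp add: \<eta>)
  have two: "\<bar>G (\<phi> x (?t + h)) - G (\<phi> x ?t + h *\<^sub>R ?v (\<phi> x ?t))\<bar> \<le> L * \<eta> * h" for x
  proof -
    have "\<bar>G (\<phi> x (?t + h)) - G (\<phi> x ?t + h *\<^sub>R ?v (\<phi> x ?t))\<bar> \<le> L * norm (\<phi> x (?t + h) - (\<phi> x ?t + h *\<^sub>R ?v (\<phi> x ?t)))"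
      by (rule C1c_lipschitz[OF Suc.prems(2,3)])
    also have "\<dots> \<le> L * (\<eta> * h)" 
      using traj_step[OF v t(1) h(1) t(3) e, of x] L by (intro mult_left_mono) (auto simp: \<eta>)
    finally show ?thesis by (simp add: mult_ac)
  qed
  have three: "(LINT x|lebesgue. G (x + h *\<^sub>R ?v x)) * (1 - (h * l)\<^sup>2) \<le> (LINT x|lebesgue. G x)"
    by (rule area_step[OF Suc.prems(2,4) v b h])
  have pow: "L * \<eta> * h \<le> L * (1 + h * l)^Suc N * \<eta> * h"
  proof -
    have "1 \<le> (1 + h * l)^Suc N" using lam by (rule one_le_power)
    then have "L * \<eta> * h * 1 \<le> L * \<eta> * h * (1 + h * l)^Suc N" using L \<eta>0 h by (intro mult_left_mono) auto
    then show ?thesis by (simp add: mult_ac)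
  qed
  have sum: "L * (1 + h * l)^Suc N * \<eta> * h + (L * (1 + h * l)) * (1 + h * l)^N * \<eta> * (real N * h) = L * (1 + h * l)^Suc N * \<eta> * (real (Suc N) * h)"
    by (simp add: algebra_simps)
  show ?case
  proof (intro exI conjI allI)
    show "C1c H0 H0'" "0 \<le> H0 x" for x by (rule IH)+
    have "\<bar>(LINT x|lebesgue. \<theta> (?t + h) x * G x) - (LINT x|lebesgue. \<theta> s x * H0 x)\<bar>
       \<le> M * (L * \<eta> * h) + M * ((L * (1 + h * l)) * (1 + h * l)^N * \<eta> * (real N * h))"
      using one IH(3) by (simp add: mult.assoc)
    also have "\<dots> \<le> M * (L * (1 + h * l)^Suc N * \<eta> * h) + M * ((L * (1 + h * l)) * (1 + h * l)^N * \<eta> * (real N * h))"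
      using mult_left_mono[OF pow M_nonneg] by linarith
    finally show "\<bar>(LINT x|lebesgue. \<theta> (s + real (Suc N) * h) x * G x) - (LINT x|lebesgue. \<theta> s x * H0 x)\<bar> \<le> M * (L * (1 + h * l)^Suc N * \<eta> * (real (Suc N) * h))"
      unfolding st sum[symmetric] distrib_left .
    show "\<bar>G (\<phi> x (s + real (Suc N) * h)) - H0 (\<phi> x s)\<bar> \<le> L * (1 + h * l)^Suc N * \<eta> * (real (Suc N) * h)" for x
      unfolding st sum[symmetric] using two[of x] IH(4)[of x] pow by linarith
    have "(h * l)\<^sup>2 \<le> 1" using h l0 by (simp add: power_le_one)
    then have "(LINT x|lebesgue. H0 x) * (1 - (h * l)\<^sup>2)^N * (1 - (h * l)\<^sup>2) \<le> (LINT x|lebesgue. G (x + h *\<^sub>R ?v x)) * (1 - (h * l)\<^sup>2)"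
      using IH(5) by (intro mult_right_mono) auto
    then show "(LINT x|lebesgue. H0 x) * (1 - (h * l)\<^sup>2)^Suc N \<le> (LINT x|lebesgue. G x)" using three by (simp add: mult_ac)
  qed
qed

text \<open>
  The inequality that decides the length of the short time interval below.
\<close>

lemma exp_half_less_2: "exp (1/2::real) < 2"
proof -
  have "(exp (1/2::real))\<^sup>2 = exp 1" by (simp add: exp_double[symmetric])
  also have "\<dots> < 2\<^sup>2" using exp_le by simp
  finally show ?thesis by (rule power_less_imp_less_base) simp
qed

text \<open>
  The Lipschitz constant at level \<open>n\<close> is \<open>34 * M * (n + 1)\<close>, so on a time interval of length at most
  \<open>1 / (68 * M)\<close> the gradients grow at most by \<open>exp ((n + 1) / 2)\<close>, while the velocity error is of
  order \<open>2^(-n)\<close>. As \<open>sqrt e < 2\<close>, the product tends to 0. So \<open>n\<close> is chosen first, and then the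
  number \<open>N\<close> of steps, which makes all terms carrying \<open>h\<close> small.
\<close>

lemma short_time_approximation:
  assumes s: "0 \<le> s" "s \<le> s'" "s' \<le> T" "s' - s \<le> 1 / (68 * M)" and \<epsilon>: "0 < \<epsilon>"
    and G: "C1c G G'" "\<And>x. 0 \<le> G x"
  obtains H H' where "C1c H H'" "\<And>x. 0 \<le> H x"
    "\<bar>(LINT x|lebesgue. \<theta> s' x * G x) - (LINT x|lebesgue. \<theta> s x * H x)\<bar> \<le> \<epsilon>"
    "\<And>x. \<bar>G (\<phi> x s') - H (\<phi> x s)\<bar> \<le> \<epsilon>"
    "(LINT x|lebesgue. H x) * (1 - \<epsilon>) \<le> (LINT x|lebesgue. G x)"
proof -
  define \<Delta> where "\<Delta> = s' - s"
  have \<Delta>: "0 \<le> \<Delta>" "\<Delta> \<le> 1 / (68 * M)" "s' = s + \<Delta>" using s by (auto simp: \<Delta>_def)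
  have M: "0 < M" using M_ge_1 by simp
  have \<Delta>1: "\<Delta> \<le> 1" using \<Delta>(2) M_ge_1 by (rule_tac order_trans[of _ "1 / (68 * M)"]) (auto simp: divide_le_eq)
  obtain L where L: "0 < L" "\<And>x. norm (G' x) \<le> L" using C1c_grad_bounded[OF G(1)] by metis
  define l where "l n = 34 * M * (real n + 1)" for n :: nat
  have l0: "0 \<le> l n" for n using M by (simp add: l_def)
  have \<Delta>l: "\<Delta> * l n \<le> (real n + 1) / 2" for n
  proof -
    have "\<Delta> * M \<le> 1 / 68" using \<Delta>(2) M by (simp add: field_simps)
    then have "34 * (\<Delta> * M) * (real n + 1) \<le> 34 * (1 / 68) * (real n + 1)" by (intro mult_right_mono mult_left_mono) auto
    then show ?thesis by (simp add: l_def mult_ac)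
  qed
  have ex: "exp (\<Delta> * l n) * (1/2)^n \<le> exp (1/2) * (exp (1/2) / 2)^n" for n
  proof -
    have "exp (\<Delta> * l n) \<le> exp ((real n + 1) / 2)" using \<Delta>l by simp
    also have "(real n + 1) / 2 = 1/2 + real n * (1/2)" by simp
    also have "exp (1/2 + real n * (1/2)) = exp (1/2::real) * exp (1/2)^n" by (simp only: exp_add exp_of_nat_mult)
    finally have "exp (\<Delta> * l n) * (1/2)^n \<le> exp (1/2) * exp (1/2)^n * (1/2)^n" by (intro mult_right_mono) auto
    then show ?thesis by (simp add: power_divide)
  qed
  \<comment> \<open>Half of the admissible error is spent on the choice of \<open>n\<close>, half on that of \<open>N\<close>.\<close>
  define e where "e = min \<epsilon> 1 / (2 * M * L)"
  have e: "0 < e" using \<epsilon> M L by (simp add: e_def)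
  have "(\<lambda>n. 3 * M * (exp (1/2) * (exp (1/2) / 2)^n)) \<longlonglongrightarrow> 3 * M * (exp (1/2) * 0)"
    using exp_half_less_2 by (intro tendsto_mult tendsto_const LIMSEQ_realpow_zero) auto
  then have "\<forall>\<^sub>F n in sequentially. 3 * M * (exp (1/2) * (exp (1/2) / 2)^n) < e" using e by (intro order_tendstoD) auto
  then obtain n where n: "3 * M * (exp (1/2) * (exp (1/2) / 2)^n) < e" using eventually_happens'[OF sequentially_bot] by blast
  \<comment> \<open>\<open>K * h\<close> collects all error terms that carry a factor \<open>h\<close>.\<close>
  define K where "K = exp (\<Delta> * l n) * (6 * M\<^sup>2 * 4 ^ n + 3 * M * l n)"
  have K: "0 \<le> K" unfolding K_def using M l0 by auto
  obtain N where N: "max (K / e) (max (\<Delta> * l n) ((\<Delta> * l n)\<^sup>2 / \<epsilon>)) < real N" using reals_Archimedean2 by blast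
  have "0 \<le> K / e" using K e by simp
  then have N0: "0 < real N" using N by linarith
  define h where "h = \<Delta> / real N"
  have h: "0 \<le> h" "real N * h = \<Delta>" using \<Delta> N0 by (auto simp: h_def)
  have hl: "h * l n < 1" using N N0 by (simp add: h_def divide_less_eq)
  define \<eta> where "\<eta> = 3 * M * (1/2)^n + 6 * M\<^sup>2 * 4 ^ n * h + 3 * M * h * l n"
  have lam: "(1 + h * l n)^N \<le> exp (\<Delta> * l n)"
  proof -
    have "(1 + h * l n)^N \<le> exp (h * l n)^N" using h l0[of n] by (intro power_mono exp_ge_add_one_self add_nonneg_nonneg) auto
    also have "\<dots> = exp (\<Delta> * l n)" unfolding exp_of_nat_mult[symmetric] mult.assoc[symmetric] h(2) ..
    finally show ?thesis .
  qed
  have hN: "h \<le> 1 / real N" using \<Delta>1 N0 by (simp add: h_def divide_right_mono)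
  have \<eta>0: "0 \<le> \<eta>" unfolding \<eta>_def using h M l0 by auto
  have "exp (\<Delta> * l n) * \<eta> = 3 * M * (exp (\<Delta> * l n) * (1/2)^n) + K * h" by (simp add: \<eta>_def K_def algebra_simps)
  also have "3 * M * (exp (\<Delta> * l n) * (1/2)^n) \<le> 3 * M * (exp (1/2) * (exp (1/2) / 2)^n)" using M ex by (intro mult_left_mono) auto
  also have "K * h \<le> K * (1 / real N)" using K hN by (intro mult_left_mono) auto
  also have "K * (1 / real N) < e" using N N0 e by (simp add: field_simps)
  finally have E: "exp (\<Delta> * l n) * \<eta> \<le> 2 * e" using n by linarith
  have "(1 + h * l n)^N * \<eta> * \<Delta> \<le> exp (\<Delta> * l n) * \<eta> * 1" using lam \<eta>0 \<Delta> \<Delta>1 by (intro mult_mono) auto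
  then have tot: "L * (1 + h * l n)^N * \<eta> * (real N * h) \<le> L * (2 * e)" unfolding h(2) using E L by (simp add: mult.assoc mult_left_mono)
  have Le: "L * (2 * e) = min \<epsilon> 1 / M" using L M by (simp add: e_def)
  have Le1: "M * (L * (2 * e)) \<le> \<epsilon>" unfolding Le using M by simp
  have Le2: "L * (2 * e) \<le> \<epsilon>" 
  proof -
    have "min \<epsilon> 1 / M \<le> min \<epsilon> 1 / 1" using M_ge_1 \<epsilon> by (intro divide_left_mono) auto
    then show ?thesis unfolding Le by simp
  qed
  have sN: "s + real N * h = s'" using h \<Delta> by simp
  obtain H H' where H: "C1c H H'" "\<And>x. 0 \<le> H x"
     "\<bar>(LINT x|lebesgue. \<theta> (s + real N * h) x * G x) - (LINT x|lebesgue. \<theta> s x * H x)\<bar> \<le> M * (L * (1 + h * l n)^N * \<eta> * (real N * h))"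
     "\<And>x. \<bar>G (\<phi> x (s + real N * h)) - H (\<phi> x s)\<bar> \<le> L * (1 + h * l n)^N * \<eta> * (real N * h)"
     "(LINT x|lebesgue. H x) * (1 - (h * l n)\<^sup>2)^N \<le> (LINT x|lebesgue. G x)"
    using euler_scheme[OF h(1) hl l_def \<eta>_def s(1) eq_refl[OF sN, THEN order_trans, OF s(3)] G(1) L(2) G(2)] by blast
  have "1 - \<epsilon> \<le> (1 - (h * l n)\<^sup>2)^N"
  proof -
    have "(h * l n)\<^sup>2 \<le> 1" using hl h l0[of n] by (simp add: power_le_one)
    then have "1 + real N * (- (h * l n)\<^sup>2) \<le> (1 + - (h * l n)\<^sup>2)^N" by (intro Bernoulli_inequality) simp
    moreover have "real N * (h * l n)\<^sup>2 = (\<Delta> * l n)\<^sup>2 / real N" using N0 by (simp add: h_def power2_eq_square)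
    moreover have "(\<Delta> * l n)\<^sup>2 / real N \<le> \<epsilon>" using N N0 \<epsilon> by (simp add: field_simps)
    ultimately show ?thesis by simp
  qed
  then have "(LINT x|lebesgue. H x) * (1 - \<epsilon>) \<le> (LINT x|lebesgue. H x) * (1 - (h * l n)\<^sup>2)^N"
    using H(2) by (intro mult_left_mono) auto
  then have 3: "(LINT x|lebesgue. H x) * (1 - \<epsilon>) \<le> (LINT x|lebesgue. G x)" using H(5) by linarith
  have 1: "\<bar>(LINT x|lebesgue. \<theta> s' x * G x) - (LINT x|lebesgue. \<theta> s x * H x)\<bar> \<le> \<epsilon>"
    using H(3) mult_left_mono[OF tot M_nonneg] Le1 unfolding sN by linarith
  have 2: "\<bar>G (\<phi> x s') - H (\<phi> x s)\<bar> \<le> \<epsilon>" for x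
    using H(4)[of x] tot Le2 unfolding sN by linarith
  show ?thesis by (rule that[OF H(1,2) 1 2 3])
qed


section \<open>Transport of the vorticity by the particle flow\<close>

text \<open>
  Three facts that pass from time to time together: \<open>\<theta> s\<close> is the density of the image of the
  initial patch under the flow map, the flow map does not increase integrals, hence areas, and it is
  continuous, expressed through test functions.
\<close>

definition transported :: "real \<Rightarrow> bool" where
  "transported s \<longleftrightarrow> (\<forall>G G'. C1c G G' \<longrightarrow> (\<forall>x. 0 \<le> G x) \<longrightarrow>
     (LINT x|lebesgue. \<theta> s x * G x) = (LINT x|lebesgue. indicator \<Omega> x * G (\<phi> x s)) \<and>
     (\<integral>\<^sup>+x. ennreal (G (\<phi> x s)) \<partial>lebesgue) \<le> ennreal (LINT x|lebesgue. G x) \<and>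
     continuous_on UNIV (\<lambda>x. G (\<phi> x s)))"

lemma \<Omega>_sets[measurable]: "\<Omega> \<in> sets lebesgue"
  using open_\<Omega> by simp

lemma \<Omega>_lmeasurable: "\<Omega> \<in> lmeasurable"
  by (rule bounded_set_imp_lmeasurable[OF bounded_\<Omega> \<Omega>_sets])

lemma \<Omega>_finite: "emeasure lebesgue \<Omega> < \<infinity>"
  using \<Omega>_lmeasurable by (simp only: fmeasurable_def mem_Collect_eq)

lemma integrable_on_\<Omega>:
  fixes F :: "real^2 \<Rightarrow> real"
  assumes "F \<in> borel_measurable lebesgue" "\<And>x. \<bar>F x\<bar> \<le> b"
  shows "integrable lebesgue (\<lambda>x. indicator \<Omega> x * F x)"
proof (rule Bochner_Integration.integrable_bound[of lebesgue "\<lambda>x. indicator \<Omega> x * b"])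
  show "integrable lebesgue (\<lambda>x. indicator \<Omega> x * b)"
    using \<Omega>_finite by (intro integrable_mult_left integrable_real_indicator) auto
  show "(\<lambda>x. indicator \<Omega> x * F x) \<in> borel_measurable lebesgue" using assms(1) by measurable
  show "AE x in lebesgue. norm (indicator \<Omega> x * F x) \<le> norm (indicator \<Omega> x * b)"
    using assms(2) by (intro AE_I2) (auto split: split_indicator intro: order_trans[OF assms(2) abs_ge_self])
qed

lemma transported_0: "transported 0"
  unfolding transported_def
proof (intro allI impI conjI)
  fix G G' assume G: "C1c G G'" and pos: "\<forall>x. 0 \<le> G x"
  have [measurable]: "G \<in> borel_measurable lebesgue" by (intro borel_lebesgue borel_measurable_continuous_onI C1c_continuous[OF G])
  have [measurable]: "\<theta> 0 \<in> borel_measurable lebesgue" using vort_integrable[of 0] T_pos by auto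
  have ae: "AE x in lebesgue. \<theta> 0 x = indicator \<Omega> x" using weak by (auto simp: euler_weak_solution_def)
  show "(LINT x|lebesgue. \<theta> 0 x * G x) = (LINT x|lebesgue. indicator \<Omega> x * G (\<phi> x 0))"
    unfolding traj_0
  proof (rule integral_cong_AE)
    show "AE x in lebesgue. \<theta> 0 x * G x = indicator \<Omega> x * G x" using ae by eventually_elim simp
  qed measurable
  show "(\<integral>\<^sup>+x. ennreal (G (\<phi> x 0)) \<partial>lebesgue) \<le> ennreal (LINT x|lebesgue. G x)"
    unfolding traj_0 using nn_integral_eq_integral[OF C1c_integrable[OF G]] pos by simp
  show "continuous_on UNIV (\<lambda>x. G (\<phi> x 0))" unfolding traj_0 using C1c_continuous[OF G] by simp
qed

text \<open>
  Each of the three facts is a limit of the corresponding fact for the approximations \<open>H k\<close> at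
  time \<open>s\<close>: the first by uniform convergence on the bounded set \<open>\<Omega>\<close>, the second by Fatou's lemma, the third
  because uniform limits of continuous functions are continuous.
\<close>

lemma transported_step:
  assumes tr: "transported s" and s: "0 \<le> s" "s \<le> s'" "s' \<le> T" "s' - s \<le> 1 / (68 * M)"
  shows "transported s'"
  unfolding transported_def
proof (intro allI impI)
  fix G G' assume G: "C1c G G'" and pos: "\<forall>x. 0 \<le> G x"
  define \<epsilon> where "\<epsilon> k = 1 / (real k + 2)" for k :: nat
  have \<epsilon>: "0 < \<epsilon> k" "\<epsilon> k \<le> 1" for k by (auto simp: \<epsilon>_def)
  have \<epsilon>0: "\<epsilon> \<longlonglongrightarrow> 0" unfolding \<epsilon>_def
    using LIMSEQ_ignore_initial_segment[OF lim_1_over_n[where 'a=real], of 2] by (simp add: add.commute)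
  have "\<exists>H. \<forall>k. (\<exists>H'. C1c (H k) H') \<and> (\<forall>x. 0 \<le> H k x) \<and>
     \<bar>(LINT x|lebesgue. \<theta> s' x * G x) - (LINT x|lebesgue. \<theta> s x * H k x)\<bar> \<le> \<epsilon> k \<and>
     (\<forall>x. \<bar>G (\<phi> x s') - H k (\<phi> x s)\<bar> \<le> \<epsilon> k) \<and>
     (LINT x|lebesgue. H k x) * (1 - \<epsilon> k) \<le> (LINT x|lebesgue. G x)"
  proof (rule choice, rule allI)
    fix k
    obtain H H' where "C1c H H'" "\<And>x. 0 \<le> H x"
    "\<bar>(LINT x|lebesgue. \<theta> s' x * G x) - (LINT x|lebesgue. \<theta> s x * H x)\<bar> \<le> \<epsilon> k"
    "\<And>x. \<bar>G (\<phi> x s') - H (\<phi> x s)\<bar> \<le> \<epsilon> k"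
    "(LINT x|lebesgue. H x) * (1 - \<epsilon> k) \<le> (LINT x|lebesgue. G x)"
      using short_time_approximation[OF s \<epsilon>(1) G, of k] pos by blast
    then show "\<exists>H. (\<exists>H'. C1c H H') \<and> (\<forall>x. 0 \<le> H x) \<and>
     \<bar>(LINT x|lebesgue. \<theta> s' x * G x) - (LINT x|lebesgue. \<theta> s x * H x)\<bar> \<le> \<epsilon> k \<and>
     (\<forall>x. \<bar>G (\<phi> x s') - H (\<phi> x s)\<bar> \<le> \<epsilon> k) \<and>
     (LINT x|lebesgue. H x) * (1 - \<epsilon> k) \<le> (LINT x|lebesgue. G x)" by blast
  qed
  then obtain H where H: "\<And>k. \<exists>H'. C1c (H k) H'" "\<And>k x. 0 \<le> H k x"
     "\<And>k. \<bar>(LINT x|lebesgue. \<theta> s' x * G x) - (LINT x|lebesgue. \<theta> s x * H k x)\<bar> \<le> \<epsilon> k"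
     "\<And>k x. \<bar>G (\<phi> x s') - H k (\<phi> x s)\<bar> \<le> \<epsilon> k"
     "\<And>k. (LINT x|lebesgue. H k x) * (1 - \<epsilon> k) \<le> (LINT x|lebesgue. G x)" by blast
  have T: "(LINT x|lebesgue. \<theta> s x * H k x) = (LINT x|lebesgue. indicator \<Omega> x * H k (\<phi> x s))"
     "(\<integral>\<^sup>+x. ennreal (H k (\<phi> x s)) \<partial>lebesgue) \<le> ennreal (LINT x|lebesgue. H k x)"
     "continuous_on UNIV (\<lambda>x. H k (\<phi> x s))" for k
    using tr H(1)[of k] H(2)[of k] unfolding transported_def by blast+
  have Hm[measurable]: "(\<lambda>x. H k (\<phi> x s)) \<in> borel_measurable lebesgue" for k
    by (intro borel_lebesgue borel_measurable_continuous_onI T)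
  have lim: "(\<lambda>k. H k (\<phi> x s)) \<longlonglongrightarrow> G (\<phi> x s')" for x
  proof (rule LIM_zero_cancel, rule Lim_null_comparison[OF _ \<epsilon>0])
    show "\<forall>\<^sub>F k in sequentially. norm (H k (\<phi> x s) - G (\<phi> x s')) \<le> \<epsilon> k"
      using H(4)[of x] by (intro always_eventually) (simp add: abs_minus_commute)
  qed
  have cont: "continuous_on UNIV (\<lambda>x. G (\<phi> x s'))"
  proof (rule uniform_limit_theorem)
    show "\<forall>\<^sub>F k in sequentially. continuous_on UNIV (\<lambda>x. H k (\<phi> x s))" using T(3) by simp
    show "uniform_limit UNIV (\<lambda>k x. H k (\<phi> x s)) (\<lambda>x. G (\<phi> x s')) sequentially"
    proof (rule uniform_limitI)
      fix e :: real assume "0 < e"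
      then have "\<forall>\<^sub>F k in sequentially. \<epsilon> k < e" using \<epsilon>0 by (intro order_tendstoD) auto
      then show "\<forall>\<^sub>F k in sequentially. \<forall>x\<in>UNIV. dist (H k (\<phi> x s)) (G (\<phi> x s')) < e"
      proof eventually_elim
        case (elim k) then show ?case using H(4)[of _ k] by (auto simp: dist_real_def abs_minus_commute intro: le_less_trans)
      qed
    qed
  qed auto
  have Gm[measurable]: "(\<lambda>x. G (\<phi> x s')) \<in> borel_measurable lebesgue"
    by (intro borel_lebesgue borel_measurable_continuous_onI cont)
  have nn: "(\<integral>\<^sup>+x. ennreal (G (\<phi> x s')) \<partial>lebesgue) \<le> ennreal (LINT x|lebesgue. G x)"
  proof -
    \<comment> \<open>The factor \<open>1 - \<epsilon> k\<close> absorbs the area distortion, so each integral is bounded by that of \<open>G\<close> itself.\<close>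
    let ?u = "\<lambda>k x. ennreal ((1 - \<epsilon> k) * H k (\<phi> x s))"
    have "(\<lambda>k. ?u k x) \<longlonglongrightarrow> ennreal ((1 - 0) * G (\<phi> x s'))" for x
      by (intro tendsto_ennrealI tendsto_mult tendsto_diff tendsto_const \<epsilon>0 lim)
    from lim_imp_Liminf[OF sequentially_bot this]
    have "(\<integral>\<^sup>+x. ennreal (G (\<phi> x s')) \<partial>lebesgue) = (\<integral>\<^sup>+x. liminf (\<lambda>k. ?u k x) \<partial>lebesgue)"
      by (intro nn_integral_cong) simp
    also have "\<dots> \<le> liminf (\<lambda>k. \<integral>\<^sup>+x. ?u k x \<partial>lebesgue)"
      by (rule nn_integral_liminf) measurable
    also have "\<dots> \<le> liminf (\<lambda>k::nat. ennreal (LINT x|lebesgue. G x))"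
    proof (intro Liminf_mono always_eventually allI)
      fix k
      have "(\<integral>\<^sup>+x. ?u k x \<partial>lebesgue) = ennreal (1 - \<epsilon> k) * (\<integral>\<^sup>+x. ennreal (H k (\<phi> x s)) \<partial>lebesgue)"
        using \<epsilon>[of k] H(2) by (simp add: ennreal_mult nn_integral_cmult)
      also have "\<dots> \<le> ennreal (1 - \<epsilon> k) * ennreal (LINT x|lebesgue. H k x)" by (intro mult_left_mono T) auto
      also have "\<dots> = ennreal ((LINT x|lebesgue. H k x) * (1 - \<epsilon> k))"
        using \<epsilon>[of k] H(2) by (simp add: ennreal_mult[symmetric] mult.commute Bochner_Integration.integral_nonneg)
      also have "\<dots> \<le> ennreal (LINT x|lebesgue. G x)" by (intro ennreal_leI H)
      finally show "(\<integral>\<^sup>+x. ?u k x \<partial>lebesgue) \<le> ennreal (LINT x|lebesgue. G x)" .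
    qed
    also have "\<dots> = ennreal (LINT x|lebesgue. G x)" by (rule Liminf_const) simp
    finally show ?thesis .
  qed
  obtain b where b: "\<And>x. \<bar>G x\<bar> \<le> b" using C1c_bounded[OF G] by metis
  have Gi: "integrable lebesgue (\<lambda>x. indicator \<Omega> x * G (\<phi> x s'))" by (rule integrable_on_\<Omega>[OF Gm b])
  have Hi: "integrable lebesgue (\<lambda>x. indicator \<Omega> x * H k (\<phi> x s))" for k
  proof -
    obtain H' where "C1c (H k) H'" using H(1) by blast
    then obtain b where "\<And>x. \<bar>H k x\<bar> \<le> b" using C1c_bounded by metis
    then show ?thesis by (intro integrable_on_\<Omega>[OF Hm])
  qed
  have l1: "(\<lambda>k. LINT x|lebesgue. \<theta> s x * H k x) \<longlonglongrightarrow> (LINT x|lebesgue. \<theta> s' x * G x)"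
  proof (rule LIM_zero_cancel, rule Lim_null_comparison[OF _ \<epsilon>0])
    show "\<forall>\<^sub>F k in sequentially. norm ((LINT x|lebesgue. \<theta> s x * H k x) - (LINT x|lebesgue. \<theta> s' x * G x)) \<le> \<epsilon> k"
      using H(3) by (intro always_eventually) (simp add: abs_minus_commute)
  qed
  have \<epsilon>\<Omega>: "(\<lambda>k. \<epsilon> k * measure lebesgue \<Omega>) \<longlonglongrightarrow> 0" by (rule tendsto_mult_left_zero[OF \<epsilon>0])
  have l2: "(\<lambda>k. LINT x|lebesgue. indicator \<Omega> x * H k (\<phi> x s)) \<longlonglongrightarrow> (LINT x|lebesgue. indicator \<Omega> x * G (\<phi> x s'))"
  proof (rule LIM_zero_cancel, rule Lim_null_comparison[OF _ \<epsilon>\<Omega>], rule always_eventually, rule allI)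
    fix k
    have "norm ((LINT x|lebesgue. indicator \<Omega> x * H k (\<phi> x s)) - (LINT x|lebesgue. indicator \<Omega> x * G (\<phi> x s')))
      = norm (LINT x|lebesgue. indicator \<Omega> x * H k (\<phi> x s) - indicator \<Omega> x * G (\<phi> x s'))"
      using Gi Hi by simp
    also have "\<dots> \<le> (LINT x|lebesgue. indicator \<Omega> x * \<epsilon> k)"
    proof (rule Bochner_Integration.integral_norm_bound_integral)
      show "integrable lebesgue (\<lambda>x. indicator \<Omega> x * H k (\<phi> x s) - indicator \<Omega> x * G (\<phi> x s'))" using Gi Hi by simp
      show "integrable lebesgue (\<lambda>x. indicator \<Omega> x * \<epsilon> k)" by (rule integrable_on_\<Omega>[where b="\<bar>\<epsilon> k\<bar>"]) auto
      show "norm (indicator \<Omega> x * H k (\<phi> x s) - indicator \<Omega> x * G (\<phi> x s')) \<le> indicator \<Omega> x * \<epsilon> k" for x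
        using H(4)[of x k] by (auto split: split_indicator simp: abs_minus_commute)
    qed
    also have "\<dots> = \<epsilon> k * measure lebesgue \<Omega>" by (simp add: mult.commute)
    finally show "norm ((LINT x|lebesgue. indicator \<Omega> x * H k (\<phi> x s)) - (LINT x|lebesgue. indicator \<Omega> x * G (\<phi> x s'))) \<le> \<epsilon> k * measure lebesgue \<Omega>" .
  qed
  have "(LINT x|lebesgue. \<theta> s' x * G x) = (LINT x|lebesgue. indicator \<Omega> x * G (\<phi> x s'))"
    using LIMSEQ_unique[OF l1] l2 unfolding T(1) by blast
  with nn cont show "(LINT x|lebesgue. \<theta> s' x * G x) = (LINT x|lebesgue. indicator \<Omega> x * G (\<phi> x s')) \<and>
     (\<integral>\<^sup>+x. ennreal (G (\<phi> x s')) \<partial>lebesgue) \<le> ennreal (LINT x|lebesgue. G x) \<and>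
     continuous_on UNIV (\<lambda>x. G (\<phi> x s'))" by blast
qed

lemma transported:
  assumes "0 \<le> s" "s \<le> T" shows "transported s"
proof -
  have M: "0 < M" using M_ge_1 by simp
  have *: "transported s" if "0 \<le> s" "s \<le> T" "s \<le> real k * (1 / (68 * M))" for k s
    using that
  proof (induction k arbitrary: s)
    case 0 then show ?case using transported_0 by simp
  next
    case (Suc k)
    show ?case
    proof (cases "s \<le> real k * (1 / (68 * M))")
      case True then show ?thesis using Suc by blast
    next
      case False
      let ?s = "real k * (1 / (68 * M))"
      have s0: "0 \<le> ?s" using M by simp
      show ?thesis
        by (rule transported_step[OF Suc.IH[of ?s]]) (use False Suc.prems s0 in \<open>auto simp: distrib_right add_divide_distrib\<close>)
    qed
  qed
  obtain k where "s / (1 / (68 * M)) < real k" using reals_Archimedean2 by blast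
  then have "s \<le> real k * (1 / (68 * M))" using M by (simp add: field_simps)
  then show ?thesis using * assms by blast
qed

end

section \<open>Testing against compact sets\<close>

text \<open>
  A sum of bumps over a finite cover of \<open>C\<close> is bounded below on \<open>C\<close>; composing with a step function
  makes it constant there.
\<close>

lemma C1c_urysohn:
  fixes C :: "(real^2) set"
  assumes C: "compact C" and r: "0 < r"
  obtains G G' where "C1c G G'" "\<And>x. 0 \<le> G x" "\<And>x. G x \<le> 1" "\<And>x. x \<in> C \<Longrightarrow> G x = 1"
    "\<And>x. (\<And>y. y \<in> C \<Longrightarrow> r \<le> dist x y) \<Longrightarrow> G x = 0"
proof -
  obtain F where F: "F \<subseteq> C" "finite F" "C \<subseteq> (\<Union>c\<in>F. ball c (r / 2))"
  proof (rule compactE_image[OF C, of C "\<lambda>c. ball c (r / 2)"])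
    show "C \<subseteq> (\<Union>c\<in>C. ball c (r / 2))" using r by auto
  qed auto
  \<comment> \<open>A point of \<open>C\<close> is within \<open>r / 2\<close> of some centre, where that bump is at least \<open>m\<close>.\<close>
  define m where "m = (3 / 4 * r\<^sup>2)\<^sup>2"
  have m: "0 < m" using r by (simp add: m_def)
  define b where "b x = (\<Sum>c\<in>F. (max 0 (r\<^sup>2 - (x - c) \<bullet> (x - c)))\<^sup>2)" for x
  define b' where "b' x = (\<Sum>c\<in>F. (2 * max 0 (r\<^sup>2 - (x - c) \<bullet> (x - c)) * (- 2)) *\<^sub>R (x - c))" for x
  have db: "(b has_derivative (\<lambda>k. b' x \<bullet> k)) (at x)" for x
  proof -
    have 1: "((\<lambda>x. r\<^sup>2 - (x - c) \<bullet> (x - c)) has_derivative (\<lambda>k. - 2 * ((x - c) \<bullet> k))) (at x)" for c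
    proof -
      have "((\<lambda>x. x - c) has_derivative (\<lambda>k. k - 0)) (at x)" by (intro has_derivative_diff has_derivative_ident has_derivative_const)
      from has_derivative_diff[OF has_derivative_const[of "r\<^sup>2"] has_derivative_inner[OF this this]]
      show ?thesis by (rule has_derivative_eq_rhs) (auto simp: inner_commute)
    qed
    have "((\<lambda>x. (max 0 (r\<^sup>2 - (x - c) \<bullet> (x - c)))\<^sup>2) has_derivative (\<lambda>k. 2 * max 0 (r\<^sup>2 - (x - c) \<bullet> (x - c)) * (- 2 * ((x - c) \<bullet> k)))) (at x)" for c
      by (rule has_derivative_compose[OF 1 DERIV_max_power2[THEN has_field_derivative_imp_has_derivative], THEN has_derivative_eq_rhs]) auto
    then have "(b has_derivative (\<lambda>k. \<Sum>c\<in>F. 2 * max 0 (r\<^sup>2 - (x - c) \<bullet> (x - c)) * (- 2 * ((x - c) \<bullet> k)))) (at x)"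
      unfolding b_def[abs_def] by (intro has_derivative_sum)
    then show ?thesis
      by (rule has_derivative_eq_rhs) (auto simp: b'_def inner_sum_left fun_eq_iff intro!: sum.cong)
  qed
  have cb: "continuous_on UNIV b" "continuous_on UNIV b'"
    unfolding b_def b'_def by (intro continuous_intros)+
  define G where "G x = smoothstep (b x / m)" for x
  define G' where "G' x = (smoothstep' (b x / m) / m) *\<^sub>R b' x" for x
  have far: "b x = 0" if x: "\<And>y. y \<in> C \<Longrightarrow> r \<le> dist x y" for x
    unfolding b_def
  proof (rule sum.neutral, rule ballI)
    fix c assume "c \<in> F"
    then have "r \<le> norm (x - c)" using x F by (auto simp: dist_norm)
    then have "r\<^sup>2 \<le> (norm (x - c))\<^sup>2" using r by (intro power_mono) auto
    then show "(max 0 (r\<^sup>2 - (x - c) \<bullet> (x - c)))\<^sup>2 = 0" by (simp add: power2_norm_eq_inner)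
  qed
  have far': "G x = 0" if x: "\<And>y. y \<in> C \<Longrightarrow> r \<le> dist x y" for x
    using far[OF x] smoothstep_props(1)[of 0] by (simp add: G_def)
  obtain R where R: "\<And>x. x \<in> C \<Longrightarrow> norm x \<le> R" using compact_imp_bounded[OF C] by (auto simp: bounded_iff)
  show ?thesis
  proof
    show "C1c G G'"
      unfolding C1c_def
    proof (intro conjI allI)
      fix x
      have "((\<lambda>x. b x / m) has_derivative (\<lambda>k. (b' x \<bullet> k) / m)) (at x)"
        using has_derivative_mult_left[OF db[of x], of "1 / m"] by simp
      from has_derivative_compose[OF this DERIV_smoothstep[THEN has_field_derivative_imp_has_derivative]]
      show "(G has_derivative (\<bullet>) (G' x)) (at x)"
        unfolding G_def[abs_def] by (rule has_derivative_eq_rhs) (auto simp: G'_def fun_eq_iff)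
      show "continuous_on UNIV G'"
        unfolding G'_def using m by (intro continuous_intros continuous_on_compose2[OF continuous_smoothstep'] cb) auto
      show "\<exists>\<rho>. \<forall>x. \<rho> \<le> norm x \<longrightarrow> G x = 0"
      proof (intro exI[of _ "R + r"] allI impI far')
        fix x y :: "real^2" assume "R + r \<le> norm x" "y \<in> C"
        then show "r \<le> dist x y" using R[of y] norm_triangle_ineq2[of x y] by (simp add: dist_norm)
      qed
    qed
    show "0 \<le> G x" "G x \<le> 1" for x by (auto simp: G_def smoothstep_props)
    show "G x = 1" if xC: "x \<in> C" for x
    proof -
      obtain c where c: "c \<in> F" "x \<in> ball c (r / 2)" using F(3) xC by blast
      then have "(norm (x - c))\<^sup>2 \<le> (r / 2)\<^sup>2" by (intro power_mono) (auto simp: dist_norm norm_minus_commute)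
      then have "3 / 4 * r\<^sup>2 \<le> max 0 (r\<^sup>2 - (x - c) \<bullet> (x - c))" by (simp add: power2_norm_eq_inner power_divide le_max_iff_disj)
      then have "m \<le> (max 0 (r\<^sup>2 - (x - c) \<bullet> (x - c)))\<^sup>2" unfolding m_def by (intro power_mono) auto
      also have "\<dots> \<le> b x" unfolding b_def using c F by (intro member_le_sum) auto
      finally show ?thesis unfolding G_def using m by (intro smoothstep_props) simp
    qed
  qed (use far' in blast)
qed

lemma C1c_approximation_compact:
  fixes C :: "(real^2) set"
  assumes C: "compact C"
  obtains G G' \<rho> where "\<And>n. C1c (G n) (G' n)" "\<And>n x. 0 \<le> G n x" "\<And>n x. G n x \<le> 1" 
    "\<And>x. (\<lambda>n::nat. G n x) \<longlonglongrightarrow> indicator C x" "\<And>n x. \<rho> \<le> norm x \<Longrightarrow> G n x = 0" "0 < \<rho>"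
proof -
  have "\<exists>P. \<forall>n. (case P n of (G, G') \<Rightarrow> C1c G G' \<and> (\<forall>x. 0 \<le> G x) \<and> (\<forall>x. G x \<le> 1) \<and> (\<forall>x\<in>C. G x = 1) \<and>
    (\<forall>x. (\<forall>y\<in>C. 1 / (real n + 1) \<le> dist x y) \<longrightarrow> G x = 0))"
  proof (rule choice, rule allI)
    fix n
    have "0 < 1 / (real n + 1)" by simp
    from C1c_urysohn[OF C this]
    obtain G G' where "C1c G G'" "\<And>x. 0 \<le> G x" "\<And>x. G x \<le> 1" "\<And>x. x \<in> C \<Longrightarrow> G x = 1"
      "\<And>x. (\<And>y. y \<in> C \<Longrightarrow> 1 / (real n + 1) \<le> dist x y) \<Longrightarrow> G x = 0" by metis
    then show "\<exists>P. case P of (G, G') \<Rightarrow> C1c G G' \<and> (\<forall>x. 0 \<le> G x) \<and> (\<forall>x. G x \<le> 1) \<and> (\<forall>x\<in>C. G x = 1) \<and>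
    (\<forall>x. (\<forall>y\<in>C. 1 / (real n + 1) \<le> dist x y) \<longrightarrow> G x = 0)"
      by (intro exI[of _ "(G, G')"]) auto
  qed
  then obtain P where P0: "\<forall>n. (case P n of (G, G') \<Rightarrow> C1c G G' \<and> (\<forall>x. 0 \<le> G x) \<and> (\<forall>x. G x \<le> 1) \<and> (\<forall>x\<in>C. G x = 1) \<and>
    (\<forall>x. (\<forall>y\<in>C. 1 / (real n + 1) \<le> dist x y) \<longrightarrow> G x = 0))" ..
  have P: "\<And>n. C1c (fst (P n)) (snd (P n))" "\<And>n x. 0 \<le> fst (P n) x" "\<And>n x. fst (P n) x \<le> 1"
    "\<And>n x. x \<in> C \<Longrightarrow> fst (P n) x = 1" "\<And>n x. (\<forall>y\<in>C. 1 / (real n + 1) \<le> dist x y) \<Longrightarrow> fst (P n) x = 0"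
    using P0 unfolding case_prod_beta by blast+
  obtain R where R: "0 < R" "\<And>x. x \<in> C \<Longrightarrow> norm x \<le> R" using compact_imp_bounded[OF C] by (auto simp: bounded_pos)
  show ?thesis
  proof (rule that[of "\<lambda>n. fst (P n)" "\<lambda>n. snd (P n)" "R + 1"])
    show "(\<lambda>n. fst (P n) x) \<longlonglongrightarrow> indicator C x" for x
    proof (cases "x \<in> C")
      case True then show ?thesis using P(4) by simp
    next
      case False
      then obtain e where e: "0 < e" "\<forall>y\<in>C. e \<le> dist x y"
        using separate_point_closed[of C x] compact_imp_closed[OF C] by auto
      obtain N where N: "0 < N" "inverse (real N) < e" using ex_inverse_of_nat_less[OF e(1)] by auto
      show ?thesis
      proof (rule tendsto_eventually, rule eventually_sequentiallyI[of N])
        fix n assume n: "N \<le> n"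
        have "1 / (real n + 1) \<le> 1 / real N" using n N by (intro divide_left_mono) auto
        also have "\<dots> \<le> e" using N by (simp add: inverse_eq_divide)
        finally have "fst (P n) x = 0" using e by (intro P(5)) auto
        then show "fst (P n) x = indicator C x" using False by simp
      qed
    qed
    show "fst (P n) x = 0" if "R + 1 \<le> norm x" for n x
    proof (rule P(5), rule ballI)
      fix y assume "y \<in> C"
      have "1 / (real n + 1) \<le> 1" by simp
      then show "1 / (real n + 1) \<le> dist x y" using R(2)[OF \<open>y \<in> C\<close>] that norm_triangle_ineq2[of x y] by (simp add: dist_norm del: divide_le_eq_1_pos)
    qed
  qed (use P R in auto)
qed

text \<open>
  Inner regularity: if the function were negative on a set of positive measure, it would be
  so on a compact subset of positive measure.
\<close>

lemma AE_nonneg_from_compact: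
  fixes f :: "real^2 \<Rightarrow> real"
  assumes f: "f \<in> borel_measurable lebesgue"
    and int: "\<And>C. compact C \<Longrightarrow> integrable lebesgue (\<lambda>x. f x * indicator C x)"
    and pos: "\<And>C. compact C \<Longrightarrow> 0 \<le> (LINT x|lebesgue. f x * indicator C x)"
  shows "AE x in lebesgue. 0 \<le> f x"
proof -
  define A where "A n = {x. f x < 0} \<inter> cball 0 (real n)" for n
  have Am: "A n \<in> sets lebesgue" for n
    using f unfolding A_def by (intro sets.Int) (auto simp: borel_measurable_iff_less[of f lebesgue])
  have null: "emeasure lebesgue C = 0" if C: "compact C" "C \<subseteq> {x. f x < 0}" for C
  proof -
    have le: "0 \<le> - (f x * indicator C x)" for x using C(2) by (auto split: split_indicator)
    have "(LINT x|lebesgue. - (f x * indicator C x)) \<le> 0" using pos[OF C(1)] by simp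
    moreover have "0 \<le> (LINT x|lebesgue. - (f x * indicator C x))" using le by (intro Bochner_Integration.integral_nonneg) auto
    ultimately have "(LINT x|lebesgue. - (f x * indicator C x)) = 0" by simp
    then have "AE x in lebesgue. - (f x * indicator C x) = 0"
      using integral_nonneg_eq_0_iff_AE[of lebesgue "\<lambda>x. - (f x * indicator C x)"] int[OF C(1)] le by auto
    then have "AE x in lebesgue. x \<notin> C"
    proof eventually_elim
      case (elim x)
      show ?case
      proof
        assume "x \<in> C" then show False using elim C(2) by auto
      qed
    qed
    moreover have "C \<in> sets lebesgue" using C(1) by (simp add: compact_imp_closed)
    ultimately show ?thesis by (subst AE_iff_measurable[symmetric, where P="\<lambda>x. x \<notin> C"]) auto
  qed
  have A0: "emeasure lebesgue (A n) = 0" for n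
  proof (rule ccontr)
    assume "emeasure lebesgue (A n) \<noteq> 0"
    then have p: "0 < emeasure lebesgue (A n)" by (simp add: zero_less_iff_neq_zero)
    obtain e :: real where e: "0 < e" "ennreal e \<le> emeasure lebesgue (A n)"
    proof (cases "emeasure lebesgue (A n)")
      case (real r) then show ?thesis using p that[of r] by auto
    next
      case top then show ?thesis using that[of 1] by auto
    qed
    obtain K where K: "closed K" "K \<subseteq> A n" "emeasure lebesgue (A n - K) < ennreal e"
      using sets_lebesgue_inner_closed[OF Am e(1)] by metis
    have "compact K" using K(1,2) by (intro compact_eq_bounded_closed[THEN iffD2] conjI bounded_subset[OF bounded_cball]) (auto simp: A_def)
    then have "emeasure lebesgue K = 0" using K(2) by (intro null) (auto simp: A_def)
    then have "emeasure lebesgue (A n) \<le> emeasure lebesgue (A n - K) + 0"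
    proof -
      have Ks: "K \<in> sets lebesgue" using K(1) by simp
      have "A n = (A n - K) \<union> K" using K(2) by auto
      then have "emeasure lebesgue (A n) \<le> emeasure lebesgue (A n - K) + emeasure lebesgue K"
        using emeasure_subadditive[of "A n - K" lebesgue K] Ks Am[of n] by (simp del: Un_Diff_cancel2 emeasure_completion) 
      then show ?thesis using \<open>emeasure lebesgue K = 0\<close> by simp
    qed
    then show False using K(3) e(2) by auto
  qed
  have "AE x in lebesgue. \<forall>n. x \<notin> A n"
    unfolding AE_all_countable
  proof
    fix n show "AE x in lebesgue. x \<notin> A n" using A0[of n] Am[of n] by (intro AE_not_in) auto
  qed
  then show ?thesis
  proof eventually_elim
    case (elim x)
    obtain n where "norm x \<le> real n" using real_arch_simple by blast
    then show ?case using elim[rule_format, of n] by (auto simp: A_def)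
  qed
qed

section \<open>The second moment\<close>

lemma integrable_bounded_product:
  fixes f :: "'a::euclidean_space \<Rightarrow> real" and g :: "'b::euclidean_space \<Rightarrow> real" and b :: "'a \<times> 'b \<Rightarrow> real"
  assumes f: "integrable lborel f" and g: "integrable lborel g"
    and b: "b \<in> borel_measurable (borel \<Otimes>\<^sub>M borel)" "\<And>z. \<bar>b z\<bar> \<le> B"
  shows "integrable (lborel \<Otimes>\<^sub>M lborel) (\<lambda>(x, y). f x * g y * b (x, y))"
proof -
  have [measurable]: "f \<in> borel_measurable borel" "g \<in> borel_measurable borel" using f g by auto
  note b(1)[measurable]
  have "integrable (lborel \<Otimes>\<^sub>M lborel) (\<lambda>(x, y). f x * g y)"
  proof (rule lborel_pair.Fubini_integrable)
    show "integrable lborel (\<lambda>x. LINT y|lborel. norm (case (x, y) of (x, y) \<Rightarrow> f x * g y))"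
      using f by (simp add: abs_mult)
    show "AE x in lborel. integrable lborel (\<lambda>y. case (x, y) of (x, y) \<Rightarrow> f x * g y)" using g by simp
  qed measurable
  then have i: "integrable (lborel \<Otimes>\<^sub>M lborel) (\<lambda>z. B * (case z of (x, y) \<Rightarrow> f x * g y))" by (intro integrable_mult_right) 
  show ?thesis
  proof (rule Bochner_Integration.integrable_bound[OF i])
    show "AE z in lborel \<Otimes>\<^sub>M lborel. norm (case z of (x, y) \<Rightarrow> f x * g y * b (x, y)) \<le> norm (B * (case z of (x, y) \<Rightarrow> f x * g y))"
    proof (rule AE_I2)
      fix z :: "'a \<times> 'b"
      have "\<bar>f (fst z) * g (snd z)\<bar> * \<bar>b z\<bar> \<le> \<bar>f (fst z) * g (snd z)\<bar> * \<bar>B\<bar>"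
        using b(2)[of z] by (intro mult_left_mono) auto
      then show "norm (case z of (x, y) \<Rightarrow> f x * g y * b (x, y)) \<le> norm (B * (case z of (x, y) \<Rightarrow> f x * g y))"
        by (simp add: case_prod_beta abs_mult mult_ac)
    qed
  qed measurable
qed

lemma perp_diff: "perp (x - y) = - perp (y - x)"
  by (simp add: vec_eq_iff forall_2 perp_component)

lemma perp_orth: "perp x \<bullet> x = 0"
  by (simp add: inner_vec_def sum_2 perp_component)

text \<open>
  The kernel is odd, so exchanging \<open>x\<close> and \<open>y\<close> replaces \<open>x\<close> by \<open>- y\<close> in the last factor; the
  symmetrised integrand contains \<open>perp (x - y) \<bullet> (x - y) = 0\<close>.
\<close>

lemma regularised_moment_identity:
  fixes f :: "real^2 \<Rightarrow> real"
  assumes f: "integrable lborel f" and supp: "\<And>x. r < norm x \<Longrightarrow> f x = 0" and r: "0 \<le> r"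
  shows "(LINT x|lborel. f x * (LINT y|lborel. f y * (reg_profile n ((x - y) \<bullet> (x - y)) * (perp (x - y) \<bullet> x)))) = 0"
proof -
  have fm[measurable]: "f \<in> borel_measurable borel" using f by auto
  have cp: "continuous_on UNIV perp" unfolding perp_def vec2_axis by (intro continuous_intros)
  let ?k = "\<lambda>z. reg_profile n (z \<bullet> z) *\<^sub>R perp z"
  have ck: "continuous_on UNIV ?k"
    by (intro continuous_intros cp continuous_on_compose2[OF reg_profile_continuous(1)]) auto
  obtain K where K: "\<And>z. norm (?k z) \<le> K"
    using compact_support_bounded[OF ck, of "2^n"] reg_profile_far by (metis scaleR_zero_left)
  have K0: "0 \<le> K" using K[of 0] norm_ge_zero order_trans by blast
  define b where "b z = (if norm (fst z) \<le> r \<and> norm (snd z) \<le> r then ?k (fst z - snd z) \<bullet> fst z else 0)" for z :: "(real^2) \<times> (real^2)"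
  have [measurable]: "?k \<in> borel_measurable borel" by (rule borel_measurable_continuous_onI[OF ck])
  have bm[measurable]: "b \<in> borel_measurable (borel \<Otimes>\<^sub>M borel)"
  proof -
    have "(\<lambda>z::(real^2) \<times> (real^2). ?k (fst z - snd z)) \<in> borel_measurable (borel \<Otimes>\<^sub>M borel)"
      by (rule measurable_compose[of "\<lambda>z. fst z - snd z" _ borel ?k]) measurable
    then have [measurable]: "(\<lambda>z. ?k (fst z - snd z) \<bullet> fst z) \<in> borel_measurable (borel \<Otimes>\<^sub>M borel)"
      by (intro borel_measurable_inner) measurable
    show ?thesis unfolding b_def by measurable
  qed
  have bb: "\<bar>b z\<bar> \<le> K * r" for z
  proof (cases "norm (fst z) \<le> r")
    case True
    have "\<bar>?k (fst z - snd z) \<bullet> fst z\<bar> \<le> K * r"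
      using Cauchy_Schwarz_ineq2[of "?k (fst z - snd z)" "fst z"] mult_mono[OF K True K0 norm_ge_zero] by (rule order_trans)
    then show ?thesis using K0 r by (auto simp: b_def)
  next
    case False then show ?thesis using K0 r by (simp add: b_def)
  qed
  let ?S = "\<lambda>x y. f x * f y * b (x, y)"
  have i: "integrable (lborel \<Otimes>\<^sub>M lborel) (\<lambda>(x, y). ?S x y)" by (rule integrable_bounded_product[OF f f bm bb])
  have anti: "?S y x = - ?S x y" for x y
  proof -
    have "?k (x - y) \<bullet> x = - (?k (y - x) \<bullet> y)"
    proof -
      have q: "(x - y) \<bullet> (x - y) = (y - x) \<bullet> (y - x)" by (simp add: algebra_simps)
      have "perp (x - y) \<bullet> (x - y) = 0" by (rule perp_orth)
      then have "perp (x - y) \<bullet> x = perp (x - y) \<bullet> y" by (simp add: inner_diff_right)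
      also have "\<dots> = - (perp (y - x) \<bullet> y)" by (subst perp_diff) simp
      finally show ?thesis by (simp add: q)
    qed
    then have "b (x, y) = - b (y, x)" by (simp add: b_def mult_ac)
    then show ?thesis by simp
  qed
  have "(LINT x|lborel. LINT y|lborel. ?S x y) = (LINT y|lborel. LINT x|lborel. ?S x y)"
    by (rule lborel_pair.Fubini_integral[OF i, symmetric])
  also have "\<dots> = (LINT y|lborel. LINT x|lborel. - ?S y x)" by (subst anti) simp
  also have "\<dots> = - (LINT y|lborel. LINT x|lborel. ?S y x)" by simp
  finally have z: "(LINT x|lborel. LINT y|lborel. ?S x y) = 0" by simp
  have "(LINT x|lborel. f x * (LINT y|lborel. f y * (reg_profile n ((x - y) \<bullet> (x - y)) * (perp (x - y) \<bullet> x)))) = (LINT x|lborel. LINT y|lborel. ?S x y)"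
  proof (rule Bochner_Integration.integral_cong[OF refl])
    fix x
    have "f x * (f y * (reg_profile n ((x - y) \<bullet> (x - y)) * (perp (x - y) \<bullet> x))) = ?S x y" for y
      using supp[of x] supp[of y] by (cases "r < norm x"; cases "r < norm y") (auto simp: b_def)
    then have "(LINT y|lborel. f x * (f y * (reg_profile n ((x - y) \<bullet> (x - y)) * (perp (x - y) \<bullet> x)))) = (LINT y|lborel. ?S x y)"
      by (intro Bochner_Integration.integral_cong[OF refl])
    then show "f x * (LINT y|lborel. f y * (reg_profile n ((x - y) \<bullet> (x - y)) * (perp (x - y) \<bullet> x))) = (LINT y|lborel. ?S x y)"
      unfolding integral_mult_right_zero .
  qed
  then show ?thesis using z by simp
qed

lemma biot_savart_measurable:
  assumes fm: "f \<in> borel_measurable lebesgue"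
  shows "biot_savart f \<in> borel_measurable lebesgue"
proof -
  obtain g where g[measurable]: "g \<in> borel_measurable borel" "AE x in lborel. f x = g x"
    using completion_ex_borel_measurable_real[OF fm] by auto
  have "(\<lambda>x. LINT y|lborel. g y *\<^sub>R biot_savart_kernel (x - y)) \<in> borel_measurable borel"
    by (rule lborel.borel_measurable_lebesgue_integral) measurable
  moreover have "biot_savart g = (\<lambda>x. LINT y|lborel. g y *\<^sub>R biot_savart_kernel (x - y))"
    unfolding biot_savart_def fun_eq_iff by (intro allI integral_completion) measurable
  moreover have "biot_savart f = biot_savart g" by (rule biot_savart_cong_AE[OF AE_completion[OF g(2)] fm borel_lebesgue[OF g(1)]])
  ultimately show ?thesis by (simp add: borel_lebesgue)
qed

text \<open>
  This expresses conservation of the second moment: the velocity is tangential on average. It is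
  the limit of the regularised identity.
\<close>

lemma moment_identity:
  fixes f :: "real^2 \<Rightarrow> real"
  assumes f: "bounded_vorticity M f" and supp: "AE x in lebesgue. r < norm x \<longrightarrow> f x = 0" and r: "0 \<le> r"
  shows "(LINT x|lebesgue. f x * (biot_savart f x \<bullet> x)) = 0"
proof -
  have fi: "integrable lebesgue f" using f by (auto simp: bounded_vorticity_def)
  then have fm[measurable]: "f \<in> borel_measurable lebesgue" by auto
  obtain g0 where g0[measurable]: "g0 \<in> borel_measurable borel" "AE x in lborel. f x = g0 x"
    using completion_ex_borel_measurable_real[OF fm] by auto
  define g where "g x = (if r < norm x then 0 else g0 x)" for x
  have gm[measurable]: "g \<in> borel_measurable borel" unfolding g_def by measurable
  have ae: "AE x in lebesgue. f x = g x"
    using supp AE_completion[OF g0(2)] by eventually_elim (auto simp: g_def)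
  have gl[measurable]: "g \<in> borel_measurable lebesgue" by (rule borel_lebesgue[OF gm])
  have gi: "integrable lebesgue g" using integrable_cong_AE[OF fm gl ae] fi by simp
  have gi': "integrable lborel g" using gi integrable_completion[of g lborel] gm by simp
  have gM: "bounded_vorticity M g" unfolding bounded_vorticity_def
  proof (intro conjI gi)
    have "(LINT x|lebesgue. \<bar>g x\<bar>) = (LINT x|lebesgue. \<bar>f x\<bar>)"
      by (rule integral_cong_AE) (use ae in \<open>auto elim!: eventually_mono\<close>)
    then show "(LINT x|lebesgue. \<bar>g x\<bar>) \<le> M" using f by (simp add: bounded_vorticity_def)
    have "AE x in lebesgue. \<bar>f x\<bar> \<le> M" using f by (simp add: bounded_vorticity_def)
    then show "AE x in lebesgue. \<bar>g x\<bar> \<le> M" using ae by eventually_elim simp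
  qed
  have bsm: "biot_savart g \<in> borel_measurable lebesgue" by (rule biot_savart_measurable[OF gl])
  have M0: "0 \<le> M" by (rule bounded_vorticity_nonneg[OF f])
  have xm: "(\<lambda>x::real^2. x) \<in> borel_measurable lebesgue" by (intro borel_lebesgue) simp
  have bsm2[measurable]: "(\<lambda>x. biot_savart g x \<bullet> x) \<in> borel_measurable lebesgue"
    by (rule borel_measurable_inner[OF bsm xm])
  have zero: "(LINT x|lebesgue. g x * (reg_velocity n g x \<bullet> x)) = 0" for n
  proof -
    have e: "reg_velocity n g x \<bullet> x = (LINT y|lborel. g y * (reg_profile n ((x - y) \<bullet> (x - y)) * (perp (x - y) \<bullet> x)))" for x
    proof -
      have cp: "continuous_on UNIV perp" unfolding perp_def vec2_axis by (intro continuous_intros)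
      have [measurable]: "perp \<in> borel_measurable borel" "reg_profile n \<in> borel_measurable borel"
        using cp reg_profile_continuous by (auto intro: borel_measurable_continuous_onI)
      have "reg_velocity n g x \<bullet> x = (LINT y|lebesgue. (g y *\<^sub>R vector [reg_kernel1 n (x - y), reg_kernel2 n (x - y)]) \<bullet> x)"
        unfolding reg_velocity_eq(1)[OF gi] by (rule integral_inner_left[symmetric]) (use reg_velocity_eq(2)[OF gi] in auto)
      also have "\<dots> = (LINT y|lebesgue. g y * (reg_profile n ((x - y) \<bullet> (x - y)) * (perp (x - y) \<bullet> x)))"
        by (simp add: reg_kernel_eq mult.assoc)
      also have "\<dots> = (LINT y|lborel. g y * (reg_profile n ((x - y) \<bullet> (x - y)) * (perp (x - y) \<bullet> x)))"
        by (rule integral_completion) measurable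
      finally show ?thesis .
    qed
    have "(LINT x|lebesgue. g x * (reg_velocity n g x \<bullet> x)) = (LINT x|lborel. g x * (reg_velocity n g x \<bullet> x))"
    proof (rule integral_completion)
      have "continuous_on UNIV (reg_velocity n g)"
        by (rule has_derivative_continuous_on) (use reg_velocity_has_derivative[OF gi] in \<open>auto intro: has_derivative_at_withinI\<close>)
      then have [measurable]: "reg_velocity n g \<in> borel_measurable borel" by (rule borel_measurable_continuous_onI)
      show "(\<lambda>x. g x * (reg_velocity n g x \<bullet> x)) \<in> borel_measurable lborel" by measurable
    qed
    also have "\<dots> = 0" unfolding e by (rule regularised_moment_identity[OF gi' _ r]) (simp add: g_def)
    finally show ?thesis .
  qed
  have int1: "integrable lebesgue (\<lambda>x. g x * (u x \<bullet> x))" if um: "(\<lambda>x. u x \<bullet> x) \<in> borel_measurable lebesgue" and u: "\<And>x. norm (u x) \<le> b" for u b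
  proof (rule Bochner_Integration.integrable_bound[of lebesgue "\<lambda>x. g x * (b * r)"])
    have b0: "0 \<le> b" using u[of 0] norm_ge_zero order_trans by blast
    show "AE x in lebesgue. norm (g x * (u x \<bullet> x)) \<le> norm (g x * (b * r))"
    proof (rule AE_I2)
      fix x
      show "norm (g x * (u x \<bullet> x)) \<le> norm (g x * (b * r))"
      proof (cases "r < norm x")
        case True then show ?thesis by (simp add: g_def)
      next
        case False
        then have "norm (u x) * norm x \<le> b * r" using u b0 by (intro mult_mono) auto
        then have "\<bar>u x \<bullet> x\<bar> \<le> b * r" using Cauchy_Schwarz_ineq2[of "u x" x] by linarith
        then show ?thesis using b0 r by (simp add: abs_mult mult_left_mono)
      qed
    qed
    show "(\<lambda>x. g x * (u x \<bullet> x)) \<in> borel_measurable lebesgue" using um by measurable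
  qed (use gi in auto)
  have "\<bar>LINT x|lebesgue. g x * (biot_savart g x \<bullet> x)\<bar> \<le> M * (r * (3 * M * (1/2)^n))" for n
  proof -
    have ub: "norm (reg_velocity n g x) \<le> 3 * M + 3 * M * (1/2)^n" for x
      using biot_savart_approx[OF gM, of x n] biot_savart_bound[OF gM, of x] norm_triangle_ineq4[of "biot_savart g x" "biot_savart g x - reg_velocity n g x"] by simp
    have cn: "continuous_on UNIV (reg_velocity n g)"
      by (rule has_derivative_continuous_on) (use reg_velocity_has_derivative[OF gi] in \<open>auto intro: has_derivative_at_withinI\<close>)
    have m2: "(\<lambda>x. reg_velocity n g x \<bullet> x) \<in> borel_measurable lebesgue"
      by (intro borel_lebesgue borel_measurable_continuous_onI continuous_intros cn)
    note i1 = int1[OF bsm2 biot_savart_bound[OF gM]] and i2 = int1[OF m2 ub]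
    have "(LINT x|lebesgue. g x * (biot_savart g x \<bullet> x)) = (LINT x|lebesgue. g x * (biot_savart g x \<bullet> x) - g x * (reg_velocity n g x \<bullet> x))"
      using i1 i2 zero[of n] by simp
    also have "norm \<dots> \<le> (LINT x|lebesgue. \<bar>g x\<bar> * (r * (3 * M * (1/2)^n)))"
    proof (rule Bochner_Integration.integral_norm_bound_integral)
      fix x
      show "norm (g x * (biot_savart g x \<bullet> x) - g x * (reg_velocity n g x \<bullet> x)) \<le> \<bar>g x\<bar> * (r * (3 * M * (1/2)^n))"
      proof (cases "r < norm x")
        case True then show ?thesis by (simp add: g_def)
      next
        case False
        have "\<bar>(biot_savart g x - reg_velocity n g x) \<bullet> x\<bar> \<le> norm (biot_savart g x - reg_velocity n g x) * norm x" by (rule Cauchy_Schwarz_ineq2)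
        also have "\<dots> \<le> 3 * M * (1/2)^n * r" using False M0 by (intro mult_mono biot_savart_approx[OF gM]) auto
        finally have "\<bar>g x\<bar> * \<bar>(biot_savart g x - reg_velocity n g x) \<bullet> x\<bar> \<le> \<bar>g x\<bar> * (3 * M * (1/2)^n * r)" by (intro mult_left_mono) auto
        then show ?thesis by (simp add: right_diff_distrib[symmetric] inner_diff_left[symmetric] abs_mult mult_ac)
      qed
    qed (use i1 i2 gi in auto)
    also have "\<dots> = (LINT x|lebesgue. \<bar>g x\<bar>) * (r * (3 * M * (1/2)^n))" by simp
    also have "\<dots> \<le> M * (r * (3 * M * (1/2)^n))" using gM M0 r by (intro mult_right_mono) (auto simp: bounded_vorticity_def)
    finally show ?thesis by simp
  qed
  moreover have "(\<lambda>n. M * (r * (3 * M * (1/2)^n))) \<longlonglongrightarrow> M * (r * (3 * M * 0))"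
    by (intro tendsto_mult tendsto_const LIMSEQ_realpow_zero) auto
  ultimately have "\<bar>LINT x|lebesgue. g x * (biot_savart g x \<bullet> x)\<bar> \<le> M * (r * (3 * M * 0))"
    by (intro LIMSEQ_le_const) auto
  then have "(LINT x|lebesgue. g x * (biot_savart g x \<bullet> x)) = 0" by simp
  moreover have "(LINT x|lebesgue. f x * (biot_savart f x \<bullet> x)) = (LINT x|lebesgue. g x * (biot_savart g x \<bullet> x))"
    unfolding biot_savart_cong_AE[OF ae fm gl]
  proof (rule integral_cong_AE)
    show "AE x in lebesgue. f x * (biot_savart g x \<bullet> x) = g x * (biot_savart g x \<bullet> x)" using ae by eventually_elim simp
  qed measurable
  ultimately show ?thesis by simp
qed

section \<open>Stability of the disc\<close>

lemma circle_area_lebesgue: "0 \<le> r \<Longrightarrow> measure lebesgue (ball (c::real^2) r) = pi * r\<^sup>2"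
  using emeasure_ball_plane[of r c] by (simp add: measure_def)

text \<open>
  Since \<open>0 \<le> f \<le> 1\<close>, the factors \<open>f - 1\<^sub>D\<close> and \<open>|x|\<^sup>2 - 1\<close> have the same sign at every point, so the
  assumption bounds the integral of \<open>|f - 1\<^sub>D| ||x|\<^sup>2 - 1|\<close>. The weight is at least \<open>\<epsilon>\<close> outside an annulus
  of area \<open>2 * pi * \<epsilon>\<close>, and inside it \<open>|f - 1\<^sub>D| \<le> 1\<close>.
\<close>

lemma L1_distance_from_moment:
  fixes f :: "real^2 \<Rightarrow> real"
  assumes f: "integrable lebesgue f" and f01: "AE x in lebesgue. 0 \<le> f x \<and> f x \<le> 1"
    and fx: "integrable lebesgue (\<lambda>x. f x * (x \<bullet> x))"
    and k: "(LINT x|lebesgue. (f x - indicator (ball 0 1) x) * (x \<bullet> x - 1)) \<le> \<kappa>"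
    and \<epsilon>: "0 < \<epsilon>" "\<epsilon> \<le> 1"
  shows "(LINT x|lebesgue. \<bar>f x - indicator (ball 0 1) x\<bar>) \<le> 2 * pi * \<epsilon> + \<kappa> / \<epsilon>"
proof -
  let ?D = "ball (0::real^2) 1"
  define A where "A = ball (0::real^2) (sqrt (1 + \<epsilon>)) - ball 0 (sqrt (1 - \<epsilon>))"
  have Am: "measure lebesgue A = 2 * pi * \<epsilon>"
  proof -
    have "measure lebesgue A = measure lebesgue (ball (0::real^2) (sqrt (1 + \<epsilon>))) - measure lebesgue (ball (0::real^2) (sqrt (1 - \<epsilon>)))"
      unfolding A_def using \<epsilon> by (intro measure_Diff) (auto simp: emeasure_ball_plane subset_ball simp del: emeasure_completion)
    also have "\<dots> = 2 * pi * \<epsilon>" using \<epsilon> by (simp add: circle_area algebra_simps)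
    finally show ?thesis .
  qed
  have Al: "A \<in> lmeasurable" unfolding A_def by (intro fmeasurable.Diff) auto
  have iA: "integrable lebesgue (indicator A :: real^2 \<Rightarrow> real)"
    using Al by (intro integrable_real_indicator) (auto simp: fmeasurable_def)
  have iD: "integrable lebesgue (indicator ?D :: real^2 \<Rightarrow> real)"
    by (intro integrable_real_indicator) (auto simp: emeasure_ball_plane simp del: emeasure_completion)
  have xm: "(\<lambda>x::real^2. x \<bullet> x) \<in> borel_measurable lebesgue" by (intro borel_lebesgue) measurable
  have iDx: "integrable lebesgue (\<lambda>x. indicator ?D x * (x \<bullet> x))"
  proof (rule Bochner_Integration.integrable_bound[OF iD])
    show "AE x in lebesgue. norm (indicator ?D x * (x \<bullet> x)) \<le> norm (indicator ?D x :: real)"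
      by (intro AE_I2) (auto split: split_indicator simp: power2_norm_eq_inner[symmetric] power_le_one)
    show "(\<lambda>x. indicator ?D x * (x \<bullet> x)) \<in> borel_measurable lebesgue" using xm by (intro borel_measurable_times borel_measurable_indicator) auto
  qed
  have iP: "integrable lebesgue (\<lambda>x. (f x - indicator ?D x) * (x \<bullet> x - 1))"
  proof -
    have "(\<lambda>x. (f x - indicator ?D x) * (x \<bullet> x - 1)) = (\<lambda>x. f x * (x \<bullet> x) - f x - (indicator ?D x * (x \<bullet> x) - indicator ?D x))"
      by (simp add: fun_eq_iff algebra_simps)
    then show ?thesis using f fx iD iDx by simp
  qed
  have pt: "\<bar>f x - indicator ?D x\<bar> \<le> indicator A x + (f x - indicator ?D x) * (x \<bullet> x - 1) * (1 / \<epsilon>)" if x: "0 \<le> f x \<and> f x \<le> 1" for x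
  proof -
    have n: "x \<bullet> x = (norm x)\<^sup>2" by (simp add: power2_norm_eq_inner)
    have e: "(f x - indicator ?D x) * (x \<bullet> x - 1) = \<bar>f x - indicator ?D x\<bar> * \<bar>x \<bullet> x - 1\<bar>"
    proof (cases "norm x < 1")
      case True
      then have "x \<bullet> x \<le> 1" unfolding n by (simp add: power_le_one)
      then have "\<bar>f x - 1\<bar> = 1 - f x" "\<bar>x \<bullet> x - 1\<bar> = 1 - x \<bullet> x" using x by auto
      then show ?thesis using True by (simp add: algebra_simps)
    next
      case False
      then have "1 \<le> x \<bullet> x" unfolding n by simp
      then show ?thesis using x False by simp
    qed
    show ?thesis
    proof (cases "x \<in> A")
      case True
      have "0 \<le> (f x - indicator ?D x) * (x \<bullet> x - 1) * (1 / \<epsilon>)" unfolding e using \<epsilon> by simp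
      moreover have "\<bar>f x - indicator ?D x\<bar> \<le> 1" using x by (auto split: split_indicator)
      ultimately show ?thesis using True by simp
    next
      case False
      have "\<epsilon> \<le> \<bar>x \<bullet> x - 1\<bar>"
      proof (cases "norm x < sqrt (1 - \<epsilon>)")
        case True
        then have "(norm x)\<^sup>2 \<le> (sqrt (1 - \<epsilon>))\<^sup>2" by (intro power_mono) auto
        then show ?thesis using \<epsilon> unfolding n by simp
      next
        case F: False
        with False have "sqrt (1 + \<epsilon>) \<le> norm x" by (simp add: A_def)
        then have "(sqrt (1 + \<epsilon>))\<^sup>2 \<le> (norm x)\<^sup>2" using \<epsilon> by (intro power_mono) auto
        then show ?thesis using \<epsilon> unfolding n by simp
      qed
      then have "\<bar>f x - indicator ?D x\<bar> * 1 \<le> \<bar>f x - indicator ?D x\<bar> * (\<bar>x \<bullet> x - 1\<bar> * (1 / \<epsilon>))"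
        using \<epsilon> by (intro mult_left_mono) (auto simp: field_simps)
      then show ?thesis using False by (simp add: e mult.assoc)
    qed
  qed
  have "(LINT x|lebesgue. \<bar>f x - indicator ?D x\<bar>) \<le> (LINT x|lebesgue. indicator A x + (f x - indicator ?D x) * (x \<bullet> x - 1) * (1 / \<epsilon>))"
  proof (rule integral_mono_AE)
    show "integrable lebesgue (\<lambda>x. \<bar>f x - indicator ?D x\<bar>)" using f iD by simp
    show "integrable lebesgue (\<lambda>x. indicator A x + (f x - indicator ?D x) * (x \<bullet> x - 1) * (1 / \<epsilon>))"
      using iA iP by (intro Bochner_Integration.integrable_add integrable_mult_left)
    show "AE x in lebesgue. \<bar>f x - indicator ?D x\<bar> \<le> indicator A x + (f x - indicator ?D x) * (x \<bullet> x - 1) * (1 / \<epsilon>)"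
      using f01 by eventually_elim (rule pt)
  qed
  also have "\<dots> = (LINT x|lebesgue. indicator A x) + (LINT x|lebesgue. (f x - indicator ?D x) * (x \<bullet> x - 1)) * (1 / \<epsilon>)"
    using iA iP by (subst Bochner_Integration.integral_add) auto
  also have "(LINT x|lebesgue. indicator A x :: real) = 2 * pi * \<epsilon>" using Am Al by simp
  also have "(LINT x|lebesgue. (f x - indicator ?D x) * (x \<bullet> x - 1)) * (1 / \<epsilon>) \<le> \<kappa> * (1 / \<epsilon>)" using k \<epsilon> by (intro mult_right_mono) auto
  finally show ?thesis by simp
qed

context yudovich_flow begin

text \<open>
  Continuity of all compositions with bumps forces continuity: the bump at \<open>\<phi> x0 s\<close> separates
  it from the complement of a small ball.
\<close>

lemma flow_continuous:
  assumes s: "0 \<le> s" "s \<le> T" shows "continuous_on UNIV (\<lambda>x. \<phi> x s)"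
  unfolding continuous_on_iff
proof (intro ballI allI impI)
  fix x0 :: "real^2" and e :: real assume e: "0 < e"
  obtain G G' where G: "C1c G G'" "\<And>x. 0 \<le> G x" "\<And>x. x \<in> {\<phi> x0 s} \<Longrightarrow> G x = 1"
    "\<And>x. (\<And>y. y \<in> {\<phi> x0 s} \<Longrightarrow> e \<le> dist x y) \<Longrightarrow> G x = 0"
  proof (rule C1c_urysohn[of "{\<phi> x0 s}" e])
    show "compact {\<phi> x0 s}" "0 < e" using e by auto
  qed blast
  have "continuous_on UNIV (\<lambda>x. G (\<phi> x s))" using transported[OF s] G unfolding transported_def by blast
  then obtain d where d: "0 < d" "\<And>x. dist x x0 < d \<Longrightarrow> dist (G (\<phi> x s)) (G (\<phi> x0 s)) < 1"
    unfolding continuous_on_iff using zero_less_one by blast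
  show "\<exists>d>0. \<forall>x\<in>UNIV. dist x x0 < d \<longrightarrow> dist (\<phi> x s) (\<phi> x0 s) < e"
  proof (intro exI[of _ d] conjI ballI impI d)
    fix x assume "dist x x0 < d"
    from d(2)[OF this] have "G (\<phi> x s) \<noteq> 0" using G(3)[of "\<phi> x0 s"] by (auto simp: dist_real_def)
    then show "dist (\<phi> x s) (\<phi> x0 s) < e" using G(4)[of "\<phi> x s"] by force
  qed
qed

lemma flow_preimage_sets:
  assumes "0 \<le> s" "s \<le> T" "compact C"
  shows "(\<lambda>x. indicator C (\<phi> x s) :: real) \<in> borel_measurable lebesgue"
proof -
  have [measurable]: "(\<lambda>x. \<phi> x s) \<in> borel_measurable borel" using flow_continuous[OF assms(1,2)] by (rule borel_measurable_continuous_onI)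
  have [measurable]: "C \<in> sets borel" using assms(3) by (simp add: compact_imp_closed)
  show ?thesis by (intro borel_lebesgue) measurable
qed

text \<open>
  Indicators of compact sets are bounded pointwise limits of test functions; the last inequality
  combines the transport of the patch with the flow not increasing area.
\<close>

lemma pushforward_compact:
  assumes s: "0 \<le> s" "s \<le> T" and C: "compact C"
  shows "integrable lebesgue (\<lambda>x. \<theta> s x * indicator C x)"
    "(LINT x|lebesgue. \<theta> s x * indicator C x) = (LINT x|lebesgue. indicator \<Omega> x * indicator C (\<phi> x s))"
    "(LINT x|lebesgue. \<theta> s x * indicator C x) \<le> measure lebesgue C"
proof -
  obtain G G' \<rho> where G: "\<And>n. C1c (G n) (G' n)" "\<And>n x. 0 \<le> G n x" "\<And>n x. G n x \<le> 1" 
    "\<And>x. (\<lambda>n::nat. G n x) \<longlonglongrightarrow> indicator C x" "\<And>n x. \<rho> \<le> norm x \<Longrightarrow> G n x = 0" "0 < \<rho>"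
    using C1c_approximation_compact[OF C] by metis
  have Gm[measurable]: "G n \<in> borel_measurable lebesgue" for n
    by (intro borel_lebesgue borel_measurable_continuous_onI C1c_continuous[OF G(1)])
  have Cs[measurable]: "C \<in> sets lebesgue" using C by (simp add: compact_imp_closed)
  have \<theta>i: "integrable lebesgue (\<theta> s)" by (rule vort_integrable[OF s])
  have [measurable]: "\<theta> s \<in> borel_measurable lebesgue" using \<theta>i by auto
  note [measurable] = flow_preimage_sets[OF s C]
  have tr: "(LINT x|lebesgue. \<theta> s x * G n x) = (LINT x|lebesgue. indicator \<Omega> x * G n (\<phi> x s))"
     "(\<integral>\<^sup>+x. ennreal (G n (\<phi> x s)) \<partial>lebesgue) \<le> ennreal (LINT x|lebesgue. G n x)"
     "continuous_on UNIV (\<lambda>x. G n (\<phi> x s))" for n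
    using transported[OF s] G(1,2)[of n] unfolding transported_def by blast+
  have [measurable]: "(\<lambda>x. G n (\<phi> x s)) \<in> borel_measurable lebesgue" for n
    by (intro borel_lebesgue borel_measurable_continuous_onI tr)
  show "integrable lebesgue (\<lambda>x. \<theta> s x * indicator C x)"
    by (rule Bochner_Integration.integrable_bound[OF \<theta>i]) (auto intro!: AE_I2 split: split_indicator)
  have l1: "(\<lambda>n. LINT x|lebesgue. \<theta> s x * G n x) \<longlonglongrightarrow> (LINT x|lebesgue. \<theta> s x * indicator C x)"
  proof (rule integral_dominated_convergence[where w = "\<lambda>x. \<bar>\<theta> s x\<bar>"])
    show "AE x in lebesgue. (\<lambda>n. \<theta> s x * G n x) \<longlonglongrightarrow> \<theta> s x * indicator C x"
      by (intro AE_I2 tendsto_mult tendsto_const G)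
    show "AE x in lebesgue. norm (\<theta> s x * G n x) \<le> \<bar>\<theta> s x\<bar>" for n
      using G(2,3) by (intro AE_I2) (simp add: abs_mult mult_left_le)
  qed (use \<theta>i in auto)
  have l2: "(\<lambda>n. LINT x|lebesgue. indicator \<Omega> x * G n (\<phi> x s)) \<longlonglongrightarrow> (LINT x|lebesgue. indicator \<Omega> x * indicator C (\<phi> x s))"
  proof (rule integral_dominated_convergence[where w = "indicator \<Omega>"])
    show "AE x in lebesgue. (\<lambda>n. indicator \<Omega> x * G n (\<phi> x s)) \<longlonglongrightarrow> indicator \<Omega> x * indicator C (\<phi> x s)"
      by (intro AE_I2 tendsto_mult tendsto_const G)
    show "AE x in lebesgue. norm (indicator \<Omega> x * G n (\<phi> x s)) \<le> indicator \<Omega> x" for n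
      using G(2,3) by (intro AE_I2) (auto simp: abs_mult split: split_indicator)
    show "integrable lebesgue (indicator \<Omega> :: real^2 \<Rightarrow> real)" using \<Omega>_finite by (intro integrable_real_indicator) auto
  qed auto
  show "(LINT x|lebesgue. \<theta> s x * indicator C x) = (LINT x|lebesgue. indicator \<Omega> x * indicator C (\<phi> x s))"
    using LIMSEQ_unique[OF l1] l2 unfolding tr(1) by blast
  have l3: "(\<lambda>n. LINT x|lebesgue. G n x) \<longlonglongrightarrow> (LINT x|lebesgue. indicator C x)"
  proof (rule integral_dominated_convergence[where w = "indicator (ball 0 \<rho>)"])
    show "AE x in lebesgue. (\<lambda>n. G n x) \<longlonglongrightarrow> indicator C x" using G by auto
    show "AE x in lebesgue. norm (G n x) \<le> indicator (ball 0 \<rho>) x" for n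
      using G(2,3,5) by (intro AE_I2) (auto split: split_indicator simp: not_less)
    show "integrable lebesgue (indicator (ball 0 \<rho>) :: real^2 \<Rightarrow> real)"
      using G(6) by (intro integrable_real_indicator) (auto simp: emeasure_ball_plane simp del: emeasure_completion)
  qed auto
  have "(LINT x|lebesgue. \<theta> s x * G n x) \<le> (LINT x|lebesgue. G n x)" for n
    unfolding tr(1)
  proof (rule integral_le_of_nn_integral_le(2))
    have "(\<integral>\<^sup>+x. ennreal (indicator \<Omega> x * G n (\<phi> x s)) \<partial>lebesgue) \<le> (\<integral>\<^sup>+x. ennreal (G n (\<phi> x s)) \<partial>lebesgue)"
      using G(2) by (intro nn_integral_mono ennreal_leI) (auto split: split_indicator)
    also note tr(2)
    finally show "(\<integral>\<^sup>+x. ennreal (indicator \<Omega> x * G n (\<phi> x s)) \<partial>lebesgue) \<le> ennreal (LINT x|lebesgue. G n x)" .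
  qed (use G(2) in \<open>auto intro: Bochner_Integration.integral_nonneg\<close>)
  from LIMSEQ_le[OF l1 l3] this have "(LINT x|lebesgue. \<theta> s x * indicator C x) \<le> (LINT x|lebesgue. indicator C x)" by blast
  also have "\<dots> = measure lebesgue C" by simp
  finally show "(LINT x|lebesgue. \<theta> s x * indicator C x) \<le> measure lebesgue C" .
qed

text \<open>
  The lower bound holds because \<open>\<theta> s\<close> is the density of an image measure, the upper one because
  that measure is dominated by Lebesgue measure.
\<close>

lemma vort_range:
  assumes s: "0 \<le> s" "s \<le> T"
  shows "AE x in lebesgue. 0 \<le> \<theta> s x \<and> \<theta> s x \<le> 1"
proof -
  have m[measurable]: "\<theta> s \<in> borel_measurable lebesgue" using vort_integrable[OF s] by auto
  have 1: "AE x in lebesgue. 0 \<le> \<theta> s x"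
  proof (rule AE_nonneg_from_compact[OF m])
    fix C :: "(real^2) set" assume C: "compact C"
    show "integrable lebesgue (\<lambda>x. \<theta> s x * indicator C x)" by (rule pushforward_compact[OF s C])
    show "0 \<le> (LINT x|lebesgue. \<theta> s x * indicator C x)"
      unfolding pushforward_compact(2)[OF s C] by (intro Bochner_Integration.integral_nonneg) auto
  qed
  have 2: "AE x in lebesgue. 0 \<le> 1 - \<theta> s x"
  proof (rule AE_nonneg_from_compact)
    show "(\<lambda>x. 1 - \<theta> s x) \<in> borel_measurable lebesgue" by measurable
    fix C :: "(real^2) set" assume C: "compact C"
    have iC: "integrable lebesgue (indicator C :: real^2 \<Rightarrow> real)"
      using lmeasurable_compact[OF C] by (intro integrable_real_indicator) (auto simp: fmeasurable_def)
    have e: "(\<lambda>x. (1 - \<theta> s x) * indicator C x) = (\<lambda>x. indicator C x - \<theta> s x * indicator C x)" by (simp add: fun_eq_iff algebra_simps)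
    show "integrable lebesgue (\<lambda>x. (1 - \<theta> s x) * indicator C x)"
      unfolding e using iC pushforward_compact(1)[OF s C] by simp
    have "(LINT x|lebesgue. indicator C x - \<theta> s x * indicator C x) = (LINT x|lebesgue. indicator C x) - (LINT x|lebesgue. \<theta> s x * indicator C x)"
      by (rule Bochner_Integration.integral_diff[OF iC pushforward_compact(1)[OF s C]])
    moreover have "(LINT x|lebesgue. indicator C x) = measure lebesgue C" using C by (simp add: compact_imp_closed)
    ultimately show "0 \<le> (LINT x|lebesgue. (1 - \<theta> s x) * indicator C x)"
      unfolding e using pushforward_compact(3)[OF s C] by simp
  qed
  show ?thesis using 1 2 by eventually_elim simp
qed

lemma traj_norm_bound: "0 \<le> s \<Longrightarrow> s \<le> T \<Longrightarrow> norm (\<phi> x s) \<le> norm x + 3 * M * T"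
proof -
  assume s: "0 \<le> s" "s \<le> T"
  have "norm (\<phi> x s - \<phi> x 0) \<le> 3 * M * (s - 0)" by (rule traj_lipschitz) (use s in auto)
  also have "\<dots> \<le> 3 * M * T" using s M_nonneg by (intro mult_left_mono) auto
  finally show ?thesis using norm_triangle_sub[of "\<phi> x s" x] by (simp add: traj_0)
qed

lemma vort_support:
  assumes s: "0 \<le> s" "s \<le> T" and R: "\<Omega> \<subseteq> ball 0 R"
  shows "AE x in lebesgue. R + 3 * M * T < norm x \<longrightarrow> \<theta> s x = 0"
proof -
  let ?r = "R + 3 * M * T"
  have "AE x in lebesgue. x \<in> cball 0 (real n) - ball 0 ?r \<longrightarrow> \<theta> s x = 0" for n
  proof -
    let ?C = "cball 0 (real n) - ball (0::real^2) ?r"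
    have C: "compact ?C" by (intro compact_diff) auto
    have "(LINT x|lebesgue. \<theta> s x * indicator ?C x) = (LINT x|lebesgue. indicator \<Omega> x * indicator ?C (\<phi> x s))"
      by (rule pushforward_compact(2)[OF s C])
    also have "\<dots> = (LINT x|(lebesgue :: (real^2) measure). 0)"
    proof (rule Bochner_Integration.integral_cong[OF refl])
      fix x show "indicator \<Omega> x * indicator ?C (\<phi> x s) = (0::real)"
      proof (cases "x \<in> \<Omega>")
        case True
        then have "norm x < R" using R by auto
        then have "norm (\<phi> x s) < ?r" using traj_norm_bound[OF s, of x] by linarith
        then show ?thesis by simp
      qed simp
    qed
    finally have "(LINT x|lebesgue. \<theta> s x * indicator ?C x) = 0" by simp
    moreover have "AE x in lebesgue. 0 \<le> \<theta> s x * indicator ?C x" using vort_range[OF s] by eventually_elim (auto split: split_indicator)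
    ultimately have "AE x in lebesgue. \<theta> s x * indicator ?C x = 0"
      using integral_nonneg_eq_0_iff_AE[OF pushforward_compact(1)[OF s C]] by simp
    then show ?thesis by eventually_elim (auto split: split_indicator)
  qed
  then have "AE x in lebesgue. \<forall>n. x \<in> cball 0 (real n) - ball 0 ?r \<longrightarrow> \<theta> s x = 0"
    unfolding AE_all_countable by blast
  then show ?thesis
  proof eventually_elim
    case (elim x)
    obtain n where "norm x \<le> real n" using real_arch_simple by blast
    then show ?case using elim[rule_format, of n] by auto
  qed
qed

lemma vort_mass:
  assumes s: "0 \<le> s" "s \<le> T"
  shows "(LINT x|lebesgue. \<theta> s x) = measure lebesgue \<Omega>"
proof -
  obtain R where R: "\<Omega> \<subseteq> ball 0 R" using bounded_subset_ballD[OF bounded_\<Omega>] by metis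
  let ?C = "cball (0::real^2) (R + 3 * M * T)"
  have C: "compact ?C" by simp
  have [measurable]: "\<theta> s \<in> borel_measurable lebesgue" using vort_integrable[OF s] by auto
  have [measurable]: "?C \<in> sets lebesgue" by simp
  have "(LINT x|lebesgue. \<theta> s x) = (LINT x|lebesgue. \<theta> s x * indicator ?C x)"
  proof (rule integral_cong_AE)
    show "AE x in lebesgue. \<theta> s x = \<theta> s x * indicator ?C x"
      using vort_support[OF s R] by eventually_elim (auto split: split_indicator)
  qed measurable
  also have "\<dots> = (LINT x|lebesgue. indicator \<Omega> x * indicator ?C (\<phi> x s))" by (rule pushforward_compact(2)[OF s C])
  also have "\<dots> = (LINT x|lebesgue. indicator \<Omega> x)"
  proof (rule Bochner_Integration.integral_cong[OF refl])
    fix x show "indicator \<Omega> x * indicator ?C (\<phi> x s) = (indicator \<Omega> x :: real)"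
    proof (cases "x \<in> \<Omega>")
      case True
      then have "norm x < R" using R by auto
      then have "norm (\<phi> x s) \<le> R + 3 * M * T" using traj_norm_bound[OF s, of x] by linarith
      then show ?thesis using True by simp
    qed simp
  qed
  finally show ?thesis by simp
qed

lemma vort_moment_integrable:
  assumes s: "0 \<le> s" "s \<le> T"
  shows "integrable lebesgue (\<lambda>x. \<theta> s x * (x \<bullet> x))"
proof -
  obtain R where R: "\<Omega> \<subseteq> ball 0 R" using bounded_subset_ballD[OF bounded_\<Omega>] by metis
  let ?r = "R + 3 * M * T"
  have [measurable]: "\<theta> s \<in> borel_measurable lebesgue" using vort_integrable[OF s] by auto
  have xm[measurable]: "(\<lambda>x::real^2. x \<bullet> x) \<in> borel_measurable lebesgue" by (intro borel_lebesgue) measurable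
  show ?thesis
  proof (rule Bochner_Integration.integrable_bound[of lebesgue "\<lambda>x. \<theta> s x * ?r\<^sup>2"])
    show "AE x in lebesgue. norm (\<theta> s x * (x \<bullet> x)) \<le> norm (\<theta> s x * ?r\<^sup>2)"
      using vort_support[OF s R]
    proof eventually_elim
      case (elim x)
      show ?case
      proof (cases "?r < norm x")
        case False
        then have "(norm x)\<^sup>2 \<le> ?r\<^sup>2" by (intro power_mono) auto
        then show ?thesis by (simp add: abs_mult power2_norm_eq_inner mult_left_mono)
      qed (use elim in simp)
    qed
  qed (use vort_integrable[OF s] in auto)
qed

text \<open>
  The test function is \<open>|x|\<^sup>2\<close>, cut off outside the ball that contains the vorticity throughout the
  time interval. On that ball its gradient is exactly \<open>2 x\<close>, so the moment identity makes the increment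
  vanish.
\<close>

lemma vort_moment:
  assumes s: "0 \<le> s" "s \<le> T"
  shows "(LINT x|lebesgue. \<theta> s x * (x \<bullet> x)) = (LINT x|lebesgue. \<theta> 0 x * (x \<bullet> x))"
proof -
  obtain R0 where R0: "\<Omega> \<subseteq> ball 0 R0" using bounded_subset_ballD[OF bounded_\<Omega>] by metis
  define R where "R = max R0 0"
  have R: "\<Omega> \<subseteq> ball 0 R" using R0 by (auto simp: R_def)
  define r where "r = R + 3 * M * T"
  have r: "0 \<le> r" unfolding r_def R_def using M_nonneg T_pos by simp
  note supp = vort_support[OF _ _ R, folded r_def]
  \<comment> \<open>The step is flat for arguments at least 1, that is, for \<open>norm x \<le> r\<close>.\<close>
  define G where "G x = (x \<bullet> x) * smoothstep (r\<^sup>2 + 1 - x \<bullet> x)" for x :: "real^2"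
  define G' where "G' x = (2 * smoothstep (r\<^sup>2 + 1 - x \<bullet> x)) *\<^sub>R x - ((x \<bullet> x) * smoothstep' (r\<^sup>2 + 1 - x \<bullet> x) * 2) *\<^sub>R x" for x :: "real^2"
  have dG: "(G has_derivative (\<lambda>k. G' x \<bullet> k)) (at x)" for x
  proof -
    have 1: "((\<lambda>x::real^2. x \<bullet> x) has_derivative (\<lambda>k. 2 * (x \<bullet> k))) (at x)"
      by (rule has_derivative_eq_rhs[OF has_derivative_inner[OF has_derivative_ident has_derivative_ident]]) (simp add: inner_commute)
    have 2: "((\<lambda>x::real^2. r\<^sup>2 + 1 - x \<bullet> x) has_derivative (\<lambda>k. 0 - 2 * (x \<bullet> k))) (at x)"
      by (intro has_derivative_diff has_derivative_const 1)
    from has_derivative_mult[OF 1 has_derivative_compose[OF 2 DERIV_smoothstep[THEN has_field_derivative_imp_has_derivative]]]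
    show ?thesis unfolding G_def[abs_def]
      by (rule has_derivative_eq_rhs) (simp add: G'_def fun_eq_iff inner_diff_left algebra_simps)
  qed
  have css: "continuous_on UNIV smoothstep"
    by (rule DERIV_continuous_on[OF DERIV_smoothstep[THEN DERIV_subset]]) auto
  have cG': "continuous_on UNIV G'" unfolding G'_def
    by (intro continuous_intros continuous_on_compose2[OF css] continuous_on_compose2[OF continuous_smoothstep']) auto
  have in_ball: "G x = x \<bullet> x" "G' x = 2 *\<^sub>R x" if "norm x \<le> r" for x
  proof -
    have "(norm x)\<^sup>2 \<le> r\<^sup>2" using that by (intro power_mono) auto
    then have 1: "1 \<le> r\<^sup>2 + 1 - x \<bullet> x" by (simp add: power2_norm_eq_inner)
    then have "1 \<le> (r\<^sup>2 + 1 - x \<bullet> x)\<^sup>2" by simp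
    with 1 have "smoothstep' (r\<^sup>2 + 1 - x \<bullet> x) = 0" by (simp add: smoothstep'_def)
    with smoothstep_props(2)[OF 1] show "G x = x \<bullet> x" "G' x = 2 *\<^sub>R x" by (auto simp: G_def G'_def)
  qed
  have C1: "C1c G G'"
    unfolding C1c_def
  proof (intro conjI allI)
    show "\<exists>\<rho>. \<forall>x. \<rho> \<le> norm x \<longrightarrow> G x = 0"
    proof (intro exI[of _ "r + 1"] allI impI)
      fix x :: "real^2" assume "r + 1 \<le> norm x"
      then have "(r + 1)\<^sup>2 \<le> (norm x)\<^sup>2" using r by (intro power_mono) auto
      then have "r\<^sup>2 + 1 - x \<bullet> x \<le> 0" using r by (simp add: power2_norm_eq_inner power2_sum)
      then show "G x = 0" using smoothstep_props(1) by (simp add: G_def)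
    qed
  qed (use dG cG' in auto)
  have "\<bar>(LINT x|lebesgue. \<theta> s x * G x) - (LINT x|lebesgue. \<theta> 0 x * G x)\<bar> \<le> 0 * (s - 0)"
  proof (rule weak_increment_static[OF C1])
    show "\<bar>LINT x|lebesgue. \<theta> t x * (velocity \<theta> t x \<bullet> G' x)\<bar> \<le> 0" if t: "0 \<le> t" "t \<le> s" for t
    proof -
      have t0: "0 \<le> t" "t \<le> T" using t s by auto
      have mm: "\<theta> t \<in> borel_measurable lebesgue" using vort_integrable[OF t0] by auto
      have "(LINT x|lebesgue. \<theta> t x * (velocity \<theta> t x \<bullet> G' x)) = (LINT x|lebesgue. 2 * (\<theta> t x * (biot_savart (\<theta> t) x \<bullet> x)))"
      proof -
        have "AE x in lebesgue. \<theta> t x * (velocity \<theta> t x \<bullet> G' x) = 2 * (\<theta> t x * (biot_savart (\<theta> t) x \<bullet> x))"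
          using supp[OF t0]
        proof eventually_elim
          case (elim x) then show ?case using in_ball(2)[of x] by (cases "r < norm x") (auto simp: velocity_eq_biot_savart)
        qed
        moreover have "biot_savart (\<theta> t) \<in> borel_measurable lebesgue" by (rule biot_savart_measurable[OF mm])
        moreover have "G' \<in> borel_measurable lebesgue" "(\<lambda>x::real^2. x) \<in> borel_measurable lebesgue"
          by (auto intro!: borel_lebesgue borel_measurable_continuous_onI cG')
        ultimately show ?thesis using mm
          by (intro integral_cong_AE) (auto simp: velocity_eq_biot_savart intro!: borel_measurable_times borel_measurable_inner borel_measurable_const)
      qed
      also have "\<dots> = 0" using moment_identity[OF vort[OF t0] supp[OF t0] r] by simp
      finally show ?thesis by simp
    qed
  qed (use s in auto)
  then have e: "(LINT x|lebesgue. \<theta> s x * G x) = (LINT x|lebesgue. \<theta> 0 x * G x)" by simp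
  have "(LINT x|lebesgue. \<theta> t x * G x) = (LINT x|lebesgue. \<theta> t x * (x \<bullet> x))" if t: "0 \<le> t" "t \<le> T" for t
  proof (rule integral_cong_AE)
    have [measurable]: "\<theta> t \<in> borel_measurable lebesgue" using vort_integrable[OF t] by auto
    have "continuous_on UNIV G" by (rule has_derivative_continuous_on) (use dG in \<open>auto intro: has_derivative_at_withinI\<close>)
    then have [measurable]: "G \<in> borel_measurable lebesgue" by (intro borel_lebesgue borel_measurable_continuous_onI)
    have xm[measurable]: "(\<lambda>x::real^2. x \<bullet> x) \<in> borel_measurable lebesgue" by (intro borel_lebesgue) measurable
    show "(\<lambda>x. \<theta> t x * G x) \<in> borel_measurable lebesgue" "(\<lambda>x. \<theta> t x * (x \<bullet> x)) \<in> borel_measurable lebesgue" by measurable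
    show "AE x in lebesgue. \<theta> t x * G x = \<theta> t x * (x \<bullet> x)"
      using supp[OF t]
    proof eventually_elim
      case (elim x) then show ?case using in_ball(1)[of x] by (cases "r < norm x") auto
    qed
  qed
  from this[OF s] this[of 0] e show ?thesis using T_pos by simp
qed

text \<open>
  Mass and second moment are conserved, so the weighted distance to the disc keeps its initial value, which
  is at most \<open>(1 + R\<^sup>2) * \<delta>\<close>. The choice \<open>\<epsilon> = sqrt \<delta>\<close> balances the two terms of the previous estimate.
\<close>

lemma vort_stability:
  assumes s: "0 \<le> s" "s \<le> T" and R: "\<Omega> \<subseteq> ball 0 R" and \<delta>: "0 < \<delta>" "\<delta> \<le> 1"
    and m: "measure lebesgue (sym_diff (ball 0 1) \<Omega>) \<le> \<delta>"
  shows "(LINT x|lebesgue. \<bar>\<theta> s x - indicator (ball 0 1) x\<bar>) \<le> (2 * pi + 1 + R\<^sup>2) * sqrt \<delta>"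
proof -
  let ?D = "ball (0::real^2) 1"
  have iD: "integrable lebesgue (indicator ?D :: real^2 \<Rightarrow> real)"
    by (intro integrable_real_indicator) (auto simp: emeasure_ball_plane simp del: emeasure_completion)
  have i\<Omega>: "integrable lebesgue (indicator \<Omega> :: real^2 \<Rightarrow> real)" using \<Omega>_finite by (intro integrable_real_indicator) auto
  have xm[measurable]: "(\<lambda>x::real^2. x \<bullet> x) \<in> borel_measurable lebesgue" by (intro borel_lebesgue) measurable
  have ix: "integrable lebesgue (\<lambda>x. indicator A x * (x \<bullet> x))" if A: "integrable lebesgue (indicator A :: real^2 \<Rightarrow> real)" "A \<in> sets lebesgue" "A \<subseteq> ball 0 b" for A b
  proof (rule Bochner_Integration.integrable_bound[of lebesgue "\<lambda>x. indicator A x * b\<^sup>2"])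
    show "AE x in lebesgue. norm (indicator A x * (x \<bullet> x)) \<le> norm (indicator A x * b\<^sup>2)"
    proof (rule AE_I2)
      fix x show "norm (indicator A x * (x \<bullet> x)) \<le> norm (indicator A x * b\<^sup>2)"
      proof (cases "x \<in> A")
        case True
        then have "norm x \<le> b" using A(3) by auto
        then have "(norm x)\<^sup>2 \<le> b\<^sup>2" by (intro power_mono) auto
        then show ?thesis using True by (simp add: power2_norm_eq_inner)
      qed simp
    qed
    show "(\<lambda>x. indicator A x * (x \<bullet> x)) \<in> borel_measurable lebesgue" using A(2) by measurable
  qed (use A in auto)
  note iDx = ix[OF iD _ order_refl] and i\<Omega>x = ix[OF i\<Omega> \<Omega>_sets R]
  have ae0: "AE x in lebesgue. \<theta> 0 x = indicator \<Omega> x" using weak by (auto simp: euler_weak_solution_def)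
  have m0: "(LINT x|lebesgue. \<theta> 0 x * (x \<bullet> x)) = (LINT x|lebesgue. indicator \<Omega> x * (x \<bullet> x))"
  proof (rule integral_cong_AE)
    have [measurable]: "\<theta> 0 \<in> borel_measurable lebesgue" using vort_integrable[of 0] T_pos by auto
    show "(\<lambda>x. \<theta> 0 x * (x \<bullet> x)) \<in> borel_measurable lebesgue" by measurable
    show "(\<lambda>x. indicator \<Omega> x * (x \<bullet> x)) \<in> borel_measurable lebesgue" by measurable
    show "AE x in lebesgue. \<theta> 0 x * (x \<bullet> x) = indicator \<Omega> x * (x \<bullet> x)" using ae0 by eventually_elim simp
  qed
  have exp: "(LINT x|lebesgue. (f x - indicator ?D x) * (x \<bullet> x - 1)) = (LINT x|lebesgue. f x * (x \<bullet> x)) - (LINT x|lebesgue. f x) - ((LINT x|lebesgue. indicator ?D x * (x \<bullet> x)) - (LINT x|lebesgue. indicator ?D x))"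
    if "integrable lebesgue f" "integrable lebesgue (\<lambda>x. f x * (x \<bullet> x))" for f :: "real^2 \<Rightarrow> real"
  proof -
    have "(\<lambda>x. (f x - indicator ?D x) * (x \<bullet> x - 1)) = (\<lambda>x. (f x * (x \<bullet> x) - f x) - (indicator ?D x * (x \<bullet> x) - indicator ?D x))"
      by (simp add: fun_eq_iff algebra_simps)
    then show ?thesis using that iD iDx by (simp add: Bochner_Integration.integral_diff)
  qed
  have "(LINT x|lebesgue. (\<theta> s x - indicator ?D x) * (x \<bullet> x - 1)) = (LINT x|lebesgue. (indicator \<Omega> x - indicator ?D x) * (x \<bullet> x - 1))"
    unfolding exp[OF vort_integrable[OF s] vort_moment_integrable[OF s]] exp[OF i\<Omega> i\<Omega>x] vort_moment[OF s] m0 vort_mass[OF s] by simp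
  also have "\<dots> \<le> (LINT x|lebesgue. indicator (sym_diff ?D \<Omega>) x * (1 + R\<^sup>2))"
  proof (rule integral_mono)
    have "(\<lambda>x. (indicator \<Omega> x - indicator ?D x) * (x \<bullet> x - 1)) = (\<lambda>x. (indicator \<Omega> x * (x \<bullet> x) - indicator \<Omega> x) - (indicator ?D x * (x \<bullet> x) - indicator ?D x :: real))"
      by (simp add: fun_eq_iff algebra_simps)
    then show "integrable lebesgue (\<lambda>x. (indicator \<Omega> x - indicator ?D x :: real) * (x \<bullet> x - 1))" using i\<Omega> i\<Omega>x iD iDx by simp
    have "sym_diff ?D \<Omega> \<in> lmeasurable" using \<Omega>_lmeasurable by (intro fmeasurable.Un fmeasurable.Diff) auto
    then show "integrable lebesgue (\<lambda>x. indicator (sym_diff ?D \<Omega>) x * (1 + R\<^sup>2))"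
      by (intro integrable_mult_left integrable_real_indicator) (auto simp: fmeasurable_def)
    fix x :: "real^2"
    have "x \<bullet> x - 1 \<le> R\<^sup>2" if "x \<in> \<Omega>"
    proof -
      have "norm x \<le> R" using that R by auto
      then have "(norm x)\<^sup>2 \<le> R\<^sup>2" by (intro power_mono) auto
      then show ?thesis by (simp add: power2_norm_eq_inner)
    qed
    moreover have "- (x \<bullet> x) \<le> R\<^sup>2" by (rule order_trans[of _ 0]) auto
    ultimately show "(indicator \<Omega> x - indicator ?D x) * (x \<bullet> x - 1) \<le> indicator (sym_diff ?D \<Omega>) x * (1 + R\<^sup>2)"
      by (cases "x \<in> \<Omega>"; cases "x \<in> ?D") (simp_all add: indicator_def)
  qed
  also have "\<dots> = measure lebesgue (sym_diff ?D \<Omega>) * (1 + R\<^sup>2)" using \<Omega>_sets by simp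
  also have "\<dots> \<le> \<delta> * (1 + R\<^sup>2)" using m by (intro mult_right_mono) auto
  finally have k: "(LINT x|lebesgue. (\<theta> s x - indicator ?D x) * (x \<bullet> x - 1)) \<le> \<delta> * (1 + R\<^sup>2)" .
  have "(LINT x|lebesgue. \<bar>\<theta> s x - indicator ?D x\<bar>) \<le> 2 * pi * sqrt \<delta> + \<delta> * (1 + R\<^sup>2) / sqrt \<delta>"
    by (rule L1_distance_from_moment[OF vort_integrable[OF s] vort_range[OF s] vort_moment_integrable[OF s] k]) (use \<delta> in auto)
  also have "\<delta> * (1 + R\<^sup>2) / sqrt \<delta> = sqrt \<delta> * (1 + R\<^sup>2)"
    using \<delta> by (simp add: real_div_sqrt flip: times_divide_eq_left)
  finally show ?thesis by (simp add: algebra_simps)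
qed

end

section \<open>The velocity field of the disc\<close>

lemma norm_sq_ij:
  fixes y :: "real^2" and i j :: 2
  assumes "i \<noteq> j" shows "(norm y)\<^sup>2 = (y $ i)\<^sup>2 + (y $ j)\<^sup>2"
  unfolding power2_norm_eq_inner using assms exhaust_2[of i] exhaust_2[of j]
  by (auto simp: inner_vec_def sum_2 power2_eq_square)

definition coord_reflection :: "2 \<Rightarrow> real^2 \<Rightarrow> real^2 \<Rightarrow> real^2" where
  "coord_reflection i x y = (\<chi> k. if k = i then 2 * x $ i - y $ i else y $ k)"

lemma coord_reflection_measurable: "coord_reflection i x \<in> borel_measurable borel"
proof -
  have "continuous_on UNIV (\<lambda>y. if k = i then 2 * x $ i - y $ i else y $ k)" for k
    by (cases "k = i") (auto intro!: continuous_intros)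
  then have "continuous_on UNIV (coord_reflection i x)" unfolding coord_reflection_def[abs_def] by (intro continuous_on_vec_lambda) 
  then show ?thesis by (rule borel_measurable_continuous_onI)
qed

lemma lborel_distr_coord_reflection: "distr lborel borel (coord_reflection i x) = lborel"
proof -
  define c :: "real^2 \<Rightarrow> real" where "c b = (if b = axis i 1 then - 1 else 1)" for b
  have e: "coord_reflection i x = (\<lambda>y. axis i (2 * x $ i) + (\<Sum>j\<in>Basis. (c j * (y \<bullet> j)) *\<^sub>R j))"
  proof (rule ext, rule euclidean_eqI)
    fix y b :: "real^2" assume b: "b \<in> Basis"
    then obtain k where k: "b = axis k 1" by (auto simp: Basis_vec_def)
    have "(axis i (2 * x $ i) + (\<Sum>j\<in>Basis. (c j * (y \<bullet> j)) *\<^sub>R j)) \<bullet> b = axis i (2 * x $ i) \<bullet> b + c b * (y \<bullet> b)"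
      using b by (simp add: inner_add_left)
    then show "coord_reflection i x y \<bullet> b = (axis i (2 * x $ i) + (\<Sum>j\<in>Basis. (c j * (y \<bullet> j)) *\<^sub>R j)) \<bullet> b"
      by (auto simp: k inner_axis c_def coord_reflection_def axis_eq_axis) (auto simp: axis_def)
  qed
  have "lborel = density (distr lborel borel (\<lambda>y. axis i (2 * x $ i) + (\<Sum>j\<in>Basis. (c j * (y \<bullet> j)) *\<^sub>R j))) (\<lambda>_. (\<Prod>j\<in>Basis. \<bar>c j\<bar>))"
    by (rule lborel_affine_euclidean) (auto simp: c_def)
  also have "(\<Prod>j\<in>Basis. \<bar>c j\<bar>) = 1" by (intro prod.neutral) (auto simp: c_def)
  finally show ?thesis unfolding e[symmetric] by (simp add: density_1)
qed

text \<open>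
  Translates of the strip of width \<open>a\<close> along the \<open>i\<close>-th axis cover the strip of width \<open>n * a\<close>. For \<open>n * a\<close>
  between 1 and 2 the latter contains a box of area \<open>1/5\<close>, which bounds the area of the thin strip from below
  without describing its curved boundary.
\<close>

lemma strip_area:
  fixes i j :: 2 and a :: real
  assumes ij: "i \<noteq> j" and a: "0 < a" "a \<le> 1"
  defines "S \<equiv> \<lambda>b. {y::real^2. 1/4 \<le> y $ j \<and> y $ j \<le> 1/2 \<and> - sqrt (1 - (y $ j)\<^sup>2) < y $ i \<and> y $ i \<le> - sqrt (1 - (y $ j)\<^sup>2) + b}"
  shows "S a \<in> lmeasurable" "a / 10 \<le> measure lebesgue (S a)"
proof -
  have sets: "S b \<in> sets borel" for b unfolding S_def by measurable
  have bd: "bounded (S b)" for b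
  proof -
    have "norm y \<le> 3 + \<bar>b\<bar>" if "y \<in> S b" for y
    proof -
      have "(y $ j)\<^sup>2 \<le> 1" using that unfolding S_def by (auto intro!: power_le_one)
      then have "0 \<le> sqrt (1 - (y $ j)\<^sup>2)" "sqrt (1 - (y $ j)\<^sup>2) \<le> 1" by simp_all
      moreover have "- sqrt (1 - (y $ j)\<^sup>2) < y $ i" "y $ i \<le> - sqrt (1 - (y $ j)\<^sup>2) + b" "1/4 \<le> y $ j" "y $ j \<le> 1/2"
        using that unfolding S_def by auto
      ultimately have "\<bar>y $ i\<bar> \<le> 1 + \<bar>b\<bar>" "\<bar>y $ j\<bar> \<le> 1" by linarith+
      moreover have "norm y \<le> \<bar>y $ i\<bar> + \<bar>y $ j\<bar>"
        using norm_le_l1_cart[of y] ij exhaust_2[of i] exhaust_2[of j] by (auto simp: sum_2)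
      ultimately show ?thesis by linarith
    qed
    then show ?thesis by (auto simp: bounded_iff)
  qed
  have lm: "S b \<in> lmeasurable" for b
    using bounded_set_imp_lmeasurable[OF bd] sets[of b] by (simp add: sets_completionI_sets)
  show "S a \<in> lmeasurable" by (rule lm)
  have step: "measure lebesgue (S (real n * a)) \<le> real n * measure lebesgue (S a)" for n
  proof (induction n)
    case 0
    have "S 0 = {}" unfolding S_def by auto
    then show ?case by simp
  next
    case (Suc n)
    have "S (real (Suc n) * a) \<subseteq> S (real n * a) \<union> (+) (axis i (real n * a)) ` S a"
    proof
      fix y assume y: "y \<in> S (real (Suc n) * a)"
      show "y \<in> S (real n * a) \<union> (+) (axis i (real n * a)) ` S a"
      proof (cases "y \<in> S (real n * a)")
        case False
        have "y - axis i (real n * a) \<in> S a" using y False ij unfolding S_def by (auto simp: axis_def algebra_simps)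
        then have "y \<in> (+) (axis i (real n * a)) ` S a" by (intro image_eqI[of _ _ "y - axis i (real n * a)"]) auto
        then show ?thesis by blast
      qed simp
    qed
    then have "measure lebesgue (S (real (Suc n) * a)) \<le> measure lebesgue (S (real n * a) \<union> (+) (axis i (real n * a)) ` S a)"
      using lm by (intro measure_mono_fmeasurable fmeasurable.Un measurable_translation) auto
    also have "\<dots> \<le> measure lebesgue (S (real n * a)) + measure lebesgue ((+) (axis i (real n * a)) ` S a)"
      using lm by (intro measure_Un_le) (auto intro: fmeasurableD measurable_translation)
    also have "measure lebesgue ((+) (axis i (real n * a)) ` S a) = measure lebesgue (S a)" by (rule measure_translation)
    finally show ?case using Suc by (simp add: algebra_simps)
  qed
  obtain n where n: "1 / a \<le> real n" "real n < 1 / a + 1"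
  proof
    show "1 / a \<le> real (nat \<lceil>1 / a\<rceil>)" by (rule real_nat_ceiling_ge)
    show "real (nat \<lceil>1 / a\<rceil>) < 1 / a + 1" using a by (simp add: ceiling_correct of_nat_nat) linarith
  qed
  have na: "1 \<le> real n * a" "real n * a \<le> 2" using n a by (auto simp: field_simps)
  \<comment> \<open>The box lies to the right of the arc, since \<open>sqrt (1 - 1/4) > 4/5\<close>, and its right side is reached because \<open>n * a \<ge> 1\<close>.\<close>
  define l u :: "real^2" where "l = (\<chi> k. if k = i then - 4/5 else 1/4)" and "u = (\<chi> k. if k = i then 0 else 1/2)"
  have "cbox l u \<subseteq> S (real n * a)"
  proof
    fix y assume "y \<in> cbox l u"
    then have y: "- 4/5 \<le> y $ i" "y $ i \<le> 0" "1/4 \<le> y $ j" "y $ j \<le> 1/2"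
      using ij by (auto simp: mem_box_cart l_def u_def split: if_splits)
    have "(y $ j)\<^sup>2 \<le> (1/2)\<^sup>2" using y by (intro power_mono) auto
    then have "(4/5)\<^sup>2 < 1 - (y $ j)\<^sup>2" by (simp add: power2_eq_square)
    then have "4/5 < sqrt (1 - (y $ j)\<^sup>2)" by (rule real_less_rsqrt)
    moreover have "sqrt (1 - (y $ j)\<^sup>2) \<le> 1" by simp
    ultimately show "y \<in> S (real n * a)" unfolding S_def mem_Collect_eq using y na by (intro conjI; linarith)
  qed
  then have "measure lebesgue (cbox l u) \<le> measure lebesgue (S (real n * a))"
    using lm by (intro measure_mono_fmeasurable) auto
  moreover have "measure lebesgue (cbox l u) = 1/5"
  proof -
    have "l \<in> cbox l u" by (auto simp: mem_box_cart l_def u_def)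
    then have "measure lborel (cbox l u) = (\<Prod>k\<in>UNIV. u $ k - l $ k)" by (intro content_cbox_cart) auto
    also have "\<dots> = 1/5" using ij exhaust_2[of i] exhaust_2[of j] by (auto simp: UNIV_2 l_def u_def)
    finally show ?thesis by simp
  qed
  ultimately have "1/5 \<le> real n * measure lebesgue (S a)" using step[of n] by linarith
  then have "a * (1/5) \<le> (real n * a) * measure lebesgue (S a)" using a mult_left_mono[of "1/5" "real n * measure lebesgue (S a)" a] by (simp add: mult_ac)
  also have "\<dots> \<le> 2 * measure lebesgue (S a)" using na by (intro mult_right_mono) auto
  finally show "a / 10 \<le> measure lebesgue (S a)" by simp
qed

text \<open>
  Reflection in the line through \<open>x\<close> orthogonal to the \<open>i\<close>-th axis changes the sign of the kernel
  component. After symmetrisation the integrand is the kernel times the difference of the indicators of the disc and of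
  the reflected disc, which is nonnegative. On the strip, whose points leave the disc under the
  reflection, it is at least \<open>1/9\<close>.
\<close>

lemma disc_velocity_component:
  fixes i j :: 2 and x :: "real^2"
  assumes ij: "i \<noteq> j" and x: "norm x \<le> 1" "0 < x $ i"
    and int: "integrable lebesgue (\<lambda>y. indicator (ball 0 1) y * ((x - y) $ i / (norm (x - y))\<^sup>2))"
  shows "x $ i / 180 \<le> (LINT y|lebesgue. indicator (ball 0 1) y * ((x - y) $ i / (norm (x - y))\<^sup>2))"
proof -
  let ?D = "ball (0::real^2) 1"
  define d where "d y = (x - y) $ i / (norm (x - y))\<^sup>2" for y
  define h where "h y = indicator ?D y * d y" for y
  let ?T = "coord_reflection i x"
  have dm[measurable]: "d \<in> borel_measurable borel" unfolding d_def
    by (intro borel_measurable_divide borel_measurable_continuous_onI continuous_intros)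
  have hm[measurable]: "h \<in> borel_measurable borel" unfolding h_def
    by (intro borel_measurable_times borel_measurable_indicator dm) auto
  note Tm[measurable] = coord_reflection_measurable[of i x]
  have nT: "(norm (x - ?T y))\<^sup>2 = (norm (x - y))\<^sup>2" for y
  proof -
    have "(x - ?T y) $ i = - ((x - y) $ i)" "(x - ?T y) $ j = (x - y) $ j" using ij by (auto simp: coord_reflection_def)
    then show ?thesis unfolding norm_sq_ij[OF ij] by (simp only: power2_minus)
  qed
  have dT: "d (?T y) = - d y" for y
  proof -
    have "(x - ?T y) $ i = - ((x - y) $ i)" by (simp add: coord_reflection_def)
    then show ?thesis unfolding d_def nT by (simp only: minus_divide_left)
  qed
  have "integrable lebesgue h" using int unfolding h_def[abs_def] d_def .
  then have ih: "integrable lborel h" by (subst (asm) integrable_completion) simp_all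
  have ihT: "integrable lborel (\<lambda>y. h (?T y))"
    using integrable_distr_eq[of ?T lborel borel h] ih by (simp add: lborel_distr_coord_reflection)
  have I: "(LINT y|lborel. h (?T y)) = (LINT y|lborel. h y)"
    using integral_distr[of ?T lborel borel h] by (simp add: lborel_distr_coord_reflection)
  have "2 * (LINT y|lborel. h y) = (LINT y|lborel. h y + h (?T y))"
    using I ih ihT by simp
  define S where "S = {y::real^2. 1/4 \<le> y $ j \<and> y $ j \<le> 1/2 \<and> - sqrt (1 - (y $ j)\<^sup>2) < y $ i \<and> y $ i \<le> - sqrt (1 - (y $ j)\<^sup>2) + x $ i}"
  have xi: "x $ i \<le> 1" "\<bar>x $ j\<bar> \<le> 1" using component_le_norm_cart[of x i] component_le_norm_cart[of x j] x by auto
  note sa = strip_area[OF ij x(2) xi(1), folded S_def]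
  have pt: "indicator S y * (1/9::real) \<le> h y + h (?T y)" for y
  proof -
    have e: "h y + h (?T y) = (indicator ?D y - indicator ?D (?T y)) * d y"
      by (simp add: h_def dT algebra_simps)
    have nn: "(norm (?T y))\<^sup>2 - (norm y)\<^sup>2 = 4 * x $ i * (x - y) $ i"
    proof -
      have "?T y $ i = 2 * x $ i - y $ i" "?T y $ j = y $ j" using ij by (auto simp: coord_reflection_def)
      then have "(norm (?T y))\<^sup>2 = (2 * x $ i - y $ i)\<^sup>2 + (y $ j)\<^sup>2" by (simp only: norm_sq_ij[OF ij])
      moreover have "(norm y)\<^sup>2 = (y $ i)\<^sup>2 + (y $ j)\<^sup>2" by (rule norm_sq_ij[OF ij])
      moreover have "(2 * a - b)\<^sup>2 - b\<^sup>2 = 4 * a * (a - b)" for a b :: real by (simp add: power2_eq_square algebra_simps)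
      ultimately show ?thesis by simp
    qed
    have D: "(z \<in> ?D) = ((norm z)\<^sup>2 < 1)" for z
      by (simp add: abs_square_less_1)
    have pos: "0 \<le> h y + h (?T y)"
    proof (cases "0 \<le> (x - y) $ i")
      case True
      then have "0 \<le> 4 * x $ i * (x - y) $ i" using x(2) by (intro mult_nonneg_nonneg) auto
      then have "(norm y)\<^sup>2 \<le> (norm (?T y))\<^sup>2" using nn by linarith
      then have "norm y \<le> norm (?T y)" by (rule power2_le_imp_le) auto
      then have "0 \<le> indicator ?D y - (indicator ?D (?T y) :: real)" by (auto split: split_indicator)
      then show ?thesis unfolding e using True by (intro mult_nonneg_nonneg) (auto simp: d_def)
    next
      case False
      then have "4 * x $ i * (x - y) $ i \<le> 0" using x(2) by (intro mult_nonneg_nonpos) auto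
      then have "(norm (?T y))\<^sup>2 \<le> (norm y)\<^sup>2" using nn by linarith
      then have "norm (?T y) \<le> norm y" by (rule power2_le_imp_le) auto
      then have "indicator ?D y - (indicator ?D (?T y) :: real) \<le> 0" by (auto split: split_indicator)
      then show ?thesis unfolding e using False by (intro mult_nonpos_nonpos) (auto simp: d_def divide_nonpos_nonneg)
    qed
    show ?thesis
    proof (cases "y \<in> S")
      case False then show ?thesis using pos by simp
    next
      case True
      define s where "s = sqrt (1 - (y $ j)\<^sup>2)"
      have y: "1/4 \<le> y $ j" "y $ j \<le> 1/2" "- s < y $ i" "y $ i \<le> - s + x $ i" using True by (auto simp: S_def s_def)
      have "(y $ j)\<^sup>2 \<le> (1/2)\<^sup>2" using y by (intro power_mono) auto
      then have yj: "(y $ j)\<^sup>2 \<le> 1/4" by (simp add: power2_eq_square)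
      then have "(4/5)\<^sup>2 < 1 - (y $ j)\<^sup>2" by (simp add: power2_eq_square)
      then have s: "4/5 < s" unfolding s_def by (rule real_less_rsqrt)
      have s2: "s\<^sup>2 = 1 - (y $ j)\<^sup>2" using yj by (simp add: s_def)
      have s1: "s \<le> 1" by (simp add: s_def)
      have "\<bar>y $ i\<bar> < s" using y xi s by auto
      then have "\<bar>y $ i\<bar>\<^sup>2 < s\<^sup>2" by (intro power_strict_mono) auto
      then have "(y $ i)\<^sup>2 < s\<^sup>2" by simp
      then have yD: "y \<in> ?D" unfolding D norm_sq_ij[OF ij] using s2 by simp
      have "s \<le> 2 * x $ i - y $ i" using y x(2) by auto
      then have "s\<^sup>2 \<le> (2 * x $ i - y $ i)\<^sup>2" using s by (intro power_mono) auto
      then have TD: "?T y \<notin> ?D" unfolding D norm_sq_ij[OF ij] using s2 ij by (simp add: coord_reflection_def)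
      have num: "4/5 \<le> (x - y) $ i" "(x - y) $ i \<le> 2" using y s s1 xi by auto
      have "((x - y) $ i)\<^sup>2 \<le> 2\<^sup>2" using num by (intro power_mono) auto
      moreover have "\<bar>(x - y) $ j\<bar> \<le> 3/2" unfolding vector_minus_component using xi(2) y(1,2) by linarith
      then have "\<bar>(x - y) $ j\<bar>\<^sup>2 \<le> (3/2)\<^sup>2" by (intro power_mono) auto
      ultimately have den: "(norm (x - y))\<^sup>2 \<le> 36/5" unfolding norm_sq_ij[OF ij] by (simp add: power2_eq_square)
      have "0 < (x - y) $ i" using num by linarith
      then have "0 < (norm (x - y))\<^sup>2" by auto
      moreover have "1/9 * (norm (x - y))\<^sup>2 \<le> (x - y) $ i" using num den by linarith
      ultimately have "1/9 \<le> d y" unfolding d_def by (subst pos_le_divide_eq)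
      then show ?thesis unfolding e using yD TD True by simp
    qed
  qed
  have "measure lebesgue S / 9 = (LINT y|lborel. indicator S y * (1/9::real))"
  proof -
    have Sb: "S \<in> sets borel" unfolding S_def by measurable
    then show ?thesis by simp
  qed
  also have "\<dots> \<le> (LINT y|lborel. h y + h (?T y))"
  proof (rule integral_mono)
    have Sb: "S \<in> sets borel" unfolding S_def by measurable
    have "emeasure lborel S < \<infinity>" using sa(1) Sb by (simp add: fmeasurable_def)
    then show "integrable lborel (\<lambda>y. indicator S y * (1/9::real))"
      using Sb by (intro integrable_mult_left integrable_real_indicator) auto
    show "integrable lborel (\<lambda>y. h y + h (?T y))" using ih ihT by simp
  qed (rule pt)
  also have "\<dots> = 2 * (LINT y|lborel. h y)" using I ih ihT by simp
  finally have "x $ i / 180 \<le> (LINT y|lborel. h y)" using sa(2) by simp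
  also have "(LINT y|lborel. h y) = (LINT y|lebesgue. h y)" by (rule integral_completion[symmetric]) measurable
  finally show ?thesis by (simp add: h_def d_def)
qed

lemma disc_kernel_integrable:
  "integrable lebesgue (\<lambda>y. indicator (ball (0::real^2) 1) y * ((x - y) $ i / (norm (x - y))\<^sup>2))"
proof -
  let ?D = "ball (0::real^2) 1"
  have iD: "integrable lebesgue (indicator ?D :: real^2 \<Rightarrow> real)"
    by (intro integrable_real_indicator) (auto simp: emeasure_ball_plane simp del: emeasure_completion)
  have "integrable lebesgue (\<lambda>y. \<bar>indicator ?D y\<bar> / norm (x - y))"
    by (rule potential_bound(1)[OF iD order_refl _ zero_le_one zero_less_one]) (auto split: split_indicator)
  then show ?thesis
  proof (rule Bochner_Integration.integrable_bound)
    have "(\<lambda>y. (x - y) $ i / (norm (x - y))\<^sup>2) \<in> borel_measurable borel"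
      by (intro borel_measurable_divide borel_measurable_continuous_onI continuous_intros)
    then show "(\<lambda>y. indicator ?D y * ((x - y) $ i / (norm (x - y))\<^sup>2)) \<in> borel_measurable lebesgue"
      by (intro borel_measurable_times borel_measurable_indicator borel_lebesgue) auto
    show "AE y in lebesgue. norm (indicator ?D y * ((x - y) $ i / (norm (x - y))\<^sup>2)) \<le> norm (\<bar>indicator ?D y :: real\<bar> / norm (x - y))"
    proof (rule AE_I2)
      fix y
      have "\<bar>(x - y) $ i\<bar> / (norm (x - y))\<^sup>2 \<le> norm (x - y) / (norm (x - y))\<^sup>2"
        by (intro divide_right_mono component_le_norm_cart) auto
      also have "\<dots> = 1 / norm (x - y)" by (simp add: power2_eq_square)
      finally show "norm (indicator ?D y * ((x - y) $ i / (norm (x - y))\<^sup>2)) \<le> norm (\<bar>indicator ?D y :: real\<bar> / norm (x - y))"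
        by (simp split: split_indicator)
    qed
  qed
qed

text \<open>
  Up to a factor \<open>\<plusminus>1 / (2 * pi)\<close> and an exchange of coordinates, a component of the velocity of the disc.
\<close>

definition disc_integral :: "2 \<Rightarrow> real^2 \<Rightarrow> real" where
  "disc_integral i x = (LINT y|lebesgue. indicator (ball (0::real^2) 1) y * ((x - y) $ i / (norm (x - y))\<^sup>2))"

lemma disc_integral_reflect:
  fixes i j :: 2
  assumes ij: "i \<noteq> j"
  shows "disc_integral i (coord_reflection i 0 x) = - disc_integral i x"
proof -
  let ?D = "ball (0::real^2) 1" and ?T = "coord_reflection i 0"
  define h where "h x y = indicator ?D y * ((x - y) $ i / (norm (x - y))\<^sup>2)" for x y :: "real^2"
  have hm: "h x \<in> borel_measurable borel" for x unfolding h_def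
    by (intro borel_measurable_times borel_measurable_indicator borel_measurable_divide borel_measurable_continuous_onI continuous_intros) auto
  have e: "disc_integral i x = (LINT y|lborel. h x y)" for x
    unfolding disc_integral_def h_def[symmetric] by (rule integral_completion) (use hm in simp)
  have nT: "norm (?T y) = norm y" for y
  proof -
    have "(norm (?T y))\<^sup>2 = (norm y)\<^sup>2" unfolding norm_sq_ij[OF ij] using ij by (simp add: coord_reflection_def)
    then show ?thesis by (simp add: power2_eq_iff_nonneg)
  qed
  have d: "?T x - ?T y = ?T (x - y)" for y by (simp add: vec_eq_iff coord_reflection_def)
  have p: "h (?T x) (?T y) = - h x y" for y
  proof -
    have "?T (x - y) $ i = - ((x - y) $ i)" by (simp add: coord_reflection_def)
    moreover have "indicator ?D (?T y) = (indicator ?D y :: real)" by (simp add: indicator_def nT)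
    ultimately show ?thesis unfolding h_def d nT by (simp only: minus_divide_left[symmetric] mult_minus_right)
  qed
  have "(LINT y|lborel. h (?T x) y) = (LINT y|distr lborel borel ?T. h (?T x) y)" by (simp only: lborel_distr_coord_reflection)
  also have "\<dots> = (LINT y|lborel. h (?T x) (?T y))"
    by (rule integral_distr) (use coord_reflection_measurable hm in auto)
  also have "\<dots> = - (LINT y|lborel. h x y)" unfolding p by simp
  finally show ?thesis by (simp add: e)
qed

lemma disc_integral_lower:
  fixes i j :: 2
  assumes ij: "i \<noteq> j" and x: "norm x \<le> 1"
  shows "\<bar>x $ i\<bar> / 180 \<le> \<bar>disc_integral i x\<bar>"
proof -
  consider "0 < x $ i" | "x $ i = 0" | "x $ i < 0" by linarith
  then show ?thesis
  proof cases
    case 1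
    then show ?thesis using disc_velocity_component[OF ij x 1 disc_kernel_integrable] by (simp add: disc_integral_def)
  next
    case 3
    let ?x = "coord_reflection i 0 x"
    have xi: "?x $ i = - x $ i" by (simp add: coord_reflection_def)
    have "(norm ?x)\<^sup>2 = (norm x)\<^sup>2" unfolding norm_sq_ij[OF ij] using ij by (simp add: coord_reflection_def)
    then have n: "norm ?x \<le> 1" using x by (simp add: power2_eq_iff_nonneg)
    have p: "0 < ?x $ i" using 3 xi by simp
    from disc_velocity_component[OF ij n p disc_kernel_integrable] have "- x $ i / 180 \<le> disc_integral i ?x" unfolding xi disc_integral_def by simp
    then show ?thesis using 3 unfolding disc_integral_reflect[OF ij] by simp
  qed simp
qed

text \<open>
  The exact value is \<open>norm x / 2\<close>; a positive multiple of \<open>norm x\<close> is all that enters below. The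
  constant is \<open>180 * 8 * 2\<close>, with 8 bounding \<open>2 * pi\<close> and 2 the number of coordinates.
\<close>

lemma disc_velocity_lower:
  assumes x: "norm x \<le> 1"
  shows "norm x / 2880 \<le> norm (biot_savart (indicator (ball 0 1)) x)"
proof -
  let ?D = "ball (0::real^2) 1"
  let ?V = "biot_savart (indicator ?D) x"
  have iD: "integrable lebesgue (indicator ?D :: real^2 \<Rightarrow> real)"
    by (intro integrable_real_indicator) (auto simp: emeasure_ball_plane simp del: emeasure_completion)
  have iK: "integrable lebesgue (\<lambda>y. indicator ?D y *\<^sub>R biot_savart_kernel (x - y))"
    by (rule biot_savart_integrable[OF iD, of 1]) (auto split: split_indicator)
  have c: "?V $ k = (LINT y|lebesgue. (indicator ?D y *\<^sub>R biot_savart_kernel (x - y)) $ k)" for k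
    unfolding biot_savart_def using integral_bounded_linear[OF bounded_linear_vec_nth iK, of k] by simp
  have V1: "?V $ 1 = - disc_integral 2 x / (2 * pi)"
  proof -
    have "?V $ 1 = (LINT y|lebesgue. (- 1 / (2 * pi)) * (indicator ?D y * ((x - y) $ 2 / (norm (x - y))\<^sup>2)))"
      unfolding c by (intro Bochner_Integration.integral_cong refl) (simp add: biot_savart_kernel_def perp_component del: minus_diff_eq vector_minus_component)
    then show ?thesis unfolding integral_mult_right_zero disc_integral_def by simp
  qed
  have V2: "?V $ 2 = disc_integral 1 x / (2 * pi)"
  proof -
    have "?V $ 2 = (LINT y|lebesgue. (1 / (2 * pi)) * (indicator ?D y * ((x - y) $ 1 / (norm (x - y))\<^sup>2)))"
      unfolding c by (intro Bochner_Integration.integral_cong refl) (simp add: biot_savart_kernel_def perp_component del: minus_diff_eq vector_minus_component)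
    then show ?thesis unfolding integral_mult_right_zero disc_integral_def by simp
  qed
  have n1: "\<bar>disc_integral 2 x\<bar> \<le> 8 * norm ?V"
  proof -
    have "\<bar>disc_integral 2 x\<bar> = 2 * pi * \<bar>?V $ 1\<bar>" by (simp add: V1 abs_divide)
    also have "\<dots> \<le> 8 * norm ?V" using pi_less_4 component_le_norm_cart[of ?V 1] by (intro mult_mono) auto
    finally show ?thesis .
  qed
  have n2: "\<bar>disc_integral 1 x\<bar> \<le> 8 * norm ?V"
  proof -
    have "\<bar>disc_integral 1 x\<bar> = 2 * pi * \<bar>?V $ 2\<bar>" by (simp add: V2 abs_divide)
    also have "\<dots> \<le> 8 * norm ?V" using pi_less_4 component_le_norm_cart[of ?V 2] by (intro mult_mono) auto
    finally show ?thesis .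
  qed
  have "norm x \<le> \<bar>x $ 1\<bar> + \<bar>x $ 2\<bar>" using norm_le_l1_cart[of x] by (simp add: sum_2)
  moreover have "\<bar>x $ 1\<bar> / 180 \<le> \<bar>disc_integral 1 x\<bar>" "\<bar>x $ 2\<bar> / 180 \<le> \<bar>disc_integral 2 x\<bar>"
    by (rule disc_integral_lower[of 1 2, OF _ x], simp, rule disc_integral_lower[of 2 1, OF _ x], simp)
  ultimately show ?thesis using n1 n2 by linarith
qed

section \<open>Speed of the particles near the disc\<close>

lemma biot_savart_diff:
  assumes "bounded_vorticity M f" "bounded_vorticity M g"
  shows "biot_savart f x - biot_savart g x = biot_savart (\<lambda>y. f y - g y) x"
proof -
  have "integrable lebesgue (\<lambda>y. f y *\<^sub>R biot_savart_kernel (x - y))" "integrable lebesgue (\<lambda>y. g y *\<^sub>R biot_savart_kernel (x - y))"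
    using assms biot_savart_integrable unfolding bounded_vorticity_def by blast+
  then show ?thesis unfolding biot_savart_def by (simp add: scaleR_diff_left Bochner_Integration.integral_diff)
qed

context yudovich_flow begin

text \<open>
  The number \<open>d\<close> stands for \<open>\<delta> powr (1/4)\<close>. The \<open>L\<^sup>1\<close> distance to the disc is of order \<open>d\<^sup>2\<close>, so
  the velocities differ by a multiple of its square root \<open>d\<close>, uniformly in time and space.
\<close>

lemma speed_lower:
  assumes s: "0 \<le> s" "s \<le> T" and R: "\<Omega> \<subseteq> ball 0 R" and d: "0 < d" "d \<le> 1"
    and m: "measure lebesgue (sym_diff (ball 0 1) \<Omega>) \<le> d ^ 4" and x: "norm x \<le> 1"
  shows "norm x / 2880 - 3 * sqrt (9 + R\<^sup>2) * d \<le> norm (velocity \<theta> s x)"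
    and "(LINT x|lebesgue. \<bar>\<theta> s x - indicator (ball 0 1) x\<bar>) \<le> (9 + R\<^sup>2) * d\<^sup>2"
proof -
  let ?D = "ball (0::real^2) 1"
  have iD: "integrable lebesgue (indicator ?D :: real^2 \<Rightarrow> real)"
    by (intro integrable_real_indicator) (auto simp: emeasure_ball_plane simp del: emeasure_completion)
  have \<theta>i: "integrable lebesgue (\<theta> s)" by (rule vort_integrable[OF s])
  have sq: "sqrt (d ^ 4) = d\<^sup>2"
    using d by (intro real_sqrt_unique) (auto simp flip: power_mult)
  have "(LINT x|lebesgue. \<bar>\<theta> s x - indicator ?D x\<bar>) \<le> (2 * pi + 1 + R\<^sup>2) * sqrt (d ^ 4)"
    by (rule vort_stability[OF s R _ _ m]) (use d in \<open>auto intro: power_le_one\<close>)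
  also have "\<dots> \<le> (9 + R\<^sup>2) * d\<^sup>2" unfolding sq using pi_less_4 by (intro mult_right_mono) auto
  finally show L1: "(LINT x|lebesgue. \<bar>\<theta> s x - indicator ?D x\<bar>) \<le> (9 + R\<^sup>2) * d\<^sup>2" .
  define q where "q = sqrt (9 + R\<^sup>2) * d"
  have "0 < sqrt (9 + R\<^sup>2)" by (simp add: add_pos_nonneg)
  then have q: "0 < q" using d by (simp add: q_def)
  have q2: "(9 + R\<^sup>2) * d\<^sup>2 / q = q"
  proof -
    have "(9 + R\<^sup>2) * d\<^sup>2 = q * q" by (simp add: q_def power2_eq_square mult_ac flip: real_sqrt_mult)
    then show ?thesis using q by simp
  qed
  have "norm (biot_savart (\<lambda>y. \<theta> s y - indicator ?D y) x) \<le> (4 * pi * 1 * q + (9 + R\<^sup>2) * d\<^sup>2 / q) / (2 * pi)"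
  proof (rule biot_savart_bound_gen[OF _ L1 _ zero_le_one q])
    show "integrable lebesgue (\<lambda>y. \<theta> s y - indicator ?D y)" using \<theta>i iD by simp
    show "AE y in lebesgue. \<bar>\<theta> s y - indicator ?D y\<bar> \<le> 1"
      using vort_range[OF s] by eventually_elim (auto split: split_indicator)
  qed
  also have "\<dots> = (4 * pi + 1) * q / (2 * pi)" unfolding q2 by (simp add: algebra_simps)
  also have "\<dots> \<le> 3 * q"
  proof -
    have "(4 * pi + 1) * q \<le> (6 * pi) * q" using q pi_gt3 by (intro mult_right_mono) auto
    then show ?thesis by (simp add: pos_divide_le_eq mult_ac)
  qed
  finally have B: "norm (biot_savart (\<lambda>y. \<theta> s y - indicator ?D y) x) \<le> 3 * q" .
  have "biot_savart (\<theta> s) x - biot_savart (indicator ?D) x = biot_savart (\<lambda>y. \<theta> s y - indicator ?D y) x"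
  proof (rule biot_savart_diff)
    \<comment> \<open>The disc itself has mass \<open>pi\<close>, which may exceed \<open>M\<close>.\<close>
    define M' where "M' = max M (max 1 pi)"
    show "bounded_vorticity M' (\<theta> s)" using vort[OF s] unfolding bounded_vorticity_def M'_def by (auto elim!: eventually_mono)
    have "(LINT x|lebesgue. \<bar>indicator ?D x :: real\<bar>) = measure lebesgue ?D" by (simp add: abs_of_nonneg)
    also have "\<dots> = pi" by (subst circle_area_lebesgue) auto
    finally show "bounded_vorticity M' (indicator ?D)" using iD unfolding bounded_vorticity_def M'_def by (auto split: split_indicator intro!: AE_I2)
  qed
  then have "norm (biot_savart (indicator ?D) x) \<le> norm (velocity \<theta> s x) + 3 * q"
  proof -
    assume "biot_savart (\<theta> s) x - biot_savart (indicator ?D) x = biot_savart (\<lambda>y. \<theta> s y - indicator ?D y) x"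
    then have "biot_savart (indicator ?D) x = biot_savart (\<theta> s) x - biot_savart (\<lambda>y. \<theta> s y - indicator ?D y) x" by (simp add: algebra_simps)
    then show ?thesis
      using B norm_triangle_ineq4[of "biot_savart (\<theta> s) x" "biot_savart (\<lambda>y. \<theta> s y - indicator ?D y) x"] unfolding velocity_eq_biot_savart by simp
  qed
  then show "norm x / 2880 - 3 * sqrt (9 + R\<^sup>2) * d \<le> norm (velocity \<theta> s x)"
    using disc_velocity_lower[OF x] by (simp add: q_def mult_ac)
qed


section \<open>Travel distance\<close>

text \<open>
  Time is projected to the window, so that the flow becomes continuous in both variables on the whole space.
\<close>

definition clamped_flow :: "real \<Rightarrow> real^2 \<Rightarrow> real^2" where
  "clamped_flow t x = \<phi> x (min (max t 0) T)"

lemma clamped_flow_continuous: "continuous_on UNIV (\<lambda>(t, x). clamped_flow t x)"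
  unfolding continuous_on_iff
proof (intro ballI allI impI)
  fix z :: "real \<times> (real^2)" and e :: real assume e: "0 < e"
  obtain t0 x0 where z: "z = (t0, x0)" by (cases z)
  define c where "c t = min (max t 0) T" for t
  have c: "0 \<le> c t" "c t \<le> T" for t using T_pos by (auto simp: c_def)
  have cl: "\<bar>c t - c t'\<bar> \<le> \<bar>t - t'\<bar>" for t t' unfolding c_def using T_pos by linarith
  obtain d1 where d1: "0 < d1" "\<And>x. dist x x0 < d1 \<Longrightarrow> dist (\<phi> x (c t0)) (\<phi> x0 (c t0)) < e / 2"
  proof -
    have "\<exists>d1>0. \<forall>x\<in>UNIV. dist x x0 < d1 \<longrightarrow> dist (\<phi> x (c t0)) (\<phi> x0 (c t0)) < e / 2"
      using flow_continuous[OF c[of t0], unfolded continuous_on_iff, rule_format, of x0 "e / 2"] e by simp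
    then show ?thesis using that by blast
  qed
  define d where "d = min d1 (e / (2 * (3 * M)))"
  have M: "0 < 3 * M" using M_ge_1 by simp
  have d: "0 < d" using d1 e M by (simp add: d_def)
  have lip: "norm (\<phi> x (c t) - \<phi> x (c t')) \<le> 3 * M * \<bar>t - t'\<bar>" for x t t'
  proof -
    have "norm (\<phi> x (c t) - \<phi> x (c t')) \<le> 3 * M * \<bar>c t - c t'\<bar>"
    proof (cases "c t' \<le> c t")
      case True then show ?thesis using traj_lipschitz[OF c(1) True c(2)] by simp
    next
      case False
      then have "norm (\<phi> x (c t') - \<phi> x (c t)) \<le> 3 * M * (c t' - c t)" by (intro traj_lipschitz c) simp
      then show ?thesis using False by (simp add: norm_minus_commute)
    qed
    also have "\<dots> \<le> 3 * M * \<bar>t - t'\<bar>" using M cl by (intro mult_left_mono) auto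
    finally show ?thesis .
  qed
  show "\<exists>d>0. \<forall>z'\<in>UNIV. dist z' z < d \<longrightarrow> dist (case z' of (t, x) \<Rightarrow> clamped_flow t x) (case z of (t, x) \<Rightarrow> clamped_flow t x) < e"
  proof (intro exI[of _ d] conjI ballI impI d)
    fix z' :: "real \<times> (real^2)" assume zz: "dist z' z < d"
    obtain t x where z': "z' = (t, x)" by (cases z')
    have t: "\<bar>t - t0\<bar> < d" and x: "dist x x0 < d"
      using zz dist_fst_le[of z' z] dist_snd_le[of z' z] by (auto simp: z z' dist_real_def)
    have "3 * M * \<bar>t - t0\<bar> \<le> 3 * M * (e / (2 * (3 * M)))" using t M by (intro mult_left_mono) (auto simp: d_def)
    also have "\<dots> = e / 2" using M by simp
    finally have "dist (\<phi> x (c t)) (\<phi> x (c t0)) \<le> e / 2" using lip[of x t t0] by (simp add: dist_norm)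
    moreover have "dist (\<phi> x (c t0)) (\<phi> x0 (c t0)) < e / 2" using d1 x by (simp add: d_def)
    ultimately have "dist (\<phi> x (c t)) (\<phi> x0 (c t0)) < e" using dist_triangle[of "\<phi> x (c t)" "\<phi> x0 (c t0)" "\<phi> x (c t0)"] by linarith
    then show "dist (case z' of (t, x) \<Rightarrow> clamped_flow t x) (case z of (t, x) \<Rightarrow> clamped_flow t x) < e"
      by (simp add: z z' clamped_flow_def c_def)
  qed
qed

lemma clamped_flow_measurable: "(\<lambda>(t, x). clamped_flow t x) \<in> borel_measurable (borel \<Otimes>\<^sub>M borel)"
  using borel_measurable_continuous_onI[OF clamped_flow_continuous] by (simp add: borel_prod)

text \<open>
  The speed along trajectories is a limit of difference quotients of the continuous flow, and is thereby
  jointly measurable without any regularity of the velocity in time.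
\<close>

lemma path_velocity_measurable:
  "(\<lambda>(t, x). indicator {0<..<T} t *\<^sub>R velocity \<theta> t (\<phi> x t)) \<in> borel_measurable (borel \<Otimes>\<^sub>M borel)"
proof (rule borel_measurable_LIMSEQ_metric)
  fix n
  note clamped_flow_measurable[measurable]
  show "(\<lambda>(t, x). indicator {0<..<T} t *\<^sub>R (real (Suc n) *\<^sub>R (clamped_flow (t + inverse (real (Suc n))) x - clamped_flow t x))) \<in> borel_measurable (borel \<Otimes>\<^sub>M borel)"
    by measurable
next
  fix z :: "real \<times> (real^2)"
  obtain t x where z: "z = (t, x)" by (cases z)
  show "(\<lambda>n. case z of (t, x) \<Rightarrow> indicator {0<..<T} t *\<^sub>R (real (Suc n) *\<^sub>R (clamped_flow (t + inverse (real (Suc n))) x - clamped_flow t x)))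
     \<longlonglongrightarrow> (case z of (t, x) \<Rightarrow> indicator {0<..<T} t *\<^sub>R velocity \<theta> t (\<phi> x t))"
  proof (cases "0 < t \<and> t < T")
    case True
    have "((\<lambda>h. (\<phi> x (t + h) - \<phi> x t) /\<^sub>R h) \<longlongrightarrow> velocity \<theta> t (\<phi> x t)) (at 0)"
    proof (rule LIM_zero_cancel, rule tendsto_norm_zero_cancel)
      let ?v = "velocity \<theta> t (\<phi> x t)"
      have "((\<lambda>h. norm (\<phi> x (t + h) - \<phi> x t - h *\<^sub>R ?v) / norm h) \<longlongrightarrow> 0) (at 0)"
        using traj_deriv[of t x] True unfolding has_vector_derivative_def has_derivative_at by blast
      then show "((\<lambda>h. norm ((\<phi> x (t + h) - \<phi> x t) /\<^sub>R h - ?v)) \<longlongrightarrow> 0) (at 0)"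
      proof (rule Lim_transform_eventually)
        have "norm (\<phi> x (t + h) - \<phi> x t - h *\<^sub>R ?v) / norm h = norm ((\<phi> x (t + h) - \<phi> x t) /\<^sub>R h - ?v)" if "h \<noteq> 0" for h
        proof -
          have "(\<phi> x (t + h) - \<phi> x t) /\<^sub>R h - ?v = inverse h *\<^sub>R (\<phi> x (t + h) - \<phi> x t - h *\<^sub>R ?v)"
            using that by (simp add: scaleR_diff_right)
          then show ?thesis by (simp add: divide_inverse_commute abs_inverse)
        qed
        then show "\<forall>\<^sub>F h in at 0. norm (\<phi> x (t + h) - \<phi> x t - h *\<^sub>R ?v) / norm h = norm ((\<phi> x (t + h) - \<phi> x t) /\<^sub>R h - ?v)"
          unfolding eventually_at_filter by (intro always_eventually) blast
      qed
    qed
    moreover have "filterlim (\<lambda>n. inverse (real (Suc n))) (at 0) sequentially"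
      unfolding filterlim_at using LIMSEQ_inverse_real_of_nat by auto
    ultimately have l: "(\<lambda>n. (\<phi> x (t + inverse (real (Suc n))) - \<phi> x t) /\<^sub>R inverse (real (Suc n))) \<longlonglongrightarrow> velocity \<theta> t (\<phi> x t)"
      by (rule filterlim_compose)
    have "\<forall>\<^sub>F n in sequentially. inverse (real (Suc n)) < T - t"
      using LIMSEQ_inverse_real_of_nat True by (intro order_tendstoD) auto
    then have "\<forall>\<^sub>F n in sequentially. (\<phi> x (t + inverse (real (Suc n))) - \<phi> x t) /\<^sub>R inverse (real (Suc n))
       = real (Suc n) *\<^sub>R (clamped_flow (t + inverse (real (Suc n))) x - clamped_flow t x)"
    proof eventually_elim
      case (elim n)
      have "0 < inverse (real (Suc n))" by simp
      then have "0 \<le> t + inverse (real (Suc n))" using True by linarith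
      moreover have "t + inverse (real (Suc n)) \<le> T" using elim by simp
      ultimately show ?case using True by (simp add: clamped_flow_def)
    qed
    from Lim_transform_eventually[OF l this] show ?thesis using True by (simp add: z)
  next
    case False then show ?thesis by (auto simp: z)
  qed
qed

lemma travel_distance_eq:
  "travel_distance (velocity \<theta>) \<phi> x T = (LINT t|lborel. norm (indicator {0<..<T} t *\<^sub>R velocity \<theta> t (\<phi> x t)))"
proof -
  let ?f = "\<lambda>t. norm (indicator {0<..<T} t *\<^sub>R velocity \<theta> t (\<phi> x t))"
  have m: "?f \<in> borel_measurable borel"
  proof -
    have "(\<lambda>t. indicator {0<..<T} t *\<^sub>R velocity \<theta> t (\<phi> x t)) \<in> borel_measurable borel"
      using measurable_compose[OF measurable_Pair2' path_velocity_measurable, of x] by simp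
    then show ?thesis by measurable
  qed
  have n: "AE t in lebesgue. t \<noteq> 0 \<and> t \<noteq> T"
    using AE_completion[OF AE_lborel_singleton[of "0::real"]] AE_completion[OF AE_lborel_singleton[of T]] by eventually_elim simp
  have ml: "?f \<in> borel_measurable lebesgue" by (rule borel_lebesgue[OF m])
  have e: "AE t in lebesgue. ?f t = indicator {0..T} t *\<^sub>R norm (velocity \<theta> t (\<phi> x t))"
    using n by eventually_elim (auto split: split_indicator)
  have "travel_distance (velocity \<theta>) \<phi> x T = (LINT t|lebesgue. indicator {0..T} t *\<^sub>R norm (velocity \<theta> t (\<phi> x t)))"
    by (simp add: travel_distance_def set_lebesgue_integral_def)
  also have "\<dots> = (LINT t|lebesgue. ?f t)"
    using e by (intro integral_cong_AE borel_measurable_AE[OF ml e] ml) (auto elim!: eventually_mono)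
  also have "\<dots> = (LINT t|lborel. ?f t)" by (rule integral_completion) (use m in simp)
  finally show ?thesis .
qed

lemma travel_distance_measurable: "(\<lambda>x. travel_distance (velocity \<theta>) \<phi> x T) \<in> borel_measurable borel"
proof -
  note path_velocity_measurable[measurable]
  have "(\<lambda>x. LINT t|lborel. (\<lambda>(t, x). norm (indicator {0<..<T} t *\<^sub>R velocity \<theta> t (\<phi> x t))) (t, x)) \<in> borel_measurable borel"
  proof (rule lborel.borel_measurable_lebesgue_integral)
    have "(\<lambda>z. norm ((\<lambda>(t, x). indicator {0<..<T} t *\<^sub>R velocity \<theta> t (\<phi> x t)) (snd z, fst z))) \<in> borel_measurable (borel \<Otimes>\<^sub>M lborel)"
      by measurable
    then show "(\<lambda>(x, t). (\<lambda>(t, x). norm (indicator {0<..<T} t *\<^sub>R velocity \<theta> t (\<phi> x t))) (t, x)) \<in> borel_measurable (borel \<Otimes>\<^sub>M lborel)"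
      by (simp add: case_prod_beta')
  qed
  then show ?thesis by (simp add: travel_distance_eq)
qed

text \<open>
  Outside the annulus, the vorticity lies either in the small disc of area \<open>pi * r\<^sup>2\<close> or outside
  the unit disc, where it contributes to the \<open>L\<^sup>1\<close> distance.
\<close>

lemma vort_in_annulus:
  assumes s: "0 \<le> s" "s \<le> T" and r: "0 \<le> r"
    and L1: "(LINT x|lebesgue. \<bar>\<theta> s x - indicator (ball 0 1) x\<bar>) \<le> \<eta>"
  shows "measure lebesgue \<Omega> - (pi * r\<^sup>2 + \<eta>) \<le> (LINT x|lebesgue. indicator \<Omega> x * indicator (cball 0 1 - ball 0 r) (\<phi> x s))"
proof -
  let ?D = "ball (0::real^2) 1" and ?C = "cball (0::real^2) 1 - ball 0 r"
  have C: "compact ?C" by (intro compact_diff) auto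
  have iD: "integrable lebesgue (indicator ?D :: real^2 \<Rightarrow> real)" "integrable lebesgue (indicator (ball 0 r) :: real^2 \<Rightarrow> real)"
    using r by (auto intro!: integrable_real_indicator simp: emeasure_ball_plane simp del: emeasure_completion)
  have \<theta>i: "integrable lebesgue (\<theta> s)" by (rule vort_integrable[OF s])
  note p = pushforward_compact[OF s C]
  have "measure lebesgue \<Omega> - (LINT x|lebesgue. \<theta> s x * indicator ?C x) = (LINT x|lebesgue. \<theta> s x - \<theta> s x * indicator ?C x)"
    using \<theta>i p(1) vort_mass[OF s] by simp
  also have "\<dots> \<le> (LINT x|lebesgue. indicator (ball 0 r) x + \<bar>\<theta> s x - indicator ?D x\<bar>)"
  proof (rule integral_mono_AE)
    show "integrable lebesgue (\<lambda>x. \<theta> s x - \<theta> s x * indicator ?C x)" using \<theta>i p(1) by simp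
    show "integrable lebesgue (\<lambda>x. indicator (ball 0 r) x + \<bar>\<theta> s x - indicator ?D x\<bar>)" using iD \<theta>i by simp
    show "AE x in lebesgue. \<theta> s x - \<theta> s x * indicator ?C x \<le> indicator (ball 0 r) x + \<bar>\<theta> s x - indicator ?D x\<bar>"
      using vort_range[OF s]
    proof eventually_elim
      case (elim x)
      show ?case
      proof (cases "x \<in> ?C")
        case True then show ?thesis by simp
      next
        case False
        then consider "norm x < r" | "1 < norm x" by fastforce
        then show ?thesis using elim False by cases (auto split: split_indicator)
      qed
    qed
  qed
  also have "\<dots> = (LINT x|lebesgue. indicator (ball (0::real^2) r) x) + (LINT x|lebesgue. \<bar>\<theta> s x - indicator ?D x\<bar>)"
    by (rule Bochner_Integration.integral_add) (use iD \<theta>i in auto)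
  also have "(LINT x|lebesgue. indicator (ball (0::real^2) r) x) = pi * r\<^sup>2"
    using circle_area_lebesgue[OF r, of 0] by simp
  finally show ?thesis unfolding p(2) using L1 by linarith
qed

text \<open>
  By \<open>speed_lower\<close>, \<open>K\<close> is large enough for all particles in the annulus \<open>K * d \<le> |x| \<le> 1\<close> to have speed
  at least \<open>d\<close>. At each time all but \<open>\<kappa>\<close>, of order \<open>d\<^sup>2\<close>, of the patch is in the annulus; integrating over time and
  exchanging the integrals, all but \<open>2 * \<kappa>\<close> of the particles spend at least half of the time there.
\<close>

lemma most_particles_travel:
  assumes R: "\<Omega> \<subseteq> ball 0 R" and d: "0 < d" "d \<le> 1"
    and m: "measure lebesgue (sym_diff (ball 0 1) \<Omega>) \<le> d ^ 4"
    and K: "K = 2880 * (1 + 3 * sqrt (9 + R\<^sup>2))"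
  defines "H \<equiv> {x \<in> \<Omega>. d / 2 \<le> travel_distance (velocity \<theta>) \<phi> x T / T}"
  shows "H \<in> sets lebesgue" "measure lebesgue \<Omega> - 2 * (pi * K\<^sup>2 + (9 + R\<^sup>2)) * d \<le> measure lebesgue H"
proof -
  let ?r = "K * d"
  let ?C = "cball (0::real^2) 1 - ball 0 ?r"
  have K0: "0 \<le> K" unfolding K by simp
  have r0: "0 \<le> ?r" using K0 d by simp
  define \<kappa> where "\<kappa> = pi * ?r\<^sup>2 + (9 + R\<^sup>2) * d\<^sup>2"
  have Ob: "\<Omega> \<in> sets borel" using open_\<Omega> by simp
  have Hb: "H \<in> sets borel"
  proof -
    have "{x \<in> space borel. d / 2 \<le> travel_distance (velocity \<theta>) \<phi> x T / T} \<in> sets borel"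
      by (intro borel_measurable_le borel_measurable_const borel_measurable_divide travel_distance_measurable)
    then have "\<Omega> \<inter> {x. d / 2 \<le> travel_distance (velocity \<theta>) \<phi> x T / T} \<in> sets borel" using Ob by auto
    then show ?thesis by (simp add: H_def Int_def)
  qed
  then show Hs: "H \<in> sets lebesgue" by (simp add: sets_completionI_sets)
  have in_C: "measure lebesgue \<Omega> - \<kappa> \<le> (LINT x|lebesgue. indicator \<Omega> x * indicator ?C (\<phi> x s))" if s: "0 \<le> s" "s \<le> T" for s
    unfolding \<kappa>_def by (rule vort_in_annulus[OF s r0 speed_lower(2)[OF s R d m, of 0]]) simp
  have speed: "d * indicator ?C (\<phi> x s) \<le> norm (velocity \<theta> s (\<phi> x s))" if s: "0 \<le> s" "s \<le> T" for s x
  proof (cases "\<phi> x s \<in> ?C")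
    case True
    then have n: "norm (\<phi> x s) \<le> 1" "?r \<le> norm (\<phi> x s)" by auto
    have "d = ?r / 2880 - 3 * sqrt (9 + R\<^sup>2) * d" by (simp add: K algebra_simps)
    also have "\<dots> \<le> norm (velocity \<theta> s (\<phi> x s))" using speed_lower(1)[OF s R d m n(1)] n(2) by linarith
    finally show ?thesis using True by simp
  qed simp
  define b where "b z = (indicator ?C (clamped_flow (fst z) (snd z)) :: real)" for z
  have bm[measurable]: "b \<in> borel_measurable (borel \<Otimes>\<^sub>M borel)"
  proof -
    have [measurable]: "(\<lambda>z. clamped_flow (fst z) (snd z)) \<in> borel_measurable (borel \<Otimes>\<^sub>M borel)"
      using clamped_flow_measurable by (simp add: case_prod_beta')
    have "?C \<in> sets borel" by auto
    then have "(indicator ?C :: real^2 \<Rightarrow> real) \<in> borel_measurable borel" by (rule borel_measurable_indicator)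
    from measurable_compose[OF _ this, of "\<lambda>z. clamped_flow (fst z) (snd z)"] show ?thesis unfolding b_def[abs_def] by simp
  qed
  have iT: "integrable lborel (indicator {0<..<T} :: real \<Rightarrow> real)" using T_pos by (intro integrable_real_indicator) auto
  have i\<Omega>: "integrable lborel (indicator \<Omega> :: real^2 \<Rightarrow> real)"
    using \<Omega>_finite Ob by (intro integrable_real_indicator) auto
  have bb: "\<bar>b z\<bar> \<le> 1" for z by (simp add: b_def)
  let ?S = "\<lambda>t x. indicator {0<..<T} t * indicator \<Omega> x * b (t, x)"
  have iS: "integrable (lborel \<Otimes>\<^sub>M lborel) (\<lambda>(t, x). ?S t x)"
    by (rule integrable_bounded_product[OF iT i\<Omega> bm bb])
  define w where "w x = (LINT t|lborel. indicator {0<..<T} t * b (t, x))" for x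
  have bt: "(\<lambda>t. b (t, x)) \<in> borel_measurable borel" for x
    using measurable_compose[OF measurable_Pair2' bm, of x] by simp
  have iw: "integrable lborel (\<lambda>t. indicator {0<..<T} t * b (t, x))" for x
    by (rule Bochner_Integration.integrable_bound[OF iT]) (use bt bb in \<open>auto split: split_indicator\<close>)
  have wm[measurable]: "w \<in> borel_measurable borel" unfolding w_def[abs_def]
  proof (rule lborel.borel_measurable_lebesgue_integral)
    show "(\<lambda>(x, t). indicator {0<..<T} t * b (t, x)) \<in> borel_measurable (borel \<Otimes>\<^sub>M lborel)" by measurable
  qed
  have wT: "w x \<le> T" for x
  proof -
    have "w x \<le> (LINT t|lborel. indicator {0<..<T} t)"
      unfolding w_def using iw iT by (intro integral_mono) (auto simp: b_def split: split_indicator)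
    then show ?thesis using T_pos by simp
  qed
  have w0: "0 \<le> w x" for x unfolding w_def by (intro Bochner_Integration.integral_nonneg) (auto simp: b_def)
  have travel: "d * w x \<le> travel_distance (velocity \<theta>) \<phi> x T" for x
  proof -
    have "d * w x = (LINT t|lborel. d * (indicator {0<..<T} t * b (t, x)))" by (simp add: w_def)
    also have "\<dots> \<le> (LINT t|lborel. norm (indicator {0<..<T} t *\<^sub>R velocity \<theta> t (\<phi> x t)))"
    proof (rule integral_mono)
      show "integrable lborel (\<lambda>t. d * (indicator {0<..<T} t * b (t, x)))" using iw by simp
      have "(\<lambda>t. indicator {0<..<T} t *\<^sub>R velocity \<theta> t (\<phi> x t)) \<in> borel_measurable borel"
        using measurable_compose[OF measurable_Pair2' path_velocity_measurable, of x] by simp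
      then have vm: "(\<lambda>t. norm (indicator {0<..<T} t *\<^sub>R velocity \<theta> t (\<phi> x t))) \<in> borel_measurable lborel"
        unfolding measurable_lborel2 by (rule measurable_compose) (rule borel_measurable_norm)
      show "integrable lborel (\<lambda>t. norm (indicator {0<..<T} t *\<^sub>R velocity \<theta> t (\<phi> x t)))"
      proof (rule Bochner_Integration.integrable_bound[of lborel "\<lambda>t. indicator {0<..<T} t * (3 * M)"])
        show "AE t in lborel. norm (norm (indicator {0<..<T} t *\<^sub>R velocity \<theta> t (\<phi> x t))) \<le> norm (indicator {0<..<T} t * (3 * M))"
          using velocity_bound M_nonneg by (intro AE_I2) (auto split: split_indicator)
      qed (use iT vm in auto)
      show "d * (indicator {0<..<T} t * b (t, x)) \<le> norm (indicator {0<..<T} t *\<^sub>R velocity \<theta> t (\<phi> x t))" for t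
        using speed[of t x] by (auto simp: b_def clamped_flow_def split: split_indicator)
    qed
    finally show ?thesis by (simp add: travel_distance_eq)
  qed
  have total: "T * (measure lebesgue \<Omega> - \<kappa>) \<le> (LINT x|lborel. indicator \<Omega> x * w x)"
  proof -
    have "T * (measure lebesgue \<Omega> - \<kappa>) = (LINT t|lborel. indicator {0<..<T} t * (measure lebesgue \<Omega> - \<kappa>))" using T_pos by simp
    also have "\<dots> \<le> (LINT t|lborel. LINT x|lborel. ?S t x)"
    proof (rule integral_mono)
      show "integrable lborel (\<lambda>t. indicator {0<..<T} t * (measure lebesgue \<Omega> - \<kappa>))" using iT by simp
      show "integrable lborel (\<lambda>t. LINT x|lborel. ?S t x)" using lborel_pair.integrable_fst[OF iS] .
      fix t
      show "indicator {0<..<T} t * (measure lebesgue \<Omega> - \<kappa>) \<le> (LINT x|lborel. ?S t x)"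
      proof (cases "0 < t \<and> t < T")
        case True
        then have t: "0 \<le> t" "t \<le> T" by auto
        have bx: "(\<lambda>x. b (t, x)) \<in> borel_measurable borel"
          using measurable_compose[OF measurable_Pair1' bm, of t] by simp
        have "(LINT x|lborel. ?S t x) = (LINT x|lborel. indicator \<Omega> x * b (t, x))" using True by simp
        also have "\<dots> = (LINT x|lebesgue. indicator \<Omega> x * b (t, x))"
          by (rule integral_completion[symmetric]) (use bx Ob in simp)
        also have "\<dots> = (LINT x|lebesgue. indicator \<Omega> x * indicator ?C (\<phi> x t))" using True by (simp add: b_def clamped_flow_def)
        finally show ?thesis using in_C[OF t] True by simp
      qed auto
    qed
    also have "\<dots> = (LINT x|lborel. LINT t|lborel. ?S t x)" by (rule lborel_pair.Fubini_integral[OF iS, symmetric])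
    also have "\<dots> = (LINT x|lborel. indicator \<Omega> x * w x)"
      unfolding w_def integral_mult_right_zero[symmetric] by (simp add: mult_ac)
    finally show ?thesis .
  qed
  define Z where "Z = {x \<in> \<Omega>. w x < T / 2}"
  have Zb: "Z \<in> sets borel"
  proof -
    have "{x \<in> space borel. w x < T / 2} \<in> sets borel" by measurable
    then have "\<Omega> \<inter> {x. w x < T / 2} \<in> sets borel" using Ob by auto
    then show ?thesis by (simp add: Z_def Int_def)
  qed
  have Zl: "Z \<in> lmeasurable"
    by (rule bounded_set_imp_lmeasurable) (use bounded_\<Omega> Zb in \<open>auto simp: Z_def sets_completionI_sets intro: bounded_subset\<close>)
  have Hl: "H \<in> lmeasurable"
    by (rule bounded_set_imp_lmeasurable[OF _ Hs]) (use bounded_\<Omega> in \<open>auto simp: H_def intro: bounded_subset\<close>)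
  have iZ: "integrable lborel (indicator Z :: real^2 \<Rightarrow> real)"
    using Zl Zb by (intro integrable_real_indicator) (auto simp: fmeasurable_def)
  have "(LINT x|lborel. indicator \<Omega> x * w x) \<le> (LINT x|lborel. T * indicator \<Omega> x - (T / 2) * indicator Z x)"
  proof (rule integral_mono)
    show "integrable lborel (\<lambda>x. indicator \<Omega> x * w x)"
    proof (rule Bochner_Integration.integrable_bound[of lborel "\<lambda>x. indicator \<Omega> x * T"])
      show "(\<lambda>x. indicator \<Omega> x * w x) \<in> borel_measurable lborel" using wm Ob by simp
      show "AE x in lborel. norm (indicator \<Omega> x * w x) \<le> norm (indicator \<Omega> x * T)"
        using wT w0 T_pos by (intro AE_I2) (auto split: split_indicator)
    qed (use i\<Omega> in auto)
    show "integrable lborel (\<lambda>x. T * indicator \<Omega> x - (T / 2) * indicator Z x)" using i\<Omega> iZ by simp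
    show "indicator \<Omega> x * w x \<le> T * indicator \<Omega> x - (T / 2) * indicator Z x" for x
      using wT[of x] by (auto simp: Z_def split: split_indicator)
  qed
  also have "\<dots> = (LINT x|lborel. T * indicator \<Omega> x) - (LINT x|lborel. (T / 2) * indicator Z x)"
    by (rule Bochner_Integration.integral_diff) (use i\<Omega> iZ in auto)
  also have "\<dots> = T * measure lebesgue \<Omega> - T / 2 * measure lebesgue Z" using Ob Zb by simp
  finally have "T * (measure lebesgue \<Omega> - \<kappa>) \<le> T * measure lebesgue \<Omega> - T / 2 * measure lebesgue Z" using total by linarith
  then have "T * (measure lebesgue Z / 2) \<le> T * \<kappa>" by (simp add: algebra_simps)
  then have Z: "measure lebesgue Z \<le> 2 * \<kappa>" using T_pos by simp
  have sub: "\<Omega> \<subseteq> H \<union> Z"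
  proof
    fix x assume x: "x \<in> \<Omega>"
    show "x \<in> H \<union> Z"
    proof (cases "w x < T / 2")
      case True then show ?thesis using x by (simp add: Z_def)
    next
      case False
      then have "d * (T / 2) \<le> d * w x" using d by (intro mult_left_mono) auto
      then have "d * T / 2 \<le> travel_distance (velocity \<theta>) \<phi> x T" using travel[of x] by simp
      then have "d / 2 \<le> travel_distance (velocity \<theta>) \<phi> x T / T" using T_pos by (simp add: field_simps)
      then show ?thesis using x by (simp add: H_def)
    qed
  qed
  have "measure lebesgue \<Omega> \<le> measure lebesgue (H \<union> Z)"
    using \<Omega>_lmeasurable Hl Zl sub by (intro measure_mono_fmeasurable) auto
  also have "\<dots> \<le> measure lebesgue H + measure lebesgue Z" using Hl Zl by (intro measure_Un_le) auto
  finally have 1: "measure lebesgue \<Omega> - 2 * \<kappa> \<le> measure lebesgue H" using Z by linarith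
  have "\<kappa> = (pi * K\<^sup>2 + (9 + R\<^sup>2)) * (d * d)" by (simp add: \<kappa>_def power2_eq_square algebra_simps)
  also have "\<dots> \<le> (pi * K\<^sup>2 + (9 + R\<^sup>2)) * (d * 1)" using d by (intro mult_left_mono) auto
  finally have "\<kappa> \<le> (pi * K\<^sup>2 + (9 + R\<^sup>2)) * d" unfolding mult_1_right .
  then show "measure lebesgue \<Omega> - 2 * (pi * K\<^sup>2 + (9 + R\<^sup>2)) * d \<le> measure lebesgue H"
    using 1 unfolding mult.assoc[of 2] by linarith
qed

end

section \<open>Existence of particles travelling far\<close>

lemma window_exists:
  assumes "euler_weak_solution (indicator \<Omega>) \<theta>" "particle_trajectories (velocity \<theta>) \<phi>" "open \<Omega>" "bounded \<Omega>" "0 < T"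
  obtains M where "yudovich_flow \<Omega> \<theta> \<phi> T M"
proof -
  obtain M where M: "\<forall>t\<in>{0..T}. integrable lebesgue (\<theta> t) \<and>
        (LINT x|lebesgue. \<bar>\<theta> t x\<bar>) \<le> M \<and> (AE x in lebesgue. \<bar>\<theta> t x\<bar> \<le> M)"
    using assms(1,5) unfolding euler_weak_solution_def by blast
  have "yudovich_flow \<Omega> \<theta> \<phi> T (max M 1)"
  proof
    fix t assume "0 \<le> t" "t \<le> T"
    then have "integrable lebesgue (\<theta> t)" "(LINT x|lebesgue. \<bar>\<theta> t x\<bar>) \<le> M" "AE x in lebesgue. \<bar>\<theta> t x\<bar> \<le> M" using M by auto
    then show "bounded_vorticity (max M 1) (\<theta> t)" unfolding bounded_vorticity_def by (auto elim!: eventually_mono)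
  qed (use assms in auto)
  then show ?thesis by (rule that)
qed

text \<open>
  Points that belong to infinitely many of the sets: the tail unions decrease and each contains one of the sets.
\<close>

lemma limsup_set_measure:
  fixes H :: "nat \<Rightarrow> 'a::euclidean_space set"
  assumes H: "\<And>n. H n \<in> sets lebesgue" "\<And>n. H n \<subseteq> \<Omega>" and \<Omega>: "\<Omega> \<in> lmeasurable"
    and a: "\<And>n. a \<le> measure lebesgue (H n)"
  shows "(\<Inter>m. \<Union>n\<in>{m..}. H n) \<in> sets lebesgue" "a \<le> measure lebesgue (\<Inter>m. \<Union>n\<in>{m..}. H n)"
proof -
  let ?A = "\<lambda>m. \<Union>n\<in>{m..}. H n"
  have As: "?A m \<in> sets lebesgue" for m using H(1) by (intro sets.countable_UN') auto
  then show "(\<Inter>m. ?A m) \<in> sets lebesgue" by (intro sets.countable_INT) auto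
  have Al: "?A m \<in> lmeasurable" for m by (rule fmeasurableI2[OF \<Omega> _ As]) (use H(2) in auto)
  have "(\<lambda>m. measure lebesgue (?A m)) \<longlonglongrightarrow> measure lebesgue (\<Inter>m. ?A m)"
  proof (rule Lim_measure_decseq)
    show "range ?A \<subseteq> sets lebesgue" using As by auto
    show "decseq ?A" by (rule decseq_SucI) (intro UN_mono, auto)
    show "emeasure lebesgue (?A i) \<noteq> \<infinity>" for i using Al[of i] unfolding fmeasurable_def by auto
  qed
  then show "a \<le> measure lebesgue (\<Inter>m. ?A m)"
  proof (rule LIMSEQ_le_const)
    have "a \<le> measure lebesgue (?A m)" for m
      by (rule order_trans[OF a[of m] measure_mono_fmeasurable]) (use H(1) Al in auto)
    then show "\<exists>N. \<forall>n\<ge>N. a \<le> measure lebesgue (?A n)" by blast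
  qed
qed

theorem theorem1p1:
  fixes R :: real
  assumes "R > 0"
  shows "\<exists>\<delta>\<^sub>0>0. \<exists>C>0. \<exists>c>0.
    \<forall>\<Omega>\<^sub>0 :: (real^2) set. \<forall>\<theta> \<phi>.
      bounded \<Omega>\<^sub>0 \<and> open \<Omega>\<^sub>0 \<and> \<Omega>\<^sub>0 \<subseteq> ball 0 R \<and>
      measure lebesgue (sym_diff (ball 0 1) \<Omega>\<^sub>0) < \<delta>\<^sub>0 \<and>
      euler_weak_solution (indicator \<Omega>\<^sub>0) \<theta> \<and>
      particle_trajectories (velocity \<theta>) \<phi>
    \<longrightarrow>
      (\<forall>\<delta>>0. measure lebesgue (sym_diff (ball 0 1) \<Omega>\<^sub>0) \<le> \<delta> \<and> \<delta> \<le> \<delta>\<^sub>0 \<longrightarrow>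
        (\<exists>H \<in> sets lebesgue. H \<subseteq> \<Omega>\<^sub>0 \<and>
          measure lebesgue H \<ge> measure lebesgue \<Omega>\<^sub>0 - C * \<delta> powr (1/4) \<and>
          (\<forall>x\<in>H. Limsup at_top (\<lambda>t. ereal (travel_distance (velocity \<theta>) \<phi> x t / t))
                     \<ge> ereal (c * \<delta> powr (1/2))))) \<and>
      (\<forall>\<delta>>0. measure lebesgue (sym_diff (ball 0 1) \<Omega>\<^sub>0) \<le> \<delta> \<and> \<delta> \<le> \<delta>\<^sub>0 \<longrightarrow>
        (\<forall>T>0. \<exists>H \<in> sets lebesgue. H \<subseteq> \<Omega>\<^sub>0 \<and>
          measure lebesgue H \<ge> measure lebesgue \<Omega>\<^sub>0 - C * \<delta> powr (1/4) \<and>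
          (\<forall>x\<in>H. travel_distance (velocity \<theta>) \<phi> x T / T \<ge> c * \<delta> powr (1/4))))"
proof -
  define K where "K = 2880 * (1 + 3 * sqrt (9 + R\<^sup>2))"
  define C where "C = 2 * (pi * K\<^sup>2 + (9 + R\<^sup>2))"
  have C: "0 < C" unfolding C_def by (simp add: add_nonneg_pos add_pos_nonneg)
  have fixed_time: "{x \<in> \<Omega>. \<delta> powr (1/4) / 2 \<le> travel_distance (velocity \<theta>) \<phi> x T / T} \<in> sets lebesgue \<and>
      measure lebesgue \<Omega> - C * \<delta> powr (1/4) \<le> measure lebesgue {x \<in> \<Omega>. \<delta> powr (1/4) / 2 \<le> travel_distance (velocity \<theta>) \<phi> x T / T}"
    if \<Omega>: "bounded \<Omega>" "open \<Omega>" "\<Omega> \<subseteq> ball 0 R" and sol: "euler_weak_solution (indicator \<Omega>) \<theta>" "particle_trajectories (velocity \<theta>) \<phi>"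
      and \<delta>: "0 < \<delta>" "\<delta> \<le> 1" "measure lebesgue (sym_diff (ball 0 1) \<Omega>) \<le> \<delta>" and T: "0 < T"
    for \<Omega> :: "(real^2) set" and \<theta> \<phi> \<delta> T
  proof -
    obtain M where "yudovich_flow \<Omega> \<theta> \<phi> T M" using window_exists[OF sol \<Omega>(2,1) T] .
    then interpret yudovich_flow \<Omega> \<theta> \<phi> T M .
    have d: "0 < \<delta> powr (1/4)" "\<delta> powr (1/4) \<le> 1" using \<delta> by (auto simp: powr_le1)
    have "(\<delta> powr (1/4)) ^ 4 = \<delta>" using \<delta> by (simp add: powr_power)
    then have m: "measure lebesgue (sym_diff (ball 0 1) \<Omega>) \<le> (\<delta> powr (1/4)) ^ 4" using \<delta> by simp
    show ?thesis using most_particles_travel[OF \<Omega>(3) d m K_def] unfolding C_def by blast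
  qed
  show ?thesis
  proof (rule exI[of _ 1], rule conjI[OF zero_less_one], rule exI[of _ C], rule conjI[OF C],
      rule exI[of _ "1/2"], rule conjI[OF half_gt_zero[OF zero_less_one]], intro allI impI conjI)
    fix \<Omega> :: "(real^2) set" and \<theta> \<phi> \<delta>
    assume asm: "bounded \<Omega> \<and> open \<Omega> \<and> \<Omega> \<subseteq> ball 0 R \<and> measure lebesgue (sym_diff (ball 0 1) \<Omega>) < 1 \<and>
      euler_weak_solution (indicator \<Omega>) \<theta> \<and> particle_trajectories (velocity \<theta>) \<phi>"
      and \<delta>: "0 < \<delta>" "measure lebesgue (sym_diff (ball 0 1) \<Omega>) \<le> \<delta> \<and> \<delta> \<le> 1"
    have ft: "{x \<in> \<Omega>. \<delta> powr (1/4) / 2 \<le> travel_distance (velocity \<theta>) \<phi> x T / T} \<in> sets lebesgue \<and>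
      measure lebesgue \<Omega> - C * \<delta> powr (1/4) \<le> measure lebesgue {x \<in> \<Omega>. \<delta> powr (1/4) / 2 \<le> travel_distance (velocity \<theta>) \<phi> x T / T}"
      if "0 < T" for T
    proof (rule fixed_time)
      show "bounded \<Omega>" "open \<Omega>" "\<Omega> \<subseteq> ball 0 R" "euler_weak_solution (indicator \<Omega>) \<theta>" "particle_trajectories (velocity \<theta>) \<phi>"
        using asm by blast+
      show "0 < \<delta>" "\<delta> \<le> 1" "measure lebesgue (sym_diff (ball 0 1) \<Omega>) \<le> \<delta>" using \<delta> by blast+
      show "0 < T" by (rule that)
    qed
    {
      \<comment> \<open>A particle counted at infinitely many integer times has the required upper limit; the times start at 1.\<close>
      define H where "H n = {x \<in> \<Omega>. \<delta> powr (1/4) / 2 \<le> travel_distance (velocity \<theta>) \<phi> x (real (Suc n)) / real (Suc n)}" for n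
      have Hn: "H n \<in> sets lebesgue" "H n \<subseteq> \<Omega>" "measure lebesgue \<Omega> - C * \<delta> powr (1/4) \<le> measure lebesgue (H n)" for n
      proof -
        have p: "0 < real (Suc n)" by simp
        show "H n \<in> sets lebesgue" "measure lebesgue \<Omega> - C * \<delta> powr (1/4) \<le> measure lebesgue (H n)"
          unfolding H_def using ft[OF p] by blast+
        show "H n \<subseteq> \<Omega>" unfolding H_def by blast
      qed
      have \<Omega>l: "\<Omega> \<in> lmeasurable" using asm by (intro bounded_set_imp_lmeasurable) auto
      note lim = limsup_set_measure[of H, OF Hn(1,2) \<Omega>l Hn(3)]
      show "\<exists>H\<in>sets lebesgue. H \<subseteq> \<Omega> \<and> measure lebesgue \<Omega> - C * \<delta> powr (1/4) \<le> measure lebesgue H \<and>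
         (\<forall>x\<in>H. ereal (1/2 * \<delta> powr (1/2)) \<le> Limsup at_top (\<lambda>t. ereal (travel_distance (velocity \<theta>) \<phi> x t / t)))"
      proof (intro bexI[of _ "\<Inter>m. \<Union>n\<in>{m..}. H n"] conjI ballI lim)
        show "(\<Inter>m. \<Union>n\<in>{m..}. H n) \<subseteq> \<Omega>" using Hn(2) by blast
        fix x assume x: "x \<in> (\<Inter>m. \<Union>n\<in>{m..}. H n)"
        show "ereal (1/2 * \<delta> powr (1/2)) \<le> Limsup at_top (\<lambda>t. ereal (travel_distance (velocity \<theta>) \<phi> x t / t))"
        proof (rule ccontr)
          assume "\<not> ereal (1/2 * \<delta> powr (1/2)) \<le> Limsup at_top (\<lambda>t. ereal (travel_distance (velocity \<theta>) \<phi> x t / t))"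
          then have "Limsup at_top (\<lambda>t. ereal (travel_distance (velocity \<theta>) \<phi> x t / t)) < ereal (1/2 * \<delta> powr (1/2))" by simp
          then have "\<forall>\<^sub>F t in at_top. ereal (travel_distance (velocity \<theta>) \<phi> x t / t) < ereal (1/2 * \<delta> powr (1/2))" by (rule Limsup_lessD)
          then obtain t0 where t0: "\<And>t. t0 \<le> t \<Longrightarrow> travel_distance (velocity \<theta>) \<phi> x t / t < 1/2 * \<delta> powr (1/2)"
            unfolding eventually_at_top_linorder by auto
          obtain m where m: "t0 \<le> real m" using real_arch_simple by blast
          obtain n where n: "m \<le> n" "x \<in> H n" using x by auto
          have "travel_distance (velocity \<theta>) \<phi> x (real (Suc n)) / real (Suc n) < 1/2 * \<delta> powr (1/2)"
            using m n by (intro t0) linarith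
          also have "\<delta> powr (1/2) \<le> \<delta> powr (1/4)" using \<delta> by (intro powr_mono') auto
          finally show False using n(2) by (simp add: H_def)
        qed
      qed
    }
    {
      fix T :: real assume "0 < T"
      let ?H = "{x \<in> \<Omega>. \<delta> powr (1/4) / 2 \<le> travel_distance (velocity \<theta>) \<phi> x T / T}"
      note ftT = ft[OF \<open>0 < T\<close>]
      show "\<exists>H\<in>sets lebesgue. H \<subseteq> \<Omega> \<and> measure lebesgue \<Omega> - C * \<delta> powr (1/4) \<le> measure lebesgue H \<and>
         (\<forall>x\<in>H. 1/2 * \<delta> powr (1/4) \<le> travel_distance (velocity \<theta>) \<phi> x T / T)"
      proof (rule bexI[of _ ?H])
        show "?H \<in> sets lebesgue" using ftT by (rule conjunct1)
        have "\<forall>x\<in>?H. 1/2 * \<delta> powr (1/4) \<le> travel_distance (velocity \<theta>) \<phi> x T / T" by simp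
        then show "?H \<subseteq> \<Omega> \<and> measure lebesgue \<Omega> - C * \<delta> powr (1/4) \<le> measure lebesgue ?H \<and>
         (\<forall>x\<in>?H. 1/2 * \<delta> powr (1/4) \<le> travel_distance (velocity \<theta>) \<phi> x T / T)"
          using conjunct2[OF ftT] by blast
      qed
    }
  qed
qed

end
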